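(* The problem of listing maximal obstacle-free convex hulls is proximity searchable, and it can be solved (every solution output exactly once) with $O(j^2h(h+\log j))=O(n^4)$ time delay.
   Context: Input: a set $V$ of $j$ points and a set $X$ of $h$ obstacle points in the plane, $n=j+h$. An obstacle-free convex hull is a set $S\subseteq V$ whose convex hull contains no point of $X$; solutions to list are the inclusion-maximal such sets. A listing problem with universe $\mathcal{U}$ (here $V$) and set $\mathcal{S}$ of solutions to list is proximity searchable if there exist $\tilde{\cap}:\mathcal{S}\times\mathcal{S}\to 2^{\mathcal{U}}$ and $\mathrm{neighbors}:\mathcal{S}\to 2^{\mathcal{S}}$ such that one solution can be found in time polynomial in $|\mathcal{U}|$, $\mathrm{neighbors}$ is computable in time polynomial in $|\mathcal{U}|$, and for any two distinct $S,S^*\in\mathcal{S}$ some $S'\in\mathrm{neighbors}(S)$ satisfies $|S'\,\tilde{\cap}\,S^*|>|S\,\tilde{\cap}\,S^*|$. Delay is the maximum time before the first output, between consecutive outputs, and after the last output.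
   Formalization: In "proximity searchable", "time polynomial in |U|" is read as polynomial in n = j + h, since reading the h obstacles already takes time not bounded in j alone; the bound O(j^2 h(h+log j)) is claimed for j, h ≥ 1 (it is 0 otherwise), and O(n^4) for n ≥ 1. *)

theory Defs
  imports "HOL-Analysis.Analysis" "HOL-Computational_Algebra.Polynomial"
begin

section \<open>Real RAM\<close>

text \<open>
  Running times refer to a real RAM, the usual model of computational geometry, presented as a
  structured while-language. The memory consists of natural-number arrays and real arrays; a
  program names finitely many of them (array names are constants of the program text), while the
  positions inside an array are computed, i.e. addressing is indirect. Every operation on
  numbers, every memory access and every elementary command takes unit time. On natural numbers
  only addition, truncated subtraction and comparison are provided (unit-cost multiplication would
  make the model unrealistically strong); on reals there are the field operations and comparison,
  but neither rounding nor irrational constants, and no way of turning a real into an address.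
\<close>

datatype nexp =
    NConst nat
  | NGet nat nexp
  | NAdd nexp nexp
  | NSub nexp nexp

datatype rexp =
    RConst nat
  | RGet nat nexp
  | RAdd rexp rexp
  | RSub rexp rexp
  | RMul rexp rexp
  | RDiv rexp rexp

datatype bexp =
    NLess nexp nexp
  | RLess rexp rexp
  | BNot bexp
  | BAnd bexp bexp

text \<open>
  A solution is written element by element: \<open>Emit\<close> appends a number to the solution under
  construction, \<open>Commit\<close> completes that solution and outputs it.
\<close>

datatype com =
    Skip
  | NSet nat nexp nexp
  | RSet nat nexp rexp
  | Emit nexp
  | Commit
  | Seq com com
  | If bexp com com
  | While bexp com

text \<open>The field \<open>outputs\<close> records the solutions output so far, each with its completion time.\<close>

record state =
  nat_mem :: "nat \<Rightarrow> nat \<Rightarrow> nat"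
  real_mem :: "nat \<Rightarrow> nat \<Rightarrow> real"
  clock :: nat
  buffer :: "nat list"
  outputs :: "(nat \<times> nat list) list"

fun neval :: "nexp \<Rightarrow> state \<Rightarrow> nat" where
  "neval (NConst n) s = n"
| "neval (NGet a e) s = nat_mem s a (neval e s)"
| "neval (NAdd e1 e2) s = neval e1 s + neval e2 s"
| "neval (NSub e1 e2) s = neval e1 s - neval e2 s"

fun reval :: "rexp \<Rightarrow> state \<Rightarrow> real" where
  "reval (RConst n) s = real n"
| "reval (RGet a e) s = real_mem s a (neval e s)"
| "reval (RAdd e1 e2) s = reval e1 s + reval e2 s"
| "reval (RSub e1 e2) s = reval e1 s - reval e2 s"
| "reval (RMul e1 e2) s = reval e1 s * reval e2 s"
| "reval (RDiv e1 e2) s = reval e1 s / reval e2 s"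

fun beval :: "bexp \<Rightarrow> state \<Rightarrow> bool" where
  "beval (NLess e1 e2) s \<longleftrightarrow> neval e1 s < neval e2 s"
| "beval (RLess e1 e2) s \<longleftrightarrow> reval e1 s < reval e2 s"
| "beval (BNot b) s \<longleftrightarrow> \<not> beval b s"
| "beval (BAnd b1 b2) s \<longleftrightarrow> beval b1 s \<and> beval b2 s"

fun ncost :: "nexp \<Rightarrow> nat" where
  "ncost (NConst n) = 1"
| "ncost (NGet a e) = 1 + ncost e"
| "ncost (NAdd e1 e2) = 1 + ncost e1 + ncost e2"
| "ncost (NSub e1 e2) = 1 + ncost e1 + ncost e2"

fun rcost :: "rexp \<Rightarrow> nat" where
  "rcost (RConst n) = 1"
| "rcost (RGet a e) = 1 + ncost e"
| "rcost (RAdd e1 e2) = 1 + rcost e1 + rcost e2"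
| "rcost (RSub e1 e2) = 1 + rcost e1 + rcost e2"
| "rcost (RMul e1 e2) = 1 + rcost e1 + rcost e2"
| "rcost (RDiv e1 e2) = 1 + rcost e1 + rcost e2"

fun bcost :: "bexp \<Rightarrow> nat" where
  "bcost (NLess e1 e2) = 1 + ncost e1 + ncost e2"
| "bcost (RLess e1 e2) = 1 + rcost e1 + rcost e2"
| "bcost (BNot b) = 1 + bcost b"
| "bcost (BAnd b1 b2) = 1 + bcost b1 + bcost b2"

definition tick :: "nat \<Rightarrow> state \<Rightarrow> state" where
  "tick k s = s\<lparr>clock := clock s + k\<rparr>"

definition nat_store :: "nat \<Rightarrow> nat \<Rightarrow> nat \<Rightarrow> state \<Rightarrow> state" where
  "nat_store a i v s = s\<lparr>nat_mem := (nat_mem s)(a := (nat_mem s a)(i := v))\<rparr>"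

definition real_store :: "nat \<Rightarrow> nat \<Rightarrow> real \<Rightarrow> state \<Rightarrow> state" where
  "real_store a i v s = s\<lparr>real_mem := (real_mem s)(a := (real_mem s a)(i := v))\<rparr>"

definition emit :: "nat \<Rightarrow> state \<Rightarrow> state" where
  "emit v s = s\<lparr>buffer := buffer s @ [v]\<rparr>"

definition commit :: "state \<Rightarrow> state" where
  "commit s = s\<lparr>buffer := [], outputs := outputs s @ [(clock s, buffer s)]\<rparr>"

text \<open>\<open>exec c s t\<close>: started in \<open>s\<close>, the program \<open>c\<close> terminates in \<open>t\<close>.\<close>

inductive exec :: "com \<Rightarrow> state \<Rightarrow> state \<Rightarrow> bool" where
  exec_Skip: "exec Skip s (tick 1 s)"
| exec_NSet: "exec (NSet a e1 e2) s
    (tick (1 + ncost e1 + ncost e2) (nat_store a (neval e1 s) (neval e2 s) s))"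
| exec_RSet: "exec (RSet a e1 e2) s
    (tick (1 + ncost e1 + rcost e2) (real_store a (neval e1 s) (reval e2 s) s))"
| exec_Emit: "exec (Emit e) s (tick (1 + ncost e) (emit (neval e s) s))"
| exec_Commit: "exec Commit s (commit (tick 1 s))"
| exec_Seq: "exec c1 s s' \<Longrightarrow> exec c2 s' s'' \<Longrightarrow> exec (Seq c1 c2) s s''"
| exec_IfTrue: "beval b s \<Longrightarrow> exec c1 (tick (1 + bcost b) s) s' \<Longrightarrow> exec (If b c1 c2) s s'"
| exec_IfFalse: "\<not> beval b s \<Longrightarrow> exec c2 (tick (1 + bcost b) s) s' \<Longrightarrow> exec (If b c1 c2) s s'"
| exec_WhileTrue: "beval b s \<Longrightarrow> exec c (tick (1 + bcost b) s) s' \<Longrightarrow> exec (While b c) s' s'' \<Longrightarrow>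
    exec (While b c) s s''"
| exec_WhileFalse: "\<not> beval b s \<Longrightarrow> exec (While b c) s (tick (1 + bcost b) s)"

inductive_cases exec_SkipE: "exec Skip s t"
inductive_cases exec_NSetE: "exec (NSet a e1 e2) s t"
inductive_cases exec_RSetE: "exec (RSet a e1 e2) s t"
inductive_cases exec_EmitE: "exec (Emit e) s t"
inductive_cases exec_CommitE: "exec Commit s t"
inductive_cases exec_SeqE: "exec (Seq c1 c2) s t"
inductive_cases exec_IfE: "exec (If b c1 c2) s t"
inductive_cases exec_WhileE: "exec (While b c) s t"

lemma exec_deterministic: "exec c s t \<Longrightarrow> exec c s t' \<Longrightarrow> t = t'"
proof (induction arbitrary: t' rule: exec.induct)
  case (exec_Seq c1 s s' c2 s'')
  from exec_Seq.prems show ?case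
    by (rule exec_SeqE) (use exec_Seq.IH in metis)
next
  case (exec_IfTrue b s c1 s' c2)
  from exec_IfTrue.prems show ?case
    by (rule exec_IfE) (use exec_IfTrue.IH[simplified] exec_IfTrue.hyps in metis)+
next
  case (exec_IfFalse b s c2 s' c1)
  from exec_IfFalse.prems show ?case
    by (rule exec_IfE) (use exec_IfFalse.IH[simplified] exec_IfFalse.hyps in metis)+
next
  case (exec_WhileTrue b s c s' s'')
  from exec_WhileTrue.prems show ?case
    by (rule exec_WhileE) (use exec_WhileTrue.IH[simplified] exec_WhileTrue.hyps in metis)+
next
  case (exec_WhileFalse b s c)
  from exec_WhileFalse.prems show ?case
    by (rule exec_WhileE) (use exec_WhileFalse.hyps in simp_all)
next
  case exec_Skip then show ?case by (auto elim: exec_SkipE)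
next
  case exec_NSet then show ?case by (auto elim: exec_NSetE)
next
  case exec_RSet then show ?case by (auto elim: exec_RSetE)
next
  case exec_Emit then show ?case by (auto elim: exec_EmitE)
next
  case exec_Commit then show ?case by (auto elim: exec_CommitE)
qed

text \<open>
  The rows of the input occupy the arrays 0, 1, 2, ... of the respective kind; all
  other cells are 0.
\<close>

definition row_mem :: "'a::zero list list \<Rightarrow> nat \<Rightarrow> nat \<Rightarrow> 'a" where
  "row_mem xss a i = (if a < length xss \<and> i < length (xss ! a) then xss ! a ! i else 0)"

definition initial_state :: "nat list list \<Rightarrow> real list list \<Rightarrow> state" where
  "initial_state ns rs =
     \<lparr>nat_mem = row_mem ns, real_mem = row_mem rs, clock = 0, buffer = [], outputs = []\<rparr>"

definition delay :: "state \<Rightarrow> nat" where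
  "delay s = (let ts = 0 # map fst (outputs s) @ [clock s]
              in Max {ts ! Suc i - ts ! i | i. Suc i < length ts})"


section \<open>Listing problems\<close>

text \<open>
  A presentation \<open>(us, ns, rs)\<close> of an instance consists of an enumeration \<open>us\<close> of the universe,
  whose only role is to let programs denote the element \<open>us ! i\<close> by the number \<open>i\<close>, and of the
  input data \<open>ns\<close> and \<open>rs\<close> actually handed to the program.
\<close>

record ('i, 'u) listing_problem =
  instances :: "'i set"
  universe :: "'i \<Rightarrow> 'u set"
  solutions :: "'i \<Rightarrow> 'u set set"
  input_size :: "'i \<Rightarrow> nat"
  presentations :: "'i \<Rightarrow> ('u list \<times> nat list \<times> real list list) set"

definition denotes :: "'u list \<Rightarrow> nat list \<Rightarrow> 'u set \<Rightarrow> bool" where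
  "denotes us is S \<longleftrightarrow> distinct is \<and> set is \<subseteq> {..<length us} \<and> S = (\<lambda>i. us ! i) ` set is"

definition finds_solution :: "('i, 'u) listing_problem \<Rightarrow> com \<Rightarrow> nat poly \<Rightarrow> bool" where
  "finds_solution P c p \<longleftrightarrow>
     (\<forall>I \<in> instances P. \<forall>(us, ns, rs) \<in> presentations P I.
        \<exists>s is S. exec c (initial_state [ns] rs) s \<and> clock s \<le> poly p (input_size P I) \<and>
          map snd (outputs s) = [is] \<and> denotes us is S \<and> S \<in> solutions P I)"

text \<open>
  The argument \<open>S\<close> is supplied as a second row: its cardinality followed by the numbers of its
  elements, in any order. The set \<open>f I S\<close> of neighbors depends on \<open>I\<close> and \<open>S\<close> only, not on the
  way they are presented.
\<close>

definition computes_neighbors ::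
    "('i, 'u) listing_problem \<Rightarrow> ('i \<Rightarrow> 'u set \<Rightarrow> 'u set set) \<Rightarrow> com \<Rightarrow> nat poly \<Rightarrow> bool" where
  "computes_neighbors P f c p \<longleftrightarrow>
     (\<forall>I \<in> instances P. \<forall>(us, ns, rs) \<in> presentations P I. \<forall>S \<in> solutions P I. \<forall>is.
        denotes us is S \<longrightarrow>
        (\<exists>s Ss. exec c (initial_state [ns, length is # is] rs) s \<and>
          clock s \<le> poly p (input_size P I) \<and>
          list_all2 (denotes us) (map snd (outputs s)) Ss \<and> set Ss = f I S))"

definition proximity_searchable :: "('i, 'u) listing_problem \<Rightarrow> bool" where
  "proximity_searchable P \<longleftrightarrow>
     (\<exists>prox neighbors.
        (\<forall>I \<in> instances P.
           (\<forall>S \<in> solutions P I. \<forall>T \<in> solutions P I. prox I S T \<subseteq> universe P I) \<and>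
           (\<forall>S \<in> solutions P I. neighbors I S \<subseteq> solutions P I) \<and>
           (\<forall>S \<in> solutions P I. \<forall>T \<in> solutions P I. S \<noteq> T \<longrightarrow>
              (\<exists>S' \<in> neighbors I S. card (prox I S' T) > card (prox I S T)))) \<and>
        (\<exists>c p. finds_solution P c p) \<and>
        (\<exists>c p. computes_neighbors P neighbors c p))"

text \<open>One program lists the solutions of every instance \<open>I\<close>, each exactly once, with delay at
  most \<open>B I\<close>.\<close>

definition listable_with_delay :: "('i, 'u) listing_problem \<Rightarrow> ('i \<Rightarrow> real) \<Rightarrow> bool" where
  "listable_with_delay P B \<longleftrightarrow>
     (\<exists>c. \<forall>I \<in> instances P. \<forall>(us, ns, rs) \<in> presentations P I.
        \<exists>s Ss. exec c (initial_state [ns] rs) s \<and>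
          list_all2 (denotes us) (map snd (outputs s)) Ss \<and>
          distinct Ss \<and> set Ss = solutions P I \<and> real (delay s) \<le> B I)"


section \<open>Obstacle-free convex hulls\<close>

type_synonym point = "real \<times> real"

definition obstacle_free :: "point set \<Rightarrow> point set \<Rightarrow> point set \<Rightarrow> bool" where
  "obstacle_free V X S \<longleftrightarrow> S \<subseteq> V \<and> convex hull S \<inter> X = {}"

definition maximal_obstacle_free :: "point set \<Rightarrow> point set \<Rightarrow> point set \<Rightarrow> bool" where
  "maximal_obstacle_free V X S \<longleftrightarrow>
     obstacle_free V X S \<and> (\<forall>T. obstacle_free V X T \<and> S \<subseteq> T \<longrightarrow> T = S)"

text \<open>
  The input consists of the two cardinalities and of the coordinates of the points, both sets
  being enumerated in an arbitrary order. The size of an instance is the total number of points: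
  the obstacles belong to the input although they are not part of the universe.
\<close>

definition obstacle_free_hulls :: "(point set \<times> point set, point) listing_problem" where
  "obstacle_free_hulls =
     \<lparr>instances = {(V, X). finite V \<and> finite X},
      universe = (\<lambda>(V, X). V),
      solutions = (\<lambda>(V, X). {S. maximal_obstacle_free V X S}),
      input_size = (\<lambda>(V, X). card V + card X),
      presentations = (\<lambda>(V, X).
        {(vs, [length vs, length xs], [map fst vs, map snd vs, map fst xs, map snd xs]) | vs xs.
           distinct vs \<and> set vs = V \<and> distinct xs \<and> set xs = X})\<rparr>"

end

theory Submission
  imports Defs "HOL-Library.Nat_Bijection"
begin

text \<open>
  Adding points greedily in lexicographic order extends every obstacle-free set A to a solution
  \<open>ext A\<close>. Measure the proximity of S and T by their intersection. For v outside S, the obstacles in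
  the convex hull of \<open>insert v S\<close> cut S into at most \<open>h + 1\<close> wedges around v. Each wedge is obstacle-free
  together with v, and every obstacle-free set R with \<open>v \<in> R \<subseteq> insert v S\<close> is contained in v and one
  wedge. Hence the sets \<open>ext (insert v W)\<close>, for the wedges W around all v, serve as neighbors of S: for
  v in T - S one of them contains v and \<open>S \<inter> T\<close>.

  An obstacle lies outside the convex hull of a set iff it sees the set under an angle below 180
  degrees. So it is enough to store, for each obstacle, the first and the last direction in which it
  sees the set under construction; a point is then tested and added in time O(h), and \<open>ext\<close> takes time
  O(jh). A breadth-first search over the solutions, with a table of visited solutions addressed by
  their binary codes, outputs each solution when it leaves the queue, with delay O(j^2 h^2).
\<close>

section \<open>Obstacles seen from a point\<close>

definition cross :: "point \<Rightarrow> point \<Rightarrow> real" where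
  "cross a b = fst a * snd b - snd a * fst b"

definition dot :: "point \<Rightarrow> point \<Rightarrow> real" where
  "dot a b = fst a * fst b + snd a * snd b"

definition ccw :: "point \<Rightarrow> point \<Rightarrow> bool" where
  "ccw a b \<longleftrightarrow> cross a b > 0 \<or> (cross a b = 0 \<and> dot a b \<ge> 0)"

lemma cross_linear:
  "cross a (b + c) = cross a b + cross a c" "cross (b + c) a = cross b a + cross c a"
  "cross a (t *\<^sub>R b) = t * cross a b" "cross (t *\<^sub>R b) a = t * cross b a"
  "cross a (b - c) = cross a b - cross a c" "cross (b - c) a = cross b a - cross c a"
  by (simp_all add: cross_def algebra_simps)

lemma dot_linear:
  "dot a (b + c) = dot a b + dot a c" "dot a (t *\<^sub>R b) = t * dot a b"
  by (simp_all add: dot_def algebra_simps)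

lemma cross_swap: "cross b a = - cross a b"
  by (simp add: cross_def)

lemma cross_self [simp]: "cross a a = 0"
  by (simp add: cross_def)

lemma cross_zero [simp]: "cross a 0 = 0" "cross 0 a = 0"
  by (simp_all add: cross_def)

lemma dot_self_pos: "a \<noteq> 0 \<Longrightarrow> dot a a > 0"
  by (cases a) (auto simp: dot_def zero_prod_def sum_squares_gt_zero_iff)

lemma parallel_scale: "cross a b = 0 \<Longrightarrow> dot a a *\<^sub>R b = dot a b *\<^sub>R a"
proof -
  assume c: "cross a b = 0"
  have "dot a a * fst b - dot a b * fst a = - snd a * cross a b"
    "dot a a * snd b - dot a b * snd a = fst a * cross a b"
    by (simp_all add: cross_def dot_def algebra_simps)
  with c show ?thesis by (simp add: prod_eq_iff)
qed

lemma parallel_dot: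
  assumes "cross a b = 0" "a \<noteq> 0" "b \<noteq> 0"
  shows "dot a b \<noteq> 0"
proof
  assume "dot a b = 0"
  with parallel_scale[OF assms(1)] have "dot a a *\<^sub>R b = 0" by simp
  with dot_self_pos[OF assms(2)] assms(3) show False by simp
qed

lemma parallel_dot_sign:
  assumes "cross a b = 0" "a \<noteq> 0" "dot u a > 0"
  shows "dot u b > 0 \<longleftrightarrow> dot a b > 0"
proof -
  have "dot a a * dot u b = dot a b * dot u a"
    using arg_cong[OF parallel_scale[OF assms(1)], of "dot u"] by (simp add: dot_linear)
  with dot_self_pos[OF assms(2)] assms(3) show ?thesis
    by (metis zero_less_mult_pos zero_less_mult_pos2 zero_less_mult_iff)
qed

lemma three_term: "cross r l *\<^sub>R p = cross p l *\<^sub>R r + cross r p *\<^sub>R l"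
  by (cases r, cases l, cases p) (auto simp: cross_def algebra_simps)

lemma dot_pos_nonzero: "dot u a > 0 \<Longrightarrow> a \<noteq> 0"
  by (auto simp: dot_def)

lemma half_plane_ccw:
  assumes "dot u a > 0" "dot u b > 0"
  shows "ccw a b \<longleftrightarrow> cross a b \<ge> 0"
  using parallel_dot_sign[of a b u] assms dot_pos_nonzero[OF assms(1)]
  unfolding ccw_def by fastforce

lemma half_plane_cross_trans:
  assumes "dot u a > 0" "dot u b > 0" "dot u c > 0" "cross a b \<ge> 0" "cross b c \<ge> 0"
  shows "cross a c \<ge> 0"
proof -
  have "cross a c * dot u b = cross b c * dot u a + cross a b * dot u c"
    using arg_cong[OF three_term[of a c b], of "dot u"] by (simp add: dot_linear)
  also have "\<dots> \<ge> 0" using assms by simp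
  finally show ?thesis using assms(2) by (simp add: zero_le_mult_iff)
qed

lemma hull_half_plane:
  assumes "\<forall>s\<in>P. dot u s > 0" "z \<in> convex hull P"
  shows "dot u z > 0"
proof -
  have "convex {z. dot u z > 0}"
  proof (rule convexI, clarsimp simp: dot_linear)
    fix a b :: real and x y :: point
    assume *: "0 < dot u x" "0 < dot u y" "0 \<le> a" "0 \<le> b" "a + b = 1"
    then have "a > 0 \<or> b > 0" by linarith
    then show "0 < a * dot u x + b * dot u y"
      using * by (auto intro: add_pos_nonneg add_nonneg_pos)
  qed
  then show ?thesis
    using hull_minimal[of P "{z. dot u z > 0}" convex] assms by auto
qed

lemma half_plane_between:
  assumes "r \<noteq> 0" "l \<noteq> 0" "ccw r l" "\<forall>s\<in>P. s \<noteq> 0 \<and> ccw r s \<and> ccw s l"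
  shows "\<exists>u. dot u r > 0 \<and> dot u l > 0 \<and> (\<forall>s\<in>P. dot u s > 0)"
proof (cases "cross r l > 0")
  case True
  define u where "u = (snd l - snd r, fst r - fst l)"
  have u: "dot u s = cross r s + cross s l" for s
    by (simp add: u_def dot_def cross_def algebra_simps)
  have "dot u s > 0" if "s \<in> P" for s
  proof (rule ccontr)
    assume "\<not> dot u s > 0"
    with assms(4) that have "cross r s = 0" "cross s l = 0"
      by (auto simp: u ccw_def)
    then have "cross r l *\<^sub>R s = 0" using three_term[of r l s] by simp
    with True assms(4) that show False by simp
  qed
  moreover have "dot u r > 0" "dot u l > 0" using True by (simp_all add: u)
  ultimately show ?thesis by blast
next
  case False
  with assms(3) have c: "cross r l = 0" "dot r l \<ge> 0" by (auto simp: ccw_def)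
  have rl: "dot r l > 0" using c parallel_dot[of r l] assms(1,2) by force
  have "dot r s > 0" if "s \<in> P" for s
  proof -
    have s: "s \<noteq> 0" "ccw r s" "ccw s l" using assms(4) that by auto
    have "dot r r * cross s l = dot r l * cross s r"
      using arg_cong[OF parallel_scale[OF c(1)], of "cross s"] by (simp add: cross_linear)
    moreover have "cross s l \<ge> 0" using s by (auto simp: ccw_def)
    ultimately have "cross s r \<ge> 0"
      using rl dot_self_pos[OF assms(1)] by (metis mult_nonneg_nonneg zero_le_mult_iff less_le not_le)
    then have "cross r s = 0" using s(2) cross_swap[of s r] by (auto simp: ccw_def)
    then show ?thesis using s parallel_dot[of r s] assms(1) by (force simp: ccw_def)
  qed
  with rl dot_self_pos[OF assms(1)] show ?thesis by blast
qed

definition spanned :: "point \<Rightarrow> point \<Rightarrow> point set \<Rightarrow> bool" where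
  "spanned r l P \<longleftrightarrow> (P = {} \<and> r = 0 \<and> l = 0) \<or>
     (r \<in> P \<and> l \<in> P \<and> (\<exists>u. \<forall>s\<in>P. dot u s > 0) \<and> (\<forall>s\<in>P. cross r s \<ge> 0 \<and> cross s l \<ge> 0))"

definition extends :: "point \<Rightarrow> point \<Rightarrow> point \<Rightarrow> bool" where
  "extends r l p \<longleftrightarrow> dot p p > 0 \<and> (ccw r p \<or> ccw p l)"

lemma spanned_avoids: "spanned r l P \<Longrightarrow> 0 \<notin> convex hull P"
  unfolding spanned_def using hull_half_plane[of P _ 0] by (auto simp: dot_def)

lemma not_ccw_cases: "\<not> ccw a b \<Longrightarrow> cross b a > 0 \<or> (cross a b = 0 \<and> dot a b < 0)"
  unfolding ccw_def using cross_swap[of a b] by linarith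

lemma zero_in_segment:
  assumes "cross a b = 0" "dot a b < 0"
  shows "(0::point) \<in> convex hull {a, b}"
proof -
  have a: "dot a a > 0" using assms dot_self_pos[of a] by (fastforce simp: dot_def)
  let ?d = "dot a a - dot a b"
  have d: "?d > 0" using a assms by linarith
  have "(- dot a b / ?d) *\<^sub>R a + (dot a a / ?d) *\<^sub>R b =
      (1 / ?d) *\<^sub>R (dot a a *\<^sub>R b - dot a b *\<^sub>R a)"
    by (simp add: algebra_simps)
  also have "\<dots> = 0" using parallel_scale[OF assms(1)] by simp
  finally have "(0::point) = (- dot a b / ?d) *\<^sub>R a + (dot a a / ?d) *\<^sub>R b" by simp
  moreover have "- dot a b / ?d \<ge> 0" "dot a a / ?d \<ge> 0" "- dot a b / ?d + dot a a / ?d = 1"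
    using a assms d by (auto simp: divide_simps)
  ultimately show ?thesis unfolding convex_hull_2 by blast
qed

lemma not_extends_hull:
  assumes "spanned r l P" "\<not> extends r l p"
  shows "0 \<in> convex hull (insert p P)"
proof (cases "p = 0")
  case True
  then show ?thesis by (simp add: hull_inc)
next
  case False
  then have n: "\<not> ccw r p" "\<not> ccw p l"
    using assms(2) dot_self_pos unfolding extends_def by auto
  have "P \<noteq> {}" using assms(1) n by (auto simp: spanned_def ccw_def dot_def)
  then obtain u where u: "r \<in> P" "l \<in> P" "\<forall>s\<in>P. dot u s > 0" "cross r l \<ge> 0"
    using assms(1) unfolding spanned_def by auto
  have sub: "convex hull {p, r} \<subseteq> convex hull (insert p P)"
    "convex hull {p, l} \<subseteq> convex hull (insert p P)"
    "convex hull {p, r, l} \<subseteq> convex hull (insert p P)"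
    using u by (auto intro!: hull_mono)
  consider "cross r p = 0 \<and> dot r p < 0" | "cross p l = 0 \<and> dot p l < 0"
    | "cross p r > 0" "cross l p > 0"
    using not_ccw_cases[OF n(1)] not_ccw_cases[OF n(2)] by auto
  then show ?thesis
  proof cases
    case 1
    then show ?thesis using zero_in_segment[of r p] sub by (auto simp: insert_commute)
  next
    case 2
    then show ?thesis using zero_in_segment[of p l] sub by auto
  next
    case 3
    let ?d = "cross r l + cross l p + cross p r"
    have d: "?d > 0" using 3 u by linarith
    have "(cross r l / ?d) *\<^sub>R p + (cross l p / ?d) *\<^sub>R r + (cross p r / ?d) *\<^sub>R l
        = (1 / ?d) *\<^sub>R (cross r l *\<^sub>R p + cross l p *\<^sub>R r + cross p r *\<^sub>R l)"
      by (simp add: algebra_simps)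
    also have "cross r l *\<^sub>R p + cross l p *\<^sub>R r + cross p r *\<^sub>R l = 0"
      using three_term[of r l p] cross_swap[of l p] cross_swap[of p r] by simp
    finally have "(0::point) = (cross r l / ?d) *\<^sub>R p + (cross l p / ?d) *\<^sub>R r + (cross p r / ?d) *\<^sub>R l"
      by simp
    moreover have "cross r l / ?d + cross l p / ?d + cross p r / ?d = 1"
      using d by (simp add: add_divide_distrib[symmetric])
    moreover have "cross r l / ?d \<ge> 0" "cross l p / ?d \<ge> 0" "cross p r / ?d \<ge> 0"
      using 3 u d by auto
    ultimately have "(0::point) \<in> convex hull {p, r, l}" unfolding convex_hull_3 by blast
    with sub show ?thesis by blast
  qed
qed

lemma extends_half_plane:
  assumes "spanned r l P" "P \<noteq> {}" "extends r l p"
  shows "\<exists>u. \<forall>s\<in>insert p P. dot u s > 0"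
proof -
  obtain w where rl: "r \<in> P" "l \<in> P" and w: "\<forall>s\<in>P. dot w s > 0"
    and b: "\<forall>s\<in>P. cross r s \<ge> 0 \<and> cross s l \<ge> 0"
    using assms(1,2) unfolding spanned_def by auto
  have nz: "r \<noteq> 0" "l \<noteq> 0" "p \<noteq> 0"
    using w rl dot_pos_nonzero assms(3) unfolding extends_def by blast+
  have W: "ccw r l" "\<forall>s\<in>P. s \<noteq> 0 \<and> ccw r s \<and> ccw s l"
    using half_plane_ccw[of w] w b rl dot_pos_nonzero[of w] by blast+
  have rot: "cross a c = 0" "dot a c > 0"
    if "cross a b = 0" "a \<noteq> 0" "b \<noteq> 0" "dot a b \<ge> 0" "cross b c = 0" "dot b c > 0" for a b c
  proof -
    have *: "dot b b *\<^sub>R c = dot b c *\<^sub>R b" using parallel_scale that by blast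
    have bb: "dot b b > 0" using dot_self_pos that by blast
    have "dot b b * cross a c = 0" "dot b b * dot a c = dot b c * dot a b"
      using arg_cong[OF *, of "cross a"] arg_cong[OF *, of "dot a"] that
      by (simp_all add: cross_linear dot_linear)
    moreover have "dot a b > 0" using parallel_dot[of a b] that by force
    ultimately show "cross a c = 0" "dot a c > 0" using bb that
      by (auto, metis zero_less_mult_iff zero_less_mult_pos)
  qed
  have "\<exists>u. dot u r > 0 \<and> dot u l > 0 \<and> dot u p > 0"
  proof (cases "ccw r p \<and> ccw p l")
    case True
    then show ?thesis using half_plane_between[of r l "{p}"] nz W by auto
  next
    case F: False
    show ?thesis
    proof (cases "ccw r p")
      case True
      with F have np: "\<not> ccw p l" by simp
      have "ccw l p"
      proof (rule ccontr)
        assume "\<not> ccw l p"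
        with np have a: "cross p l = 0" "dot p l < 0"
          using not_ccw_cases[of p l] not_ccw_cases[of l p] cross_swap[of p l]
          by (auto simp: ccw_def)
        have ls: "dot p p *\<^sub>R l = dot p l *\<^sub>R p" using parallel_scale a by blast
        have pp: "dot p p > 0" using dot_self_pos nz by blast
        have c1: "dot p p * cross r l = dot p l * cross r p"
          and c2: "dot p p * dot r l = dot p l * dot r p"
          using arg_cong[OF ls, of "cross r"] arg_cong[OF ls, of "dot r"]
          by (simp_all add: cross_linear dot_linear)
        have "cross r l \<ge> 0" "cross r p \<ge> 0" using W(1) True by (auto simp: ccw_def)
        then have "cross r l = 0" "cross r p = 0"
          using c1 pp a by (smt (verit) mult_neg_pos mult_nonneg_nonneg mult_pos_pos mult_eq_0_iff)+
        then have "dot r l > 0" "dot r p > 0"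
          using W(1) True parallel_dot[of r l] parallel_dot[of r p] nz by (force simp: ccw_def)+
        then show False using c2 pp a by (smt (verit) mult_neg_pos mult_pos_pos)
      qed
      then show ?thesis using half_plane_between[of r p "{l}"] nz W True by auto
    next
      case False
      with assms(3) have pl: "ccw p l" by (simp add: extends_def)
      have "ccw p r"
      proof (rule ccontr)
        assume "\<not> ccw p r"
        with False have a: "cross p r = 0" "dot p r < 0"
          using not_ccw_cases[of p r] not_ccw_cases[of r p] cross_swap[of p r]
          by (auto simp: ccw_def)
        have ls: "dot p p *\<^sub>R r = dot p r *\<^sub>R p" using parallel_scale a by blast
        have pp: "dot p p > 0" using dot_self_pos nz by blast
        have c1: "dot p p * cross l r = dot p r * cross l p"
          and c2: "dot p p * dot l r = dot p r * dot l p"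
          using arg_cong[OF ls, of "cross l"] arg_cong[OF ls, of "dot l"]
          by (simp_all add: cross_linear dot_linear)
        have "cross l r \<le> 0" "cross l p \<le> 0"
          using W(1) pl cross_swap[of l r] cross_swap[of l p] by (auto simp: ccw_def)
        then have z: "cross l r = 0" "cross l p = 0"
          using c1 pp a by (smt (verit) mult_neg_neg mult_neg_pos mult_pos_pos mult_pos_neg mult_eq_0_iff)+
        then have "dot l r > 0" "dot l p > 0"
          using W(1) pl parallel_dot[of l r] parallel_dot[of l p] nz cross_swap[of l r] cross_swap[of l p]
          by (force simp: ccw_def dot_def mult.commute)+
        then show False using c2 pp a by (smt (verit) mult_neg_pos mult_pos_pos)
      qed
      then show ?thesis using half_plane_between[of p l "{r}"] nz W pl by auto
    qed
  qed
  then obtain u where u: "dot u r > 0" "dot u l > 0" "dot u p > 0" by blast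
  have "dot u s > 0" if s: "s \<in> P" for s
  proof (cases "cross r l = 0")
    case True
    have 1: "dot r l > 0" using parallel_dot_sign[of r l w] True nz w rl by blast
    have "dot r r * cross s l = dot r l * cross s r"
      using arg_cong[OF parallel_scale[OF True], of "cross s"] by (simp add: cross_linear)
    then have "cross s r \<ge> 0"
      using 1 dot_self_pos[OF nz(1)] b s
      by (metis mult_nonneg_nonneg zero_le_mult_iff less_le not_le)
    then have "cross r s = 0" using b s cross_swap[of s r] by force
    then show ?thesis using parallel_dot_sign[of r s] nz u w rl s by blast
  next
    case False
    then have rl0: "cross r l > 0" using b rl by force
    have e: "cross r l * dot u s = cross s l * dot u r + cross r s * dot u l"
      using arg_cong[OF three_term[of r l s], of "dot u"] by (simp add: dot_linear)
    have "\<not> (cross s l = 0 \<and> cross r s = 0)"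
      using three_term[of r l s] rl0 W(2) s by auto
    then have "cross s l * dot u r + cross r s * dot u l > 0"
      using b s u by (metis add_nonneg_pos add_pos_nonneg less_eq_real_def mult_nonneg_nonneg mult_pos_pos)
    with e rl0 show ?thesis by (metis zero_less_mult_pos)
  qed
  with u show ?thesis by blast
qed

lemma spanned_update:
  assumes "spanned r l P" "extends r l p"
  shows "spanned (if ccw p r then p else r) (if ccw l p then p else l) (insert p P)"
proof (cases "P = {}")
  case True
  then have "r = 0" "l = 0" using assms(1) by (auto simp: spanned_def)
  moreover have "dot p p > 0" using assms(2) by (simp add: extends_def)
  ultimately show ?thesis using True unfolding spanned_def by (auto simp: ccw_def dot_def)
next
  case False
  obtain u where u: "\<forall>s\<in>insert p P. dot u s > 0"
    using extends_half_plane[OF assms(1) False assms(2)] by blast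
  have rl: "r \<in> P" "l \<in> P" and b: "\<forall>s\<in>P. cross r s \<ge> 0 \<and> cross s l \<ge> 0"
    using assms(1) False unfolding spanned_def by auto
  have W: "ccw p r \<longleftrightarrow> cross p r \<ge> 0" "ccw l p \<longleftrightarrow> cross l p \<ge> 0"
    using half_plane_ccw[of u] u rl by auto
  let ?r = "if ccw p r then p else r" and ?l = "if ccw l p then p else l"
  have "cross ?r s \<ge> 0" if "s \<in> insert p P" for s
  proof (cases "ccw p r")
    case True
    then show ?thesis using that b W u rl half_plane_cross_trans[of u p r s] by auto
  next
    case False
    then show ?thesis using that b W cross_swap[of p r] by auto
  qed
  moreover have "cross s ?l \<ge> 0" if "s \<in> insert p P" for s
  proof (cases "ccw l p")
    case True
    then show ?thesis using that b W u rl half_plane_cross_trans[of u s l p] by auto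
  next
    case False
    then show ?thesis using that b W cross_swap[of l p] by auto
  qed
  ultimately show ?thesis
    unfolding spanned_def using u rl by (intro disjI2 conjI exI[of _ u]) auto
qed

lemma extends_iff:
  assumes "spanned r l P"
  shows "extends r l p \<longleftrightarrow> 0 \<notin> convex hull (insert p P)"
  using not_extends_hull[OF assms] spanned_avoids[OF spanned_update[OF assms]] by blast

lemma zero_in_hull_translate:
  "0 \<in> convex hull ((\<lambda>s. s - x) ` T) \<longleftrightarrow> x \<in> convex hull (T :: point set)"
  using convex_hull_translation[of "- x" T] by (force simp: image_iff)


definition blocked :: "point set \<Rightarrow> point set \<Rightarrow> point \<Rightarrow> point set" where
  "blocked X S v = {x \<in> X. x \<in> convex hull (insert v S)}"

definition ahead :: "point \<Rightarrow> point option \<Rightarrow> point \<Rightarrow> bool" where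
  "ahead v d z \<longleftrightarrow> (case d of None \<Rightarrow> True | Some x \<Rightarrow> cross (x - v) (z - v) > 0)"

definition wedge :: "point set \<Rightarrow> point set \<Rightarrow> point \<Rightarrow> point option \<Rightarrow> point set" where
  "wedge X S v d = {s \<in> S. ahead v d s \<and>
     (\<forall>y \<in> blocked X S v. ahead v d y \<longrightarrow> cross (y - v) (s - v) < 0)}"

lemma dot_inner: "dot = inner"
  by (simp add: fun_eq_iff dot_def inner_prod_def)

lemma hull_cross_pos:
  assumes "\<forall>s\<in>W. cross a (s - v) > 0" "b \<in> convex hull W"
  shows "cross a (b - v) > 0"
proof -
  have e: "cross a (z - v) > 0 \<longleftrightarrow> inner (- snd a, fst a) z > inner (- snd a, fst a) v" for z
    by (cases z, cases v) (simp add: cross_def inner_prod_def algebra_simps)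
  show ?thesis
    using hull_minimal[of W "{z. inner (- snd a, fst a) z > inner (- snd a, fst a) v}" convex]
      convex_halfspace_gt[of "inner (- snd a, fst a) v" "(- snd a, fst a)"] assms
    unfolding e by blast
qed

lemma hull_cross_neg:
  assumes "\<forall>s\<in>W. cross a (s - v) < 0" "b \<in> convex hull W"
  shows "cross a (b - v) < 0"
  using hull_cross_pos[of W "- a" v b] assms by (auto simp: cross_def algebra_simps)

lemma in_hull_insert:
  assumes "y \<in> convex hull (insert v S)" "y \<noteq> v"
  obtains q w where "q \<in> convex hull S" "0 < w" "w \<le> 1" "y - v = w *\<^sub>R (q - v)"
proof -
  have "S \<noteq> {}" using assms by auto
  then obtain u w b where *: "u \<ge> 0" "w \<ge> 0" "u + w = 1" "b \<in> convex hull S" "y = u *\<^sub>R v + w *\<^sub>R b"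
    using assms(1) unfolding convex_hull_insert[OF \<open>S \<noteq> {}\<close>] by blast
  have u: "u = 1 - w" using * by simp
  have "w \<noteq> 0" using * u assms(2) by auto
  with * u show ?thesis by (intro that[of b w]) (auto simp: algebra_simps)
qed

lemma wedge_avoids:
  assumes "v \<notin> X" "convex hull S \<inter> X = {}"
  shows "convex hull (insert v (wedge X S v d)) \<inter> X = {}"
proof (rule ccontr)
  let ?W = "wedge X S v d"
  assume "\<not> ?thesis"
  then obtain y where y: "y \<in> X" "y \<in> convex hull (insert v ?W)" by blast
  with assms have "y \<noteq> v" by auto
  with y(2) obtain q w where q: "q \<in> convex hull ?W" "0 < w" "w \<le> 1" "y - v = w *\<^sub>R (q - v)"
    by (rule in_hull_insert)
  have "y \<in> blocked X S v"
    using y hull_mono[of "insert v ?W" "insert v S"] by (auto simp: blocked_def wedge_def)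
  moreover have "ahead v d y"
  proof (cases d)
    case (Some x)
    then have "cross (x - v) (q - v) > 0"
      by (intro hull_cross_pos[OF _ q(1)]) (auto simp: wedge_def ahead_def)
    then show ?thesis using Some q by (simp add: ahead_def cross_linear(3))
  qed (simp add: ahead_def)
  ultimately have "cross (y - v) (q - v) < 0"
    by (intro hull_cross_neg[OF _ q(1)]) (auto simp: wedge_def)
  then show False unfolding q(4) by (simp add: cross_linear(4))
qed

text \<open>R lies strictly on one side of the line from v through a blocking obstacle y: a segment between two
  points of R meeting this line would meet it beyond y, as \<open>convex hull S\<close> does, so that
  \<open>convex hull R\<close> would contain y.\<close>

lemma blocked_one_sided:
  assumes S: "convex hull S \<inter> X = {}" and u: "\<forall>s\<in>S. dot u (s - v) > 0"
    and R: "R \<subseteq> insert v S" "v \<in> R" "convex hull R \<inter> X = {}"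
    and y: "y \<in> blocked X S v" and ab: "a \<in> R - {v}" "b \<in> R - {v}"
    and ca: "cross (y - v) (a - v) \<ge> 0"
  shows "cross (y - v) (b - v) > 0"
proof (rule ccontr)
  assume cb: "\<not> ?thesis"
  have yX: "y \<in> X" "y \<in> convex hull (insert v S)" using y by (auto simp: blocked_def)
  have "v \<notin> X" using R by (meson disjoint_iff hull_inc)
  with yX have "y \<noteq> v" by blast
  with yX(2) obtain q w where q: "q \<in> convex hull S" "0 < w" "w \<le> 1" "y - v = w *\<^sub>R (q - v)"
    by (rule in_hull_insert)
  let ?a = "cross (y - v) (a - v)" and ?b = "cross (y - v) (b - v)"
  obtain p where p: "p \<in> convex hull {a, b}" "cross (y - v) (p - v) = 0"
  proof (cases "?a = 0")
    case True
    then show ?thesis by (intro that[of a]) (auto simp: hull_inc)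
  next
    case False
    then have d: "?a - ?b > 0" using ca cb by linarith
    let ?p = "(- ?b / (?a - ?b)) *\<^sub>R a + (?a / (?a - ?b)) *\<^sub>R b"
    have 1: "- ?b / (?a - ?b) + ?a / (?a - ?b) = 1"
      using d by (simp add: add_divide_distrib[symmetric] diff_divide_distrib[symmetric])
    have "?p - v = (- ?b / (?a - ?b)) *\<^sub>R (a - v) + (?a / (?a - ?b)) *\<^sub>R (b - v)
        + (- ?b / (?a - ?b) + ?a / (?a - ?b) - 1) *\<^sub>R v"
      by (simp add: algebra_simps)
    then have "?p - v = (- ?b / (?a - ?b)) *\<^sub>R (a - v) + (?a / (?a - ?b)) *\<^sub>R (b - v)"
      unfolding 1 by simp
    then have "cross (y - v) (?p - v) = 0"
      by (simp add: cross_linear(1,3) del: scaleR_minus_left)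
    moreover have "?p \<in> convex hull {a, b}"
      using 1 d ca cb by (intro convexD[OF convex_convex_hull])
        (auto simp: hull_inc divide_le_0_iff simp del: minus_divide_left)
    ultimately show ?thesis by (rule that[rotated])
  qed
  have pS: "p \<in> convex hull S" and pR: "p \<in> convex hull R"
    using p(1) ab R(1) hull_mono[of "{a, b}" S] hull_mono[of "{a, b}" R] by blast+
  have pos: "dot u (z - v) > 0" if "z \<in> convex hull S" for z
  proof -
    have "z - v \<in> convex hull ((\<lambda>s. s - v) ` S)"
      using that convex_hull_translation[of "- v" S] by (auto simp: image_iff)
    then show ?thesis using hull_half_plane[of "(\<lambda>s. s - v) ` S" u "z - v"] u by auto
  qed
  have yv: "dot u (y - v) > 0" using pos[OF q(1)] q(2) unfolding q(4) by (simp add: dot_linear)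
  define t where "t = dot (y - v) (p - v) / dot (y - v) (y - v)"
  have yy: "dot (y - v) (y - v) > 0" using \<open>y \<noteq> v\<close> dot_self_pos[of "y - v"] by simp
  have "(p - v) = (1 / dot (y - v) (y - v)) *\<^sub>R (dot (y - v) (y - v) *\<^sub>R (p - v))"
    using yy by simp
  also have "\<dots> = t *\<^sub>R (y - v)" unfolding parallel_scale[OF p(2)] t_def by simp
  finally have pt: "p - v = t *\<^sub>R (y - v)" .
  have "t * dot u (y - v) > 0" using pos[OF pS] unfolding pt by (simp add: dot_linear)
  with yv have t: "t > 0" by (metis zero_less_mult_pos2)
  show False
  proof (cases "t \<ge> 1")
    case True
    have "y = (1 - 1 / t) *\<^sub>R v + (1 / t) *\<^sub>R p"
    proof -
      have "(1 / t) *\<^sub>R (p - v) = y - v" using t unfolding pt by simp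
      then show ?thesis by (simp add: algebra_simps)
    qed
    moreover have "v \<in> convex hull R" using R(2) by (simp add: hull_inc)
    ultimately have "y \<in> convex hull R"
      using convexD[OF convex_convex_hull, of v R p "1 - 1 / t" "1 / t"] pR True t by simp
    with R(3) yX show False by blast
  next
    case False
    define c where "c = 1 / w"
    have c: "c \<ge> 1" "q - v = c *\<^sub>R (y - v)" using q unfolding c_def q(4) by auto
    have d: "c - t > 0" using c False by linarith
    let ?l = "(c - 1) / (c - t)"
    have 0: "1 - ?l = (1 - t) / (c - t)" using d by (simp add: field_simps)
    have 1: "?l * t + (1 - ?l) * c = 1" unfolding 0 using d by (simp add: divide_simps) (simp add: algebra_simps)
    have "?l *\<^sub>R p + (1 - ?l) *\<^sub>R q = v + ?l *\<^sub>R (p - v) + (1 - ?l) *\<^sub>R (q - v)"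
      by (simp add: algebra_simps)
    also have "\<dots> = v + (?l * t + (1 - ?l) * c) *\<^sub>R (y - v)"
      unfolding pt c(2) by (simp add: algebra_simps)
    also have "\<dots> = y" unfolding 1 by simp
    finally have "y = ?l *\<^sub>R p + (1 - ?l) *\<^sub>R q" by simp
    moreover have "?l \<ge> 0" "1 - ?l \<ge> 0" unfolding 0 using c d False by auto
    ultimately have "y \<in> convex hull S"
      using convexD[OF convex_convex_hull, of p S q ?l "1 - ?l"] pS q(1) by simp
    with S yX show False by blast
  qed
qed

lemma cross_slope:
  assumes "dot u x > 0" "dot u y > 0"
  shows "cross x y > 0 \<longleftrightarrow> cross u x / dot u x < cross u y / dot u y"
proof -
  have "dot u u * cross x y = dot u x * cross u y - cross u x * dot u y"
    by (simp add: dot_def cross_def algebra_simps)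
  moreover have "dot u u > 0" using assms dot_self_pos[of u] by (force simp: dot_def)
  ultimately have "cross x y > 0 \<longleftrightarrow> dot u x * cross u y - cross u x * dot u y > 0"
    by (metis zero_less_mult_iff less_asym)
  also have "\<dots> \<longleftrightarrow> cross u x / dot u x < cross u y / dot u y"
    using assms by (simp add: divide_less_eq less_divide_eq field_simps)
  finally show ?thesis .
qed

lemma wedge_covers:
  assumes fin: "finite S" "finite X" and S: "convex hull S \<inter> X = {}" and v: "v \<notin> convex hull S"
    and R: "R \<subseteq> insert v S" "v \<in> R" "convex hull R \<inter> X = {}"
  shows "\<exists>d \<in> insert None (Some ` X). R - {v} \<subseteq> wedge X S v d"
proof (cases "S = {}")
  case True
  then show ?thesis using R by auto
next
  case False
  have "compact (convex hull S)" using fin(1) by (simp add: finite_imp_compact_convex_hull)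
  then obtain u c where uc: "inner u v < c" "\<forall>x\<in>convex hull S. inner u x > c"
    using separating_hyperplane_closed_point[of "convex hull S" v] v
    by (auto simp: compact_imp_closed)
  then have "inner u v < inner u s" if "s \<in> S" for s
    using hull_inc[of s S convex] that by (meson order.strict_trans)
  then have u: "\<forall>s\<in>S. dot u (s - v) > 0"
    by (simp add: dot_inner inner_diff_right)
  have vX: "v \<notin> X" using R by (meson disjoint_iff hull_inc)
  note one = blocked_one_sided[OF S u R]
  define L where "L = {y \<in> blocked X S v. \<forall>r\<in>R-{v}. cross (y - v) (r - v) > 0}"
  have neg: "cross (y - v) (r - v) < 0" if "y \<in> blocked X S v" "y \<notin> L" "r \<in> R - {v}" for y r
  proof (rule ccontr)
    assume "\<not> ?thesis"
    then have "\<forall>r'\<in>R-{v}. cross (y - v) (r' - v) > 0" using one that(1,3) by fastforce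
    with that show False by (simp add: L_def)
  qed
  have RS: "R - {v} \<subseteq> S" using R by blast
  show ?thesis
  proof (cases "L = {}")
    case True
    then have "R - {v} \<subseteq> wedge X S v None"
      using RS neg by (auto simp: wedge_def ahead_def)
    then show ?thesis by blast
  next
    case False
    define g where "g z = cross u (z - v) / dot u (z - v)" for z
    have "finite L" using fin by (auto simp: L_def blocked_def)
    then have "Max (g ` L) \<in> g ` L" "\<forall>y\<in>L. g y \<le> Max (g ` L)" using False by auto
    then obtain x where x: "x \<in> L" "\<forall>y\<in>L. g y \<le> g x" by auto
    have pos: "dot u (y - v) > 0" if "y \<in> blocked X S v" for y
    proof -
      have "y \<in> convex hull (insert v S)" "y \<noteq> v" using that vX by (auto simp: blocked_def)
      then obtain q w where q: "q \<in> convex hull S" "0 < w" "y - v = w *\<^sub>R (q - v)"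
        by (rule in_hull_insert)
      have "dot u (q - v) > 0" using uc q(1) by (force simp: dot_inner inner_diff_right)
      then show ?thesis using q by (simp add: dot_linear)
    qed
    have "R - {v} \<subseteq> wedge X S v (Some x)"
    proof
      fix r assume r: "r \<in> R - {v}"
      have "cross (y - v) (r - v) < 0" if "y \<in> blocked X S v" "cross (x - v) (y - v) > 0" for y
      proof (rule neg[OF that(1) _ r])
        have "g x < g y"
          using cross_slope[of u "x - v" "y - v"] pos that x(1) unfolding g_def L_def by auto
        then show "y \<notin> L" using x(2) by force
      qed
      then show "r \<in> wedge X S v (Some x)"
        using r RS x(1) by (auto simp: wedge_def ahead_def L_def)
    qed
    moreover have "x \<in> X" using x(1) by (auto simp: L_def blocked_def)
    ultimately show ?thesis by blast
  qed
qed

section \<open>Greedy extension and neighbors\<close>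

definition lex_less :: "point \<Rightarrow> point \<Rightarrow> bool" where
  "lex_less p q \<longleftrightarrow> fst p < fst q \<or> (fst p = fst q \<and> snd p < snd q)"

definition lex_rank :: "point set \<Rightarrow> point \<Rightarrow> nat" where
  "lex_rank V p = card {q \<in> V. lex_less q p}"

definition pt :: "point set \<Rightarrow> nat \<Rightarrow> point" where
  "pt V r = (THE p. p \<in> V \<and> lex_rank V p = r)"

lemma lex_less_trans: "lex_less p q \<Longrightarrow> lex_less q r \<Longrightarrow> lex_less p r"
  by (auto simp: lex_less_def)

lemma lex_less_irrefl [simp]: "\<not> lex_less p p"
  by (simp add: lex_less_def)

lemma lex_less_total: "p \<noteq> q \<Longrightarrow> lex_less p q \<or> lex_less q p"
  by (auto simp: lex_less_def prod_eq_iff)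

lemma rank_less:
  assumes "finite V" "p \<in> V" "lex_less p q"
  shows "lex_rank V p < lex_rank V q"
  unfolding lex_rank_def
proof (rule psubset_card_mono)
  show "{r \<in> V. lex_less r p} \<subset> {r \<in> V. lex_less r q}"
    using assms(2,3) lex_less_irrefl[of p] by (blast intro: lex_less_trans)
qed (use assms in simp)

lemma inj_rank: "finite V \<Longrightarrow> inj_on (lex_rank V) V"
proof (rule inj_onI, rule ccontr)
  fix p q assume *: "finite V" "p \<in> V" "q \<in> V" "lex_rank V p = lex_rank V q" "p \<noteq> q"
  then show False
    using lex_less_total[of p q] rank_less[of V p q] rank_less[of V q p] by auto
qed

lemma rank_bound: "finite V \<Longrightarrow> p \<in> V \<Longrightarrow> lex_rank V p < card V"
  unfolding lex_rank_def using lex_less_irrefl[of p] by (intro psubset_card_mono) blast+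

lemma rank_bij:
  assumes "finite V"
  shows "bij_betw (lex_rank V) V {..<card V}"
  unfolding bij_betw_def
proof (intro conjI card_subset_eq)
  show "lex_rank V ` V \<subseteq> {..<card V}" using rank_bound[OF assms] by blast
qed (simp_all add: assms inj_rank card_image)

lemma pt_rank: "finite V \<Longrightarrow> p \<in> V \<Longrightarrow> pt V (lex_rank V p) = p"
  unfolding pt_def by (rule the_equality) (auto dest: inj_rank inj_onD)

lemma rank_pt:
  assumes "finite V" "r < card V"
  shows "pt V r \<in> V" "lex_rank V (pt V r) = r"
proof -
  obtain p where "p \<in> V" "lex_rank V p = r"
    using rank_bij[OF assms(1)] assms(2) unfolding bij_betw_def by (metis imageE lessThan_iff)
  then show "pt V r \<in> V" "lex_rank V (pt V r) = r" using pt_rank[OF assms(1), of p] by simp_all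
qed

lemma pt_image:
  assumes "finite V"
  shows "pt V ` {..<card V} = V"
proof
  show "V \<subseteq> pt V ` {..<card V}"
  proof
    fix p assume "p \<in> V"
    then show "p \<in> pt V ` {..<card V}"
      using pt_rank[OF assms] rank_bound[OF assms] by (intro image_eqI[of p _ "lex_rank V p"]) simp_all
  qed
qed (use rank_pt(1)[OF assms] in blast)

definition grow :: "point set \<Rightarrow> point set \<Rightarrow> point \<Rightarrow> point set" where
  "grow X T p = (if convex hull (insert p T) \<inter> X = {} then insert p T else T)"

lemma grow_mono: "T \<subseteq> foldl (grow X) T ps"
proof (induction ps arbitrary: T)
  case (Cons p ps)
  have "T \<subseteq> grow X T p" by (auto simp: grow_def)
  with Cons[of "grow X T p"] show ?case by auto
qed simp

lemma grow_bound: "foldl (grow X) T ps \<subseteq> T \<union> set ps"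
proof (induction ps arbitrary: T)
  case (Cons p ps)
  have "grow X T p \<subseteq> insert p T" by (auto simp: grow_def)
  with Cons[of "grow X T p"] show ?case by auto
qed simp

lemma grow_avoids: "convex hull T \<inter> X = {} \<Longrightarrow> convex hull (foldl (grow X) T ps) \<inter> X = {}"
  by (induction ps arbitrary: T) (auto simp: grow_def)

lemma grow_saturated:
  assumes "p \<in> set ps" "convex hull (insert p (foldl (grow X) T ps)) \<inter> X = {}"
  shows "p \<in> foldl (grow X) T ps"
  using assms
proof (induction ps arbitrary: T)
  case (Cons q ps)
  show ?case
  proof (cases "p = q")
    case True
    have "convex hull (insert p T) \<subseteq> convex hull (insert p (foldl (grow X) T (q # ps)))"
      by (intro hull_mono insert_mono grow_mono)
    then have "convex hull (insert p T) \<inter> X = {}" using Cons.prems(2) by blast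
    then have "p \<in> grow X T q" using True by (simp add: grow_def)
    then show ?thesis using grow_mono[of "grow X T q" X ps] by auto
  qed (use Cons in auto)
qed simp

lemma grow_accept:
  assumes "convex hull A \<inter> X = {}" "T \<subseteq> A" "set ps \<subseteq> A"
  shows "foldl (grow X) T ps = T \<union> set ps"
  using assms(2,3)
proof (induction ps arbitrary: T)
  case (Cons p ps)
  have "convex hull (insert p T) \<subseteq> convex hull A" using Cons.prems by (intro hull_mono) auto
  then have "grow X T p = insert p T" using assms(1) by (auto simp: grow_def)
  then show ?case using Cons by auto
qed simp

definition points :: "point set \<Rightarrow> point list" where
  "points V = map (pt V) [0..<card V]"

lemma set_points: "finite V \<Longrightarrow> set (points V) = V"
  by (simp add: points_def atLeast0LessThan pt_image)

definition ext :: "point set \<Rightarrow> point set \<Rightarrow> point set \<Rightarrow> point set" where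
  "ext V X A = foldl (grow X) {} (filter (\<lambda>p. p \<in> A) (points V) @ points V)"

lemma ext_maximal:
  assumes "finite V"
  shows "maximal_obstacle_free V X (ext V X A)"
proof -
  let ?ps = "filter (\<lambda>p. p \<in> A) (points V) @ points V"
  have V: "set ?ps = V" using set_points[OF assms] by auto
  have "ext V X A \<subseteq> V" using grow_bound[of X "{}" ?ps] V by (simp add: ext_def)
  moreover have "convex hull (ext V X A) \<inter> X = {}" unfolding ext_def by (rule grow_avoids) simp
  moreover have "p \<in> ext V X A" if T: "obstacle_free V X T" "ext V X A \<subseteq> T" "p \<in> T" for T p
  proof -
    have "convex hull (insert p (ext V X A)) \<subseteq> convex hull T" using T by (intro hull_mono) auto
    then have "convex hull (insert p (ext V X A)) \<inter> X = {}"
      using T(1) unfolding obstacle_free_def by blast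
    moreover have "p \<in> set ?ps" using T V unfolding obstacle_free_def by blast
    ultimately show ?thesis unfolding ext_def by (intro grow_saturated)
  qed
  ultimately show ?thesis unfolding maximal_obstacle_free_def obstacle_free_def by blast
qed

lemma ext_superset:
  assumes "finite V" "A \<subseteq> V" "convex hull A \<inter> X = {}"
  shows "A \<subseteq> ext V X A"
proof -
  have "foldl (grow X) {} (filter (\<lambda>p. p \<in> A) (points V)) = A"
    using grow_accept[OF assms(3), of "{}" "filter (\<lambda>p. p \<in> A) (points V)"]
      set_points[OF assms(1)] assms(2) by auto
  then show ?thesis unfolding ext_def foldl_append using grow_mono by metis
qed

definition nbrs :: "point set \<Rightarrow> point set \<Rightarrow> point set \<Rightarrow> point set set" where
  "nbrs V X S = (\<lambda>(v, d). ext V X (insert v (wedge X S v d))) ` (V \<times> insert None (Some ` X))"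

lemma nbrs_maximal: "finite V \<Longrightarrow> T \<in> nbrs V X S \<Longrightarrow> maximal_obstacle_free V X T"
  unfolding nbrs_def by (elim imageE) (simp add: ext_maximal split: prod.splits)

lemma nbrs_closer:
  assumes fin: "finite V" "finite X"
    and S: "maximal_obstacle_free V X S" and T: "maximal_obstacle_free V X T" and "S \<noteq> T"
  shows "\<exists>S' \<in> nbrs V X S. card (S \<inter> T) < card (S' \<inter> T)"
proof -
  have Sf: "S \<subseteq> V" "convex hull S \<inter> X = {}" and Tf: "T \<subseteq> V" "convex hull T \<inter> X = {}"
    using S T by (auto simp: maximal_obstacle_free_def obstacle_free_def)
  obtain v where v: "v \<in> T" "v \<notin> S"
    using S T \<open>S \<noteq> T\<close> unfolding maximal_obstacle_free_def by blast
  let ?R = "insert v (S \<inter> T)"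
  have R: "convex hull ?R \<inter> X = {}"
    using Tf(2) hull_mono[of ?R T convex] v by blast
  have "v \<notin> convex hull S"
  proof
    assume "v \<in> convex hull S"
    then have "convex hull (insert v S) = convex hull S" by (rule hull_redundant)
    then have "obstacle_free V X (insert v S)"
      using Sf Tf v by (auto simp: obstacle_free_def)
    then show False using S v unfolding maximal_obstacle_free_def by blast
  qed
  then obtain d where d: "d \<in> insert None (Some ` X)" "?R - {v} \<subseteq> wedge X S v d"
    using wedge_covers[of S X v ?R] fin Sf R finite_subset[OF Sf(1)] by auto
  let ?A = "insert v (wedge X S v d)"
  have "v \<notin> X" using v Tf(2) by (meson disjoint_iff hull_inc)
  then have "convex hull ?A \<inter> X = {}" using wedge_avoids Sf(2) by blast
  then have "?A \<subseteq> ext V X ?A"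
    using Sf(1) Tf(1) v by (intro ext_superset[OF fin(1)]) (auto simp: wedge_def)
  then have "?R \<subseteq> ext V X ?A \<inter> T" using d(2) v by blast
  moreover have "finite (ext V X ?A \<inter> T)" using fin(1) Tf(1) finite_subset by blast
  ultimately have "card ?R \<le> card (ext V X ?A \<inter> T)" using card_mono by blast
  moreover have "card ?R = Suc (card (S \<inter> T))"
    using v fin(1) Tf(1) finite_subset by (subst card_insert_disjoint) auto
  moreover have "ext V X ?A \<in> nbrs V X S"
    using v Tf d(1) unfolding nbrs_def by (intro image_eqI[where x = "(v, d)"]) auto
  ultimately show ?thesis by (intro bexI[of _ "ext V X ?A"]) auto
qed

text \<open>Every step towards T enlarges the intersection with T, so T is reached eventually.\<close>

lemma nbrs_reach:
  assumes fin: "finite V" "finite X"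
    and A: "A \<subseteq> {S. maximal_obstacle_free V X S}" "A \<noteq> {}" "\<And>S. S \<in> A \<Longrightarrow> nbrs V X S \<subseteq> A"
  shows "A = {S. maximal_obstacle_free V X S}"
proof -
  have "T \<in> A" if T: "maximal_obstacle_free V X T" for T
  proof -
    have "finite A" using A(1) fin(1)
      by (intro finite_subset[of A "Pow V"]) (auto simp: maximal_obstacle_free_def obstacle_free_def)
    then have "Max ((\<lambda>S. card (S \<inter> T)) ` A) \<in> (\<lambda>S. card (S \<inter> T)) ` A"
      "\<forall>S\<in>A. card (S \<inter> T) \<le> Max ((\<lambda>S. card (S \<inter> T)) ` A)" using A(2) by auto
    then obtain S where S: "S \<in> A" "\<forall>S'\<in>A. card (S' \<inter> T) \<le> card (S \<inter> T)" by auto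
    show ?thesis
    proof (rule ccontr)
      assume "T \<notin> A"
      then have "S \<noteq> T" using S by blast
      then obtain S' where "S' \<in> nbrs V X S" "card (S \<inter> T) < card (S' \<inter> T)"
        using nbrs_closer[OF fin _ T] S(1) A(1) by blast
      then show False using A(3)[OF S(1)] S(2) by force
    qed
  qed
  with A(1) show ?thesis by blast
qed

section \<open>Bounded-time correctness of programs\<close>

lemma tick_simps [simp]:
  "nat_mem (tick k s) = nat_mem s" "real_mem (tick k s) = real_mem s"
  "buffer (tick k s) = buffer s" "outputs (tick k s) = outputs s" "clock (tick k s) = clock s + k"
  by (simp_all add: tick_def)

lemma nat_store_simps [simp]:
  "nat_mem (nat_store a i v s) b = (if b = a then (nat_mem s a)(i := v) else nat_mem s b)"
  "real_mem (nat_store a i v s) = real_mem s"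
  "buffer (nat_store a i v s) = buffer s" "outputs (nat_store a i v s) = outputs s"
  "clock (nat_store a i v s) = clock s"
  by (simp_all add: nat_store_def)

lemma real_store_simps [simp]:
  "nat_mem (real_store a i r s) = nat_mem s"
  "real_mem (real_store a i r s) b = (if b = a then (real_mem s a)(i := r) else real_mem s b)"
  "buffer (real_store a i r s) = buffer s" "outputs (real_store a i r s) = outputs s"
  "clock (real_store a i r s) = clock s"
  by (simp_all add: real_store_def)

lemma emit_simps [simp]:
  "nat_mem (emit v s) = nat_mem s" "real_mem (emit v s) = real_mem s"
  "buffer (emit v s) = buffer s @ [v]" "outputs (emit v s) = outputs s" "clock (emit v s) = clock s"
  by (simp_all add: emit_def)

lemma commit_simps [simp]:
  "nat_mem (commit s) = nat_mem s" "real_mem (commit s) = real_mem s"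
  "buffer (commit s) = []" "outputs (commit s) = outputs s @ [(clock s, buffer s)]"
  "clock (commit s) = clock s"
  by (simp_all add: commit_def)

fun nat_writes :: "com \<Rightarrow> nat set" where
  "nat_writes (NSet a e1 e2) = {a}"
| "nat_writes (Seq c1 c2) = nat_writes c1 \<union> nat_writes c2"
| "nat_writes (If b c1 c2) = nat_writes c1 \<union> nat_writes c2"
| "nat_writes (While b c) = nat_writes c"
| "nat_writes _ = {}"

fun real_writes :: "com \<Rightarrow> nat set" where
  "real_writes (RSet a e1 e2) = {a}"
| "real_writes (Seq c1 c2) = real_writes c1 \<union> real_writes c2"
| "real_writes (If b c1 c2) = real_writes c1 \<union> real_writes c2"
| "real_writes (While b c) = real_writes c"
| "real_writes _ = {}"

fun silent :: "com \<Rightarrow> bool" where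
  "silent (Emit e) = False"
| "silent Commit = False"
| "silent (Seq c1 c2) = (silent c1 \<and> silent c2)"
| "silent (If b c1 c2) = (silent c1 \<and> silent c2)"
| "silent (While b c) = silent c"
| "silent _ = True"

definition frame :: "com \<Rightarrow> state \<Rightarrow> state \<Rightarrow> bool" where
  "frame c s t \<longleftrightarrow> (\<forall>a. a \<notin> nat_writes c \<longrightarrow> nat_mem t a = nat_mem s a) \<and>
     (\<forall>a. a \<notin> real_writes c \<longrightarrow> real_mem t a = real_mem s a) \<and>
     (silent c \<longrightarrow> buffer t = buffer s \<and> outputs t = outputs s)"

lemma exec_frame: "exec c s t \<Longrightarrow> frame c s t"
  by (induction rule: exec.induct) (auto simp: frame_def)

lemma frameD:
  assumes "frame c s t"
  shows "a \<notin> nat_writes c \<Longrightarrow> nat_mem t a = nat_mem s a"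
    "a \<notin> real_writes c \<Longrightarrow> real_mem t a = real_mem s a"
    "silent c \<Longrightarrow> buffer t = buffer s" "silent c \<Longrightarrow> outputs t = outputs s"
  using assms by (auto simp: frame_def)

definition wp :: "com \<Rightarrow> nat \<Rightarrow> (state \<Rightarrow> bool) \<Rightarrow> state \<Rightarrow> bool" where
  "wp c K Q s \<longleftrightarrow> (\<exists>t. exec c s t \<and> clock t \<le> clock s + K \<and> Q t)"

lemma wp_mono:
  assumes "wp c K Q s" "K \<le> K'" "\<And>t. frame c s t \<Longrightarrow> clock t \<le> clock s + K \<Longrightarrow> Q t \<Longrightarrow> Q' t"
  shows "wp c K' Q' s"
  using assms exec_frame unfolding wp_def by (meson add_left_mono le_trans)

lemma wp_Seq:
  assumes "wp c1 K1 Q1 s"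
    "\<And>t. frame c1 s t \<Longrightarrow> clock t \<le> clock s + K1 \<Longrightarrow> Q1 t \<Longrightarrow> wp c2 K2 Q t" "K1 + K2 \<le> K"
  shows "wp (Seq c1 c2) K Q s"
proof -
  obtain t where t: "exec c1 s t" "clock t \<le> clock s + K1" "Q1 t" using assms(1) by (auto simp: wp_def)
  obtain u where "exec c2 t u" "clock u \<le> clock t + K2" "Q u"
    using assms(2)[OF exec_frame[OF t(1)] t(2,3)] by (auto simp: wp_def)
  then show ?thesis using t assms(3) by (auto simp: wp_def intro!: exec_Seq exI[of _ u])
qed

lemma wp_If:
  assumes "beval b s \<Longrightarrow> wp c1 K Q (tick (1 + bcost b) s)"
    "\<not> beval b s \<Longrightarrow> wp c2 K Q (tick (1 + bcost b) s)" "1 + bcost b + K \<le> K'"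
  shows "wp (If b c1 c2) K' Q s"
proof (cases "beval b s")
  case True
  then obtain t where "exec c1 (tick (1 + bcost b) s) t" "clock t \<le> clock s + (1 + bcost b) + K" "Q t"
    using assms(1) by (auto simp: wp_def)
  with True show ?thesis using assms(3) unfolding wp_def by (intro exI[of _ t]) (auto intro: exec_IfTrue)
next
  case False
  then obtain t where "exec c2 (tick (1 + bcost b) s) t" "clock t \<le> clock s + (1 + bcost b) + K" "Q t"
    using assms(2) by (auto simp: wp_def)
  with False show ?thesis using assms(3) unfolding wp_def by (intro exI[of _ t]) (auto intro: exec_IfFalse)
qed

fun straight :: "com \<Rightarrow> bool" where
  "straight (Seq c1 c2) = (straight c1 \<and> straight c2)"
| "straight (If b c1 c2) = (straight c1 \<and> straight c2)"
| "straight (While b c) = False"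
| "straight _ = True"

fun run :: "com \<Rightarrow> state \<Rightarrow> state" where
  "run Skip s = tick 1 s"
| "run (NSet a e1 e2) s = tick (1 + ncost e1 + ncost e2) (nat_store a (neval e1 s) (neval e2 s) s)"
| "run (RSet a e1 e2) s = tick (1 + ncost e1 + rcost e2) (real_store a (neval e1 s) (reval e2 s) s)"
| "run (Emit e) s = tick (1 + ncost e) (emit (neval e s) s)"
| "run Commit s = commit (tick 1 s)"
| "run (Seq c1 c2) s = run c2 (run c1 s)"
| "run (If b c1 c2) s = (if beval b s then run c1 (tick (1 + bcost b) s) else run c2 (tick (1 + bcost b) s))"
| "run (While b c) s = s"

fun steps :: "com \<Rightarrow> nat" where
  "steps Skip = 1"
| "steps (NSet a e1 e2) = 1 + ncost e1 + ncost e2"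
| "steps (RSet a e1 e2) = 1 + ncost e1 + rcost e2"
| "steps (Emit e) = 1 + ncost e"
| "steps Commit = 1"
| "steps (Seq c1 c2) = steps c1 + steps c2"
| "steps (If b c1 c2) = 1 + bcost b + steps c1 + steps c2"
| "steps (While b c) = 0"

lemma exec_run: "straight c \<Longrightarrow> exec c s (run c s) \<and> clock (run c s) \<le> clock s + steps c"
proof (induction c arbitrary: s)
  case (Seq c1 c2)
  then show ?case using exec_Seq[of c1 s "run c1 s" c2 "run c2 (run c1 s)"] by (fastforce intro: le_trans)
next
  case (If b c1 c2)
  have "clock (run c1 (tick (1 + bcost b) s)) \<le> clock s + (1 + bcost b) + steps c1"
    "clock (run c2 (tick (1 + bcost b) s)) \<le> clock s + (1 + bcost b) + steps c2"
    using If.IH[of "tick (1 + bcost b) s"] If.prems by auto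
  then show ?case
    using If.IH[of "tick (1 + bcost b) s"] If.prems by (auto intro: exec_IfTrue exec_IfFalse)
qed (simp_all add: exec_Skip[simplified] exec_NSet[simplified] exec_RSet[simplified]
    exec_Emit[simplified] exec_Commit[simplified])

lemma wp_run: "straight c \<Longrightarrow> steps c \<le> K \<Longrightarrow> Q (run c s) \<Longrightarrow> wp c K Q s"
  unfolding wp_def using exec_run[of c s] by (intro exI[of _ "run c s"]) auto

fun nat_reads :: "nexp \<Rightarrow> nat set" where
  "nat_reads (NConst n) = {}"
| "nat_reads (NGet a e) = insert a (nat_reads e)"
| "nat_reads (NAdd e1 e2) = nat_reads e1 \<union> nat_reads e2"
| "nat_reads (NSub e1 e2) = nat_reads e1 \<union> nat_reads e2"

lemma neval_cong: "(\<And>a. a \<in> nat_reads e \<Longrightarrow> nat_mem t a = nat_mem s a) \<Longrightarrow> neval e t = neval e s"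
  by (induction e) auto

lemma eval_tick [simp]:
  "neval e (tick k s) = neval e s" "reval r (tick k s) = reval r s" "beval b (tick k s) = beval b s"
proof -
  show n: "neval e (tick k s) = neval e s" for e by (rule neval_cong) simp
  show r: "reval r (tick k s) = reval r s" for r by (induction r) (simp_all add: n)
  show "beval b (tick k s) = beval b s" by (induction b) (simp_all add: n r)
qed

abbreviation NVar :: "nat \<Rightarrow> nexp" where "NVar a \<equiv> NGet a (NConst 0)"
abbreviation RVar :: "nat \<Rightarrow> rexp" where "RVar a \<equiv> RGet a (NConst 0)"

definition For :: "nat \<Rightarrow> nexp \<Rightarrow> com \<Rightarrow> com" where
  "For i n c = Seq (NSet i (NConst 0) (NConst 0))
     (While (NLess (NVar i) n) (Seq c (NSet i (NConst 0) (NAdd (NVar i) (NConst 1)))))"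

lemma For_writes [simp]:
  "nat_writes (For i n c) = insert i (nat_writes c)" "real_writes (For i n c) = real_writes c"
  "silent (For i n c) = silent c"
  by (auto simp: For_def)

text \<open>The condition \<open>P k t \<Longrightarrow> P k (tick q (nat_store i 0 v t))\<close> says that \<open>P k\<close> depends neither on the
  clock nor on the loop counter; \<open>nat_mem t i 0 = k\<close> is supplied separately.\<close>

lemma wp_For:
  assumes N: "neval n s = N" "nat_reads n \<inter> insert i (nat_writes c) = {}" "ncost n \<le> 4"
    and i: "i \<notin> nat_writes c"
    and init: "P 0 s"
    and stable: "\<And>k t q v. P k t \<Longrightarrow> P k (tick q (nat_store i 0 v t))"
    and body: "\<And>k t. k < N \<Longrightarrow> P k t \<Longrightarrow> frame (For i n c) s t \<Longrightarrow> nat_mem t i 0 = k \<Longrightarrow>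
      wp c B (P (Suc k)) t"
    and K: "(N + 1) * (B + 14) \<le> K"
  shows "wp (For i n c) K (P N) s"
proof -
  let ?b = "NLess (NVar i) n" and ?inc = "NSet i (NConst 0) (NAdd (NVar i) (NConst 1))"
  let ?c = "Seq c ?inc"
  let ?I = "\<lambda>k t. P k t \<and> frame (For i n c) s t \<and> nat_mem t i 0 = k"
  have n_const: "neval n t = N" if "frame (For i n c) s t" for t
  proof -
    have "nat_mem t a = nat_mem s a" if "a \<in> nat_reads n" for a
      using that N(2) by (intro frameD(1)[OF \<open>frame (For i n c) s t\<close>]) (simp, blast)
    then show ?thesis using neval_cong[of n t s] N(1) by simp
  qed
  have tick_stable: "P k (tick q t)" if "P k t" for k q t
    using stable[OF that, of q "nat_mem t i 0"] by (simp add: nat_store_def)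
  have loop: "\<exists>u. exec (While ?b ?c) t u \<and> clock u \<le> clock t + (N - k) * (B + 14) + 8 \<and> P N u"
    if "?I k t" "k \<le> N" for k t
    using that
  proof (induction "N - k" arbitrary: k t)
    case 0
    then have k: "k = N" by simp
    have t: "P N t" "neval n t = N" "nat_mem t i 0 = N" using 0(2) n_const k by blast+
    then have "\<not> beval ?b t" by simp
    then have "exec (While ?b ?c) t (tick (1 + bcost ?b) t)" by (rule exec_WhileFalse)
    moreover have "1 + bcost ?b \<le> 8" using N(3) by simp
    ultimately show ?case using tick_stable[OF t(1)]
      by (intro exI[of _ "tick (1 + bcost ?b) t"]) (simp del: bcost.simps)
  next
    case (Suc m)
    then have k: "k < N" by simp
    have t: "P k t" "frame (For i n c) s t" "nat_mem t i 0 = k" using Suc.prems(1) by auto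
    then have b: "beval ?b t" using n_const[of t] k by simp
    have bc: "bcost ?b \<le> 7" using N(3) by simp
    let ?t = "tick (1 + bcost ?b) t"
    have ft: "frame (For i n c) s ?t" using t(2) by (simp add: frame_def)
    have "wp c B (P (Suc k)) ?t"
      using t(3) by (intro body[OF k tick_stable[OF t(1)] ft]) simp
    then obtain u where u: "exec c ?t u" "clock u \<le> clock ?t + B" "P (Suc k) u" by (auto simp: wp_def)
    let ?u = "run ?inc u"
    have fu: "frame c ?t u" by (rule exec_frame[OF u(1)])
    have iu: "nat_mem u i 0 = k" using frameD(1)[OF fu i] t(3) by simp
    have "frame (For i n c) s ?u"
      using ft fu by (auto simp: frame_def)
    moreover have "P (Suc k) ?u" using stable[OF u(3)] by simp
    ultimately have Iu: "?I (Suc k) ?u" using iu by simp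
    have "m = N - Suc k" "Suc k \<le> N" using Suc.hyps(2) k by simp_all
    from Suc.hyps(1)[OF this(1) Iu this(2)] obtain w where w: "exec (While ?b ?c) ?u w" "clock w \<le> clock ?u + (N - Suc k) * (B + 14) + 8" "P N w"
      by blast
    have "exec ?inc u ?u" using exec_run[of ?inc u] by simp
    then have "exec ?c ?t ?u" by (rule exec_Seq[OF u(1)])
    then have "exec (While ?b ?c) t w" using w(1) by (rule exec_WhileTrue[OF b])
    moreover have "(N - k) * (B + 14) = (N - Suc k) * (B + 14) + (B + 14)"
      using Suc_diff_Suc[OF k] by (metis add.commute mult_Suc)
    then have "clock w \<le> clock t + (N - k) * (B + 14) + 8"
      using w(2) u(2) bc by simp
    ultimately show ?case using w(3) by blast
  qed
  let ?s = "run (NSet i (NConst 0) (NConst 0)) s"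
  have "?I 0 ?s" using stable[OF init] by (simp add: frame_def)
  then obtain u where u: "exec (While ?b ?c) ?s u" "clock u \<le> clock ?s + N * (B + 14) + 8" "P N u"
    using loop[of 0 ?s] by (metis diff_zero le0)
  have "exec (NSet i (NConst 0) (NConst 0)) s ?s"
    using exec_run[of "NSet i (NConst 0) (NConst 0)" s] by simp
  then have "exec (For i n c) s u" unfolding For_def using u(1) by (rule exec_Seq)
  moreover have "clock u \<le> clock s + K" using u(2) K by (simp add: algebra_simps)
  ultimately show ?thesis using u(3) by (auto simp: wp_def)
qed

section \<open>Adding a point to the current set\<close>

definition cross_exp :: "rexp \<Rightarrow> rexp \<Rightarrow> rexp \<Rightarrow> rexp \<Rightarrow> rexp" where
  "cross_exp a b c d = RSub (RMul a d) (RMul b c)"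

definition dot_exp :: "rexp \<Rightarrow> rexp \<Rightarrow> rexp \<Rightarrow> rexp \<Rightarrow> rexp" where
  "dot_exp a b c d = RAdd (RMul a c) (RMul b d)"

definition BOr :: "bexp \<Rightarrow> bexp \<Rightarrow> bexp" where
  "BOr b c = BNot (BAnd (BNot b) (BNot c))"

definition ccw_exp :: "rexp \<Rightarrow> rexp \<Rightarrow> rexp \<Rightarrow> rexp \<Rightarrow> bexp" where
  "ccw_exp a b c d = BOr (RLess (RConst 0) (cross_exp a b c d))
     (BAnd (BNot (RLess (cross_exp a b c d) (RConst 0))) (BNot (RLess (dot_exp a b c d) (RConst 0))))"

lemma exp_simps [simp]:
  "reval (cross_exp a b c d) s = cross (reval a s, reval b s) (reval c s, reval d s)"
  "reval (dot_exp a b c d) s = dot (reval a s, reval b s) (reval c s, reval d s)"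
  "beval (BOr p q) s \<longleftrightarrow> beval p s \<or> beval q s"
  "beval (ccw_exp a b c d) s \<longleftrightarrow> ccw (reval a s, reval b s) (reval c s, reval d s)"
  by (auto simp: cross_exp_def dot_exp_def BOr_def ccw_exp_def cross_def dot_def ccw_def)

lemma exp_costs [simp]:
  "rcost (cross_exp a b c d) = 3 + rcost a + rcost b + rcost c + rcost d"
  "rcost (dot_exp a b c d) = 3 + rcost a + rcost b + rcost c + rcost d"
  "bcost (BOr p q) = 4 + bcost p + bcost q"
  "bcost (ccw_exp a b c d) = 22 + 3 * (rcost a + rcost b + rcost c + rcost d)"
  by (auto simp: cross_exp_def dot_exp_def BOr_def ccw_exp_def)

text \<open>Natural arrays: 0 the numbers of points and obstacles, 1 a given solution, 2 the indices of
  the points in lexicographic order, 3 the inverse of this permutation, 7 the current point, 8 the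
  current obstacle, 9 whether the current point fits, 10 the set under construction. Real arrays:
  0--3 the input, 4--5 the sorted points, 6--7 the vector from the current obstacle to the current
  point, 8--9 and 10--11 the last and the first direction in which an obstacle sees the set under
  construction. Scalars are stored at index 0.\<close>

abbreviation "point_count \<equiv> NGet 0 (NConst 0)"
abbreviation "obstacle_count \<equiv> NGet 0 (NConst 1)"

abbreviation "rx \<equiv> RGet 10 (NVar 8)"
abbreviation "ry \<equiv> RGet 11 (NVar 8)"
abbreviation "lx \<equiv> RGet 8 (NVar 8)"
abbreviation "ly \<equiv> RGet 9 (NVar 8)"
abbreviation "px \<equiv> RVar 6"
abbreviation "py \<equiv> RVar 7"

definition view :: "nat \<Rightarrow> com" where
  "view y = Seq (RSet 6 (NConst 0) (RSub (RGet 4 (NVar y)) (RGet 2 (NVar 8))))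
     (RSet 7 (NConst 0) (RSub (RGet 5 (NVar y)) (RGet 3 (NVar 8))))"

definition extends_exp :: bexp where
  "extends_exp = BAnd (RLess (RConst 0) (dot_exp px py px py)) (BOr (ccw_exp rx ry px py) (ccw_exp px py lx ly))"

definition update_first :: com where
  "update_first = If (ccw_exp px py rx ry) (Seq (RSet 10 (NVar 8) px) (RSet 11 (NVar 8) py)) Skip"

definition update_last :: com where
  "update_last = If (ccw_exp lx ly px py) (Seq (RSet 8 (NVar 8) px) (RSet 9 (NVar 8) py)) Skip"

definition first_dir :: "state \<Rightarrow> nat \<Rightarrow> point" where
  "first_dir s i = (real_mem s 10 i, real_mem s 11 i)"

definition last_dir :: "state \<Rightarrow> nat \<Rightarrow> point" where
  "last_dir s i = (real_mem s 8 i, real_mem s 9 i)"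

definition viewed :: "state \<Rightarrow> point" where
  "viewed s = (real_mem s 6 0, real_mem s 7 0)"

lemma dir_simps [simp]:
  "first_dir (tick q s) = first_dir s" "last_dir (tick q s) = last_dir s"
  "first_dir (nat_store a i v s) = first_dir s" "last_dir (nat_store a i v s) = last_dir s"
  by (simp_all add: first_dir_def last_dir_def fun_eq_iff)

lemma dir_cong:
  "real_mem t 10 = real_mem s 10 \<Longrightarrow> real_mem t 11 = real_mem s 11 \<Longrightarrow> first_dir t = first_dir s"
  "real_mem t 8 = real_mem s 8 \<Longrightarrow> real_mem t 9 = real_mem s 9 \<Longrightarrow> last_dir t = last_dir s"
  by (simp_all add: first_dir_def last_dir_def fun_eq_iff)

lemma run_view:
  "viewed (run (view y) s) = (real_mem s 4 (nat_mem s y 0), real_mem s 5 (nat_mem s y 0)) -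
     (real_mem s 2 (nat_mem s 8 0), real_mem s 3 (nat_mem s 8 0))"
  "first_dir (run (view y) s) i = first_dir s i" "last_dir (run (view y) s) i = last_dir s i"
  "nat_mem (run (view y) s) = nat_mem s"
  by (simp_all add: view_def viewed_def first_dir_def last_dir_def)

lemma beval_extends_exp:
  "beval extends_exp s \<longleftrightarrow> extends (first_dir s (nat_mem s 8 0)) (last_dir s (nat_mem s 8 0)) (viewed s)"
  by (simp add: extends_exp_def extends_def viewed_def first_dir_def last_dir_def)

lemma run_update_first:
  assumes "nat_mem s 8 0 = k"
  shows "nat_mem (run update_first s) = nat_mem s" "viewed (run update_first s) = viewed s"
    "last_dir (run update_first s) i = last_dir s i"
    "first_dir (run update_first s) i =
      (if i = k \<and> ccw (viewed s) (first_dir s i) then viewed s else first_dir s i)"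
proof -
  let ?u = "run update_first s" and ?c = "ccw (viewed s) (first_dir s k)"
  have u: "nat_mem ?u = nat_mem s"
    "real_mem ?u 10 = (if ?c then (real_mem s 10)(k := fst (viewed s)) else real_mem s 10)"
    "real_mem ?u 11 = (if ?c then (real_mem s 11)(k := snd (viewed s)) else real_mem s 11)"
    "real_mem ?u 6 = real_mem s 6" "real_mem ?u 7 = real_mem s 7"
    "real_mem ?u 8 = real_mem s 8" "real_mem ?u 9 = real_mem s 9"
    using assms by (simp_all add: update_first_def viewed_def first_dir_def del: fun_upd_apply)
  then show "nat_mem ?u = nat_mem s" "viewed ?u = viewed s" "last_dir ?u i = last_dir s i"
    by (simp_all only: viewed_def last_dir_def)
  show "first_dir ?u i = (if i = k \<and> ccw (viewed s) (first_dir s i) then viewed s else first_dir s i)"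
    unfolding first_dir_def[of ?u] u(2,3) by (cases "i = k") (simp_all add: first_dir_def)
qed

lemma run_update_last:
  assumes "nat_mem s 8 0 = k"
  shows "first_dir (run update_last s) i = first_dir s i"
    "last_dir (run update_last s) i =
      (if i = k \<and> ccw (last_dir s i) (viewed s) then viewed s else last_dir s i)"
proof -
  let ?u = "run update_last s" and ?c = "ccw (last_dir s k) (viewed s)"
  have u: "real_mem ?u 8 = (if ?c then (real_mem s 8)(k := fst (viewed s)) else real_mem s 8)"
    "real_mem ?u 9 = (if ?c then (real_mem s 9)(k := snd (viewed s)) else real_mem s 9)"
    "real_mem ?u 10 = real_mem s 10" "real_mem ?u 11 = real_mem s 11"
    using assms by (simp_all add: update_last_def viewed_def last_dir_def del: fun_upd_apply)
  then show "first_dir ?u i = first_dir s i" by (simp only: first_dir_def)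
  show "last_dir ?u i = (if i = k \<and> ccw (last_dir s i) (viewed s) then viewed s else last_dir s i)"
    unfolding last_dir_def[of ?u] u(1,2) by (cases "i = k") (simp_all add: last_dir_def)
qed

lemma run_update_dirs:
  assumes "nat_mem s 8 0 = k"
  shows "first_dir (run (Seq update_first update_last) s) i =
      (if i = k \<and> ccw (viewed s) (first_dir s i) then viewed s else first_dir s i)"
    "last_dir (run (Seq update_first update_last) s) i =
      (if i = k \<and> ccw (last_dir s i) (viewed s) then viewed s else last_dir s i)"
proof -
  note first = run_update_first[OF assms]
  have k: "nat_mem (run update_first s) 8 0 = k" unfolding first(1) by (rule assms)
  note last = run_update_last[OF k]
  show "first_dir (run (Seq update_first update_last) s) i =
      (if i = k \<and> ccw (viewed s) (first_dir s i) then viewed s else first_dir s i)"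
    unfolding run.simps(6) last(1) by (rule first(4))
  show "last_dir (run (Seq update_first update_last) s) i =
      (if i = k \<and> ccw (last_dir s i) (viewed s) then viewed s else last_dir s i)"
    unfolding run.simps(6) last(2) first(2,3) by (rule refl)
qed

definition try_point :: com where
  "try_point = Seq (NSet 9 (NConst 0) (NConst 1))
     (Seq (For 8 obstacle_count (Seq (view 7) (If extends_exp Skip (NSet 9 (NConst 0) (NConst 0)))))
     (If (NLess (NConst 0) (NVar 9))
       (Seq (For 8 obstacle_count (Seq (view 7) (Seq update_first update_last)))
         (NSet 10 (NVar 7) (NConst 1)))
       Skip))"

definition clear :: com where
  "clear = Seq (For 7 point_count (NSet 10 (NVar 7) (NConst 0)))
     (For 8 obstacle_count (Seq (Seq (RSet 8 (NVar 8) (RConst 0)) (RSet 9 (NVar 8) (RConst 0)))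
       (Seq (RSet 10 (NVar 8) (RConst 0)) (RSet 11 (NVar 8) (RConst 0)))))"

definition add_points :: "bexp \<Rightarrow> com" where
  "add_points b = For 7 point_count (If b try_point Skip)"

lemma try_point_writes [simp]:
  "nat_writes try_point = {8, 9, 10}" "real_writes try_point = {6, 7, 8, 9, 10, 11}" "silent try_point"
  by (auto simp: try_point_def view_def update_first_def update_last_def)

lemma clear_writes [simp]:
  "nat_writes clear = {7, 8, 10}" "real_writes clear = {8, 9, 10, 11}" "silent clear"
  by (auto simp: clear_def)

lemma add_points_writes [simp]:
  "nat_writes (add_points b) = {7, 8, 9, 10}" "real_writes (add_points b) = {6, 7, 8, 9, 10, 11}"
  "silent (add_points b)"
  by (auto simp: add_points_def)

locale input =
  fixes vs xs :: "point list"
  assumes distinct: "distinct vs" "distinct xs"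
begin

abbreviation "j \<equiv> length vs"
abbreviation "h \<equiv> length xs"
abbreviation "V \<equiv> set vs"
abbreviation "X \<equiv> set xs"
abbreviation "p \<equiv> pt V"

lemma card_V: "card V = j"
  using distinct by (simp add: distinct_card)

lemma p_in: "y < j \<Longrightarrow> p y \<in> V"
  using rank_pt(1)[of V y] card_V by simp

lemma p_inj: "y < j \<Longrightarrow> y' < j \<Longrightarrow> p y = p y' \<longleftrightarrow> y = y'"
  using rank_pt(2)[of V y] rank_pt(2)[of V y'] unfolding card_V by (metis List.finite_set)

definition sorted_input :: "state \<Rightarrow> bool" where
  "sorted_input s \<longleftrightarrow> nat_mem s 0 0 = j \<and> nat_mem s 0 1 = h \<and>
     (\<forall>i<h. real_mem s 2 i = fst (xs ! i) \<and> real_mem s 3 i = snd (xs ! i)) \<and>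
     (\<forall>y<j. real_mem s 4 y = fst (p y) \<and> real_mem s 5 y = snd (p y) \<and>
        nat_mem s 2 y < j \<and> vs ! nat_mem s 2 y = p y)"

lemma sorted_input_cong:
  assumes "sorted_input s" "nat_mem t 0 = nat_mem s 0" "nat_mem t 2 = nat_mem s 2"
    "real_mem t 2 = real_mem s 2" "real_mem t 3 = real_mem s 3"
    "real_mem t 4 = real_mem s 4" "real_mem t 5 = real_mem s 5"
  shows "sorted_input t"
  using assms by (simp add: sorted_input_def)

lemma sorted_input_frame:
  assumes "sorted_input s" "frame c s t" "{0, 2} \<inter> nat_writes c = {}" "{2, 3, 4, 5} \<inter> real_writes c = {}"
  shows "sorted_input t"
  using assms(3,4) by (intro sorted_input_cong[OF assms(1)] frameD[OF assms(2)]) auto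

definition flags :: "nat \<Rightarrow> state \<Rightarrow> point set \<Rightarrow> bool" where
  "flags a s T \<longleftrightarrow> (\<forall>y<j. nat_mem s a y = (if p y \<in> T then 1 else 0))"

definition views :: "state \<Rightarrow> point set \<Rightarrow> bool" where
  "views s T \<longleftrightarrow> (\<forall>i<h. spanned (first_dir s i) (last_dir s i) ((\<lambda>q. q - xs ! i) ` T))"

definition current :: "state \<Rightarrow> point set \<Rightarrow> bool" where
  "current s T \<longleftrightarrow> flags 10 s T \<and> views s T"

lemma extends_view:
  assumes "views s T" "i < h"
  shows "extends (first_dir s i) (last_dir s i) (q - xs ! i) \<longleftrightarrow> xs ! i \<notin> convex hull (insert q T)"
  using extends_iff[of "first_dir s i" "last_dir s i" "(\<lambda>q. q - xs ! i) ` T" "q - xs ! i"]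
    zero_in_hull_translate[of "xs ! i" "insert q T"] assms
  by (simp add: views_def)

lemma all_obstacles: "(\<forall>i<h. xs ! i \<notin> A) \<longleftrightarrow> A \<inter> X = {}"
  by (metis disjoint_iff in_set_conv_nth)

lemma wp_try_point:
  assumes s: "sorted_input s" "current s T" "nat_mem s 7 0 = y" "y < j"
  shows "wp try_point (2000 * (h + 1)) (\<lambda>t. current t (grow X T (p y))) s"
proof -
  have vw: "views s T" using s by (simp add: current_def)
  let ?q = "\<lambda>i. p y - xs ! i"
  let ?ok = "\<lambda>i. extends (first_dir s i) (last_dir s i) (?q i)"
  let ?r = "\<lambda>i. if ccw (?q i) (first_dir s i) then ?q i else first_dir s i"
  let ?l = "\<lambda>i. if ccw (last_dir s i) (?q i) then ?q i else last_dir s i"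
  have in0: "nat_mem s 0 0 = j" "nat_mem s 0 1 = h" using s(1) by (simp_all add: sorted_input_def)
  show ?thesis
    unfolding try_point_def
  proof (rule wp_Seq[where ?K1.0 = 3 and ?K2.0 = "1900 * (h + 1)" and ?Q1.0 = "\<lambda>t. nat_mem t 9 0 = 1"])
    fix s1 assume f1: "frame (NSet 9 (NConst 0) (NConst 1)) s s1" and q1: "nat_mem s1 9 0 = 1"
    note m1 = frameD[OF f1, simplified]
    let ?c = "Seq (view 7) (If extends_exp Skip (NSet 9 (NConst 0) (NConst 0)))"
    let ?P = "\<lambda>k t. 0 < nat_mem t 9 0 \<longleftrightarrow> (\<forall>i<k. ?ok i)"
    have "wp (For 8 obstacle_count ?c) (300 * (h + 1)) (?P h) s1"
    proof (rule wp_For[where B = 200 and P = ?P and N = h])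
      fix k t
      assume k: "k < h" "0 < nat_mem t 9 0 \<longleftrightarrow> (\<forall>i<k. ?ok i)" "frame (For 8 obstacle_count ?c) s1 t" "nat_mem t 8 0 = k"
      note mt = frameD[OF k(3), simplified view_def update_first_def update_last_def, simplified]
      have v: "viewed (run (view 7) t) = ?q k"
        using s k(1,4) by (simp add: run_view sorted_input_def mt m1)
      have d: "first_dir t k = first_dir s k" "last_dir t k = last_dir s k"
        by (simp_all add: first_dir_def last_dir_def mt m1)
      have "beval extends_exp (run (view 7) t) \<longleftrightarrow> ?ok k"
        using k(4) d v by (simp add: beval_extends_exp run_view)
      then have "?P (Suc k) (run ?c t)"
        using k(2) by (auto simp: run_view less_Suc_eq)
      then show "wp ?c 200 (?P (Suc k)) t"
        by (intro wp_run) (simp_all add: view_def extends_exp_def)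
    qed (use in0 m1 q1 in \<open>simp_all add: view_def\<close>)
    then show "wp (Seq (For 8 obstacle_count ?c) (If (NLess (NConst 0) (NVar 9))
       (Seq (For 8 obstacle_count (Seq (view 7) (Seq update_first update_last)))
         (NSet 10 (NVar 7) (NConst 1))) Skip)) (1900 * (h + 1)) (\<lambda>t. current t (grow X T (p y))) s1"
    proof (rule wp_Seq[where ?K2.0 = "1500 * (h + 1)"])
      fix s2 assume f2: "frame (For 8 obstacle_count ?c) s1 s2" and q2: "0 < nat_mem s2 9 0 \<longleftrightarrow> (\<forall>i<h. ?ok i)"
      note m2 = frameD[OF f2, simplified view_def update_first_def update_last_def, simplified]
      have ok: "0 < nat_mem s2 9 0 \<longleftrightarrow> convex hull (insert (p y) T) \<inter> X = {}"
        unfolding q2 using extends_view[OF vw] by (simp add: all_obstacles[symmetric])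
      have d2: "first_dir s2 = first_dir s" "last_dir s2 = last_dir s"
        by (intro dir_cong; simp add: m1 m2)+
      let ?s = "tick (1 + bcost (NLess (NConst 0) (NVar 9))) s2"
      let ?d = "Seq (view 7) (Seq update_first update_last)"
      show "wp (If (NLess (NConst 0) (NVar 9)) (Seq (For 8 obstacle_count ?d)
         (NSet 10 (NVar 7) (NConst 1))) Skip) (1500 * (h + 1)) (\<lambda>t. current t (grow X T (p y))) s2"
      proof (rule wp_If[where K = "1400 * (h + 1)"])
        assume "beval (NLess (NConst 0) (NVar 9)) s2"
        then have acc: "convex hull (insert (p y) T) \<inter> X = {}" using ok by simp
        let ?P = "\<lambda>k t. \<forall>i<h. first_dir t i = (if i < k then ?r i else first_dir s i) \<and>
            last_dir t i = (if i < k then ?l i else last_dir s i)"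
        have "wp (For 8 obstacle_count ?d) (400 * (h + 1)) (?P h) ?s"
        proof (rule wp_For[where B = 300 and P = ?P and N = h])
          fix k t
          assume k: "k < h" "?P k t" "frame (For 8 obstacle_count ?d) ?s t" "nat_mem t 8 0 = k"
          note mt = frameD[OF k(3), simplified view_def update_first_def update_last_def, simplified]
          have v: "viewed (run (view 7) t) = ?q k"
            using s k(1,4) by (simp add: run_view sorted_input_def mt m1 m2)
          have n: "nat_mem (run (view 7) t) 8 0 = k" using k(4) by (simp add: run_view)
          have "?P (Suc k) (run ?d t)"
            unfolding run.simps(6)[of "view 7"] run_update_dirs[OF n] run_view(2,3) v
            using k(2) by (simp add: less_Suc_eq)
          then show "wp ?d 300 (?P (Suc k)) t"
            by (intro wp_run) (simp_all add: view_def update_first_def update_last_def)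
        qed (use in0 in \<open>simp_all add: view_def update_first_def update_last_def d2 m1 m2\<close>)
        then show "wp (Seq (For 8 obstacle_count ?d) (NSet 10 (NVar 7) (NConst 1))) (1400 * (h + 1))
           (\<lambda>t. current t (grow X T (p y))) ?s"
        proof (rule wp_Seq[where ?K2.0 = 10])
          fix s3 assume f3: "frame (For 8 obstacle_count ?d) ?s s3" and q3: "?P h s3"
          note m3 = frameD[OF f3, simplified view_def update_first_def update_last_def, simplified]
          let ?u = "run (NSet 10 (NVar 7) (NConst 1)) s3"
          have "spanned (?r i) (?l i) ((\<lambda>q. q - xs ! i) ` insert (p y) T)" if "i < h" for i
            unfolding image_insert
            using vw that acc extends_view[OF vw that, of "p y"]
            by (intro spanned_update) (simp_all add: views_def all_obstacles[symmetric])
          then have "views s3 (insert (p y) T)" using q3 by (simp add: views_def)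
          then have "views ?u (insert (p y) T)" by (simp add: views_def)
          moreover have "flags 10 ?u (insert (p y) T)"
            using s p_inj by (auto simp: flags_def current_def m1 m2 m3)
          ultimately have "current ?u (grow X T (p y))" using acc by (simp add: current_def grow_def)
          then show "wp (NSet 10 (NVar 7) (NConst 1)) 10 (\<lambda>t. current t (grow X T (p y))) s3"
            by (intro wp_run) simp_all
        qed simp
      next
        assume "\<not> beval (NLess (NConst 0) (NVar 9)) s2"
        then have "grow X T (p y) = T" using ok by (simp add: grow_def)
        moreover have "current ?s T"
          using s(2) by (simp add: current_def flags_def views_def d2 m1 m2)
        ultimately show "wp Skip (1400 * (h + 1)) (\<lambda>t. current t (grow X T (p y))) ?s"
          by (intro wp_run) (simp_all add: current_def flags_def views_def)
      qed simp
    qed simp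
  qed (simp_all add: wp_run)
qed

end

section \<open>Generating the neighbors\<close>

lemma wp_For_scaled:
  assumes "neval n s = N" "nat_reads n \<inter> insert i (nat_writes c) = {}" "ncost n \<le> 4"
    and "i \<notin> nat_writes c" "P 0 s"
    and "\<And>k t q v. P k t \<Longrightarrow> P k (tick q (nat_store i 0 v t))"
    and "\<And>k t. k < N \<Longrightarrow> P k t \<Longrightarrow> frame (For i n c) s t \<Longrightarrow> nat_mem t i 0 = k \<Longrightarrow>
      wp c (C * M) (P (Suc k)) t"
    and "0 < M" "(C + 14) * ((N + 1) * M) \<le> K"
  shows "wp (For i n c) K (P N) s"
proof (rule wp_For[OF assms(1-7)])
  have "(N + 1) * (C * M + 14) \<le> (N + 1) * (C * M + 14 * M)"
    using assms(8) by (intro mult_le_mono) auto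
  also have "\<dots> = (C + 14) * ((N + 1) * M)" by (simp add: algebra_simps)
  finally show "(N + 1) * (C * M + 14) \<le> K" using assms(9) by (rule le_trans)
qed

definition flagged :: "nat \<Rightarrow> bexp" where
  "flagged a = NLess (NConst 0) (NGet a (NVar 7))"

definition always :: bexp where
  "always = NLess (NConst 0) (NConst 1)"

definition extend :: "nat \<Rightarrow> com" where
  "extend a = Seq clear (Seq (add_points (flagged a)) (add_points always))"

lemma extend_writes [simp]:
  "nat_writes (extend a) = {7, 8, 9, 10}" "real_writes (extend a) = {6, 7, 8, 9, 10, 11}" "silent (extend a)"
  by (auto simp: extend_def)

text \<open>Further natural arrays: 11 the set S whose neighbors are computed, 12 the obstacles that block
  the point stored in 14, 13 the wedge of this point given by the obstacle stored in 15, where the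
  value \<open>h\<close> stands for \<open>None\<close>.\<close>

definition mark_blocked :: com where
  "mark_blocked = Seq (Seq clear (add_points (flagged 11)))
     (For 8 obstacle_count (Seq (view 14)
       (If extends_exp (NSet 12 (NVar 8) (NConst 0)) (NSet 12 (NVar 8) (NConst 1)))))"

definition ahead_exp :: "rexp \<Rightarrow> rexp \<Rightarrow> bexp" where
  "ahead_exp zx zy = BOr (BNot (NLess (NVar 15) obstacle_count))
     (RLess (RConst 0) (cross_exp (RSub (RGet 2 (NVar 15)) (RGet 4 (NVar 14))) (RSub (RGet 3 (NVar 15)) (RGet 5 (NVar 14)))
       (RSub zx (RGet 4 (NVar 14))) (RSub zy (RGet 5 (NVar 14)))))"

definition blocks_exp :: bexp where
  "blocks_exp = BAnd (NLess (NConst 0) (NGet 12 (NVar 8))) (BAnd (ahead_exp (RGet 2 (NVar 8)) (RGet 3 (NVar 8)))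
     (BNot (RLess (cross_exp (RSub (RGet 2 (NVar 8)) (RGet 4 (NVar 14))) (RSub (RGet 3 (NVar 8)) (RGet 5 (NVar 14)))
       (RSub (RGet 4 (NVar 7)) (RGet 4 (NVar 14))) (RSub (RGet 5 (NVar 7)) (RGet 5 (NVar 14)))) (RConst 0))))"

definition compute_wedge :: com where
  "compute_wedge = Seq (For 7 point_count
     (Seq (If (ahead_exp (RGet 4 (NVar 7)) (RGet 5 (NVar 7))) (NSet 13 (NVar 7) (NGet 11 (NVar 7)))
         (NSet 13 (NVar 7) (NConst 0)))
       (For 8 obstacle_count (If blocks_exp (NSet 13 (NVar 7) (NConst 0)) Skip))))
     (NSet 13 (NVar 14) (NConst 1))"

definition process :: "com \<Rightarrow> com" where
  "process act = For 14 point_count (Seq mark_blocked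
     (For 15 (NAdd obstacle_count (NConst 1)) (Seq compute_wedge (Seq (extend 13) act))))"

lemma mark_blocked_writes [simp]:
  "nat_writes mark_blocked = {7, 8, 9, 10, 12}" "real_writes mark_blocked = {6, 7, 8, 9, 10, 11}" "silent mark_blocked"
  by (auto simp: mark_blocked_def view_def)

lemma compute_wedge_writes [simp]:
  "nat_writes compute_wedge = {7, 8, 13}" "real_writes compute_wedge = {}" "silent compute_wedge"
  by (auto simp: compute_wedge_def)

lemma process_writes [simp]:
  "nat_writes (process act) = {7, 8, 9, 10, 12, 13, 14, 15} \<union> nat_writes act"
  "real_writes (process act) = {6, 7, 8, 9, 10, 11} \<union> real_writes act" "silent (process act) = silent act"
  by (auto simp: process_def)

context input
begin

definition jh :: nat where "jh = (j + 1) * (h + 1)"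

lemma jh_ge: "j + 1 \<le> jh" "h + 1 \<le> jh" "0 < jh" "1 \<le> jh"
  by (simp_all add: jh_def)

lemma sorted_input_counts: "sorted_input s \<Longrightarrow> nat_mem s 0 0 = j \<and> nat_mem s 0 (Suc 0) = h"
  by (simp add: sorted_input_def)

lemma flags_cong: "flags a s T \<Longrightarrow> nat_mem t a = nat_mem s a \<Longrightarrow> flags a t T"
  by (simp add: flags_def)

lemma flags_simps [simp]:
  "flags a (tick q s) T = flags a s T" "b \<noteq> a \<Longrightarrow> flags a (nat_store b i v s) T = flags a s T"
  by (simp_all add: flags_def)

lemma current_simps [simp]:
  "current (tick q s) T = current s T" "b \<noteq> 10 \<Longrightarrow> current (nat_store b i v s) T = current s T"
  by (simp_all add: current_def views_def)

lemma wp_clear: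
  assumes s: "sorted_input s"
  shows "wp clear (200 * jh) (\<lambda>t. current t {}) s"
  unfolding clear_def
proof (rule wp_Seq[where ?K1.0 = "50 * jh" and ?K2.0 = "100 * jh"])
  note counts = sorted_input_counts[OF s]
  let ?c = "NSet 10 (NVar 7) (NConst 0)"
  let ?P = "\<lambda>k t :: state. \<forall>y<k. nat_mem t 10 y = 0"
  show "wp (For 7 point_count ?c) (50 * jh) (?P j) s"
  proof (rule wp_For[where B = 10 and P = ?P and N = j])
    fix k t assume "?P k t" "nat_mem t 7 0 = k"
    then show "wp ?c 10 (?P (Suc k)) t" by (intro wp_run) (auto simp: less_Suc_eq)
  qed (use counts jh_ge in simp_all)
  fix s1 assume f1: "frame (For 7 point_count ?c) s s1" and q1: "?P j s1"
  note m1 = frameD[OF f1, simplified]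
  let ?d = "Seq (Seq (RSet 8 (NVar 8) (RConst 0)) (RSet 9 (NVar 8) (RConst 0)))
       (Seq (RSet 10 (NVar 8) (RConst 0)) (RSet 11 (NVar 8) (RConst 0)))"
  let ?Q = "\<lambda>k t. (\<forall>i<k. first_dir t i = 0 \<and> last_dir t i = 0)"
  have "wp (For 8 obstacle_count ?d) (100 * jh) (?Q h) s1"
  proof (rule wp_For[where B = 30 and P = ?Q and N = h])
    fix k t assume k: "?Q k t" "nat_mem t 8 0 = k"
    then have "first_dir (run ?d t) i = (if i = k then 0 else first_dir t i)"
      "last_dir (run ?d t) i = (if i = k then 0 else last_dir t i)" for i
      by (simp_all add: first_dir_def last_dir_def zero_prod_def)
    with k show "wp ?d 30 (?Q (Suc k)) t"
      by (intro wp_run) (auto simp: less_Suc_eq simp del: run.simps)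
  qed (use counts jh_ge in \<open>simp_all add: m1\<close>)
  then show "wp (For 8 obstacle_count ?d) (100 * jh) (\<lambda>t. current t {}) s1"
  proof (rule wp_mono)
    fix t assume f: "frame (For 8 obstacle_count ?d) s1 t" and q: "?Q h t"
    show "current t {}" using q q1 frameD[OF f, simplified]
      by (simp add: current_def flags_def views_def spanned_def)
  qed simp
qed simp

lemma wp_add_points:
  assumes s: "sorted_input s" "current s T"
    and b: "\<And>y t. y < j \<Longrightarrow> nat_mem t 7 0 = y \<Longrightarrow>
        (\<And>a. a \<notin> {7, 8, 9, 10} \<Longrightarrow> nat_mem t a = nat_mem s a) \<Longrightarrow> beval b t \<longleftrightarrow> p y \<in> A"
    and cost: "bcost b \<le> 10"
  shows "wp (add_points b) (2100 * jh) (\<lambda>t. current t (foldl (grow X) T (filter (\<lambda>q. q \<in> A) (points V)))) s"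
proof -
  let ?T = "\<lambda>k. foldl (grow X) T (filter (\<lambda>q. q \<in> A) (map p [0..<k]))"
  let ?P = "\<lambda>k t. current t (?T k)"
  have "wp (add_points b) (2100 * jh) (?P j) s"
    unfolding add_points_def
  proof (rule wp_For_scaled[where C = 2020 and M = "h + 1" and P = ?P and N = j])
    fix k t
    assume k: "k < j" "?P k t" "frame (For 7 point_count (If b try_point Skip)) s t" "nat_mem t 7 0 = k"
    note mt = frameD[OF k(3), simplified]
    have inp: "sorted_input t" using s(1) by (rule sorted_input_frame[OF _ k(3)]) auto
    have bt: "beval b t \<longleftrightarrow> p k \<in> A" using k(1,4) by (rule b) (simp add: mt)
    show "wp (If b try_point Skip) (2020 * (h + 1)) (?P (Suc k)) t"
    proof (rule wp_If[where K = "2000 * (h + 1)"])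
      assume "beval b t"
      then have e: "?T (Suc k) = grow X (?T k) (p k)" using bt by simp
      show "wp try_point (2000 * (h + 1)) (?P (Suc k)) (tick (1 + bcost b) t)"
        unfolding e using inp k by (intro wp_try_point) (simp_all add: sorted_input_def)
    next
      assume "\<not> beval b t"
      then have "?T (Suc k) = ?T k" using bt by simp
      then show "wp Skip (2000 * (h + 1)) (?P (Suc k)) (tick (1 + bcost b) t)"
        using k(2) by (intro wp_run) simp_all
    qed (use cost in simp)
  qed (use s sorted_input_counts[OF s(1)] in \<open>simp_all add: jh_def\<close>)
  then show ?thesis by (simp add: points_def card_V)
qed

lemma beval_flagged:
  assumes "flags a s A" "a \<notin> {7, 8, 9, 10}" "y < j" "nat_mem t 7 0 = y"
    "\<And>a. a \<notin> {7, 8, 9, 10} \<Longrightarrow> nat_mem t a = nat_mem s a"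
  shows "beval (flagged a) t \<longleftrightarrow> p y \<in> A"
  using assms by (simp add: flagged_def flags_def)

lemma wp_extend:
  assumes s: "sorted_input s" "flags a s A" "a \<notin> {7, 8, 9, 10}"
  shows "wp (extend a) (4500 * jh) (\<lambda>t. current t (ext V X A)) s"
  unfolding extend_def
proof (rule wp_Seq[OF wp_clear[OF s(1)]])
  fix s1 assume f1: "frame clear s s1" and q1: "current s1 {}"
  have i1: "sorted_input s1" using s(1) by (rule sorted_input_frame[OF _ f1]) auto
  have a1: "flags a s1 A" using s(2,3) by (intro flags_cong[OF s(2)] frameD(1)[OF f1]) auto
  show "wp (Seq (add_points (flagged a)) (add_points always)) (4300 * jh) (\<lambda>t. current t (ext V X A)) s1"
  proof (rule wp_Seq[OF wp_add_points[OF i1 q1]])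
    fix s2 assume f2: "frame (add_points (flagged a)) s1 s2"
      and q2: "current s2 (foldl (grow X) {} (filter (\<lambda>q. q \<in> A) (points V)))"
    have i2: "sorted_input s2" using i1 by (rule sorted_input_frame[OF _ f2]) auto
    have "wp (add_points always) (2100 * jh)
        (\<lambda>t. current t (foldl (grow X) (foldl (grow X) {} (filter (\<lambda>q. q \<in> A) (points V)))
          (filter (\<lambda>q. q \<in> UNIV) (points V)))) s2"
      by (rule wp_add_points[OF i2 q2]) (simp_all add: always_def)
    then show "wp (add_points always) (2100 * jh) (\<lambda>t. current t (ext V X A)) s2"
      by (simp add: ext_def)
  next
    fix y and t :: state
    assume *: "y < j" "nat_mem t 7 0 = y" "\<And>a. a \<notin> {7, 8, 9, 10} \<Longrightarrow> nat_mem t a = nat_mem s1 a"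
    show "beval (flagged a) t \<longleftrightarrow> p y \<in> A" by (rule beval_flagged[OF a1 s(3) *])
  qed (simp_all add: flagged_def)
qed simp

lemma wp_mark_blocked:
  assumes s: "sorted_input s" "flags 11 s S" "S \<subseteq> V" "convex hull S \<inter> X = {}" "nat_mem s 14 0 = y" "y < j"
  shows "wp mark_blocked (2700 * jh)
    (\<lambda>t. \<forall>i<h. nat_mem t 12 i = (if xs ! i \<in> blocked X S (p y) then 1 else 0)) s"
  unfolding mark_blocked_def
proof (rule wp_Seq[where ?K2.0 = "300 * jh"])
  show "wp (Seq clear (add_points (flagged 11))) (2400 * jh) (\<lambda>t. current t S) s"
  proof (rule wp_Seq[OF wp_clear[OF s(1)]])
    fix s1 assume f1: "frame clear s s1" and q1: "current s1 {}"
    have i1: "sorted_input s1" using s(1) by (rule sorted_input_frame[OF _ f1]) auto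
    have a1: "flags 11 s1 S" by (intro flags_cong[OF s(2)] frameD(1)[OF f1]) auto
    have "foldl (grow X) {} (filter (\<lambda>q. q \<in> S) (points V)) = {} \<union> set (filter (\<lambda>q. q \<in> S) (points V))"
      by (rule grow_accept[OF s(4)]) auto
    also have "\<dots> = S" using s(3) set_points[of V] by auto
    finally have e: "foldl (grow X) {} (filter (\<lambda>q. q \<in> S) (points V)) = S" .
    have "wp (add_points (flagged 11)) (2100 * jh)
        (\<lambda>t. current t (foldl (grow X) {} (filter (\<lambda>q. q \<in> S) (points V)))) s1"
    proof (rule wp_add_points[OF i1 q1])
      fix y and t :: state
      assume *: "y < j" "nat_mem t 7 0 = y" "\<And>a. a \<notin> {7, 8, 9, 10} \<Longrightarrow> nat_mem t a = nat_mem s1 a"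
      show "beval (flagged 11) t \<longleftrightarrow> p y \<in> S" by (rule beval_flagged[OF a1 _ *]) simp
    qed (simp add: flagged_def)
    then show "wp (add_points (flagged 11)) (2100 * jh) (\<lambda>t. current t S) s1" unfolding e .
  qed simp
next
  fix s1 assume f1: "frame (Seq clear (add_points (flagged 11))) s s1" and q1: "current s1 S"
  note m1 = frameD[OF f1, simplified]
  have i1: "sorted_input s1" using s(1) by (rule sorted_input_frame[OF _ f1]) auto
  let ?c = "Seq (view 14) (If extends_exp (NSet 12 (NVar 8) (NConst 0)) (NSet 12 (NVar 8) (NConst 1)))"
  let ?P = "\<lambda>k t. \<forall>i<k. nat_mem t 12 i = (if xs ! i \<in> blocked X S (p y) then 1 else 0)"
  show "wp (For 8 obstacle_count ?c) (300 * jh) (?P h) s1"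
  proof (rule wp_For[where B = 250 and P = ?P and N = h])
    fix k t
    assume k: "k < h" "?P k t" "frame (For 8 obstacle_count ?c) s1 t" "nat_mem t 8 0 = k"
    note mt = frameD[OF k(3), simplified view_def, simplified]
    have "real_mem t 2 k = fst (xs ! k)" "real_mem t 3 k = snd (xs ! k)"
      "real_mem t 4 y = fst (p y)" "real_mem t 5 y = snd (p y)" "nat_mem t 14 0 = y"
      using i1 k(1) s(5,6) by (simp_all add: sorted_input_def mt m1)
    then have v: "viewed (run (view 14) t) = p y - xs ! k"
      using k(4) by (simp add: run_view)
    have d: "first_dir t = first_dir s1" "last_dir t = last_dir s1"
      by (intro dir_cong; simp add: mt)+
    have "views s1 S" using q1 by (simp add: current_def)
    from extends_view[OF this k(1), of "p y"]
    have "beval extends_exp (run (view 14) t) \<longleftrightarrow> xs ! k \<notin> blocked X S (p y)"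
      using k(1,4) v d by (simp add: beval_extends_exp run_view blocked_def)
    then have "?P (Suc k) (run ?c t)"
      using k(2,4) by (simp add: run_view less_Suc_eq)
    then show "wp ?c 250 (?P (Suc k)) t"
      by (intro wp_run) (simp_all add: view_def extends_exp_def)
  qed (use sorted_input_counts[OF i1] jh_ge in \<open>simp_all add: view_def\<close>)
qed simp

definition dir :: "nat \<Rightarrow> point option" where
  "dir k = (if k < h then Some (xs ! k) else None)"

lemma dir_image: "dir ` {..<h + 1} = insert None (Some ` X)"
proof -
  have "dir ` {..<h} = Some ` X"
    by (auto simp: dir_def set_conv_nth image_iff)
  moreover have "{..<h + 1} = insert h {..<h}" by auto
  moreover have "dir h = None" by (simp add: dir_def)
  ultimately show ?thesis by (simp only: image_insert)
qed

lemma coordinates: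
  assumes "sorted_input t"
  shows "i < h \<Longrightarrow> real_mem t 2 i = fst (xs ! i)" "i < h \<Longrightarrow> real_mem t 3 i = snd (xs ! i)"
    "y < j \<Longrightarrow> real_mem t 4 y = fst (p y)" "y < j \<Longrightarrow> real_mem t 5 y = snd (p y)"
  using assms by (simp_all add: sorted_input_def)

lemma beval_ahead_exp:
  assumes t: "sorted_input t" "nat_mem t 14 0 = y" "y < j" "nat_mem t 15 0 = k"
  shows "beval (ahead_exp zx zy) t \<longleftrightarrow> ahead (p y) (dir k) (reval zx t, reval zy t)"
  using t(2-4) sorted_input_counts[OF t(1)] coordinates[OF t(1)]
  by (simp add: ahead_exp_def ahead_def dir_def minus_prod_def)

lemma bcost_ahead_exp: "bcost (ahead_exp zx zy) = 37 + rcost zx + rcost zy"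
  by (simp add: ahead_exp_def)

definition blocks :: "point set \<Rightarrow> nat \<Rightarrow> nat \<Rightarrow> nat \<Rightarrow> nat \<Rightarrow> bool" where
  "blocks S y k m i \<longleftrightarrow> xs ! i \<in> blocked X S (p y) \<and> ahead (p y) (dir k) (xs ! i) \<and>
     \<not> cross (xs ! i - p y) (p m - p y) < 0"

lemma wedge_iff:
  "z \<in> wedge X S (p y) (dir k) \<longleftrightarrow> z \<in> S \<and> ahead (p y) (dir k) z \<and>
    (\<forall>i<h. xs ! i \<in> blocked X S (p y) \<longrightarrow> ahead (p y) (dir k) (xs ! i) \<longrightarrow> cross (xs ! i - p y) (z - p y) < 0)"
proof -
  have "\<exists>i<h. x = xs ! i" if "x \<in> blocked X S (p y)" for x
    using that in_set_conv_nth[of x xs] by (auto simp: blocked_def)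
  then have "(\<forall>x\<in>blocked X S (p y). Q x) \<longleftrightarrow> (\<forall>i<h. xs ! i \<in> blocked X S (p y) \<longrightarrow> Q (xs ! i))" for Q
    by blast
  then show ?thesis unfolding wedge_def by simp
qed

lemma beval_blocks_exp:
  assumes t: "sorted_input t" "nat_mem t 14 0 = y" "y < j" "nat_mem t 15 0 = k"
    and i: "nat_mem t 8 0 = i" "i < h" "nat_mem t 7 0 = m" "m < j"
    and b: "nat_mem t 12 i = (if xs ! i \<in> blocked X S (p y) then 1 else 0)"
  shows "beval blocks_exp t \<longleftrightarrow> blocks S y k m i"
proof -
  have "beval (ahead_exp (RGet 2 (NVar 8)) (RGet 3 (NVar 8))) t \<longleftrightarrow> ahead (p y) (dir k) (xs ! i)"
    using i coordinates[OF t(1)] by (simp add: beval_ahead_exp[OF t])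
  then show ?thesis
    using i b t(2,3) coordinates[OF t(1)] by (simp add: blocks_exp_def blocks_def minus_prod_def)
qed

lemma wp_compute_wedge:
  assumes s: "sorted_input s" "flags 11 s S" "nat_mem s 14 0 = y" "y < j" "nat_mem s 15 0 = k"
    and b: "\<forall>i<h. nat_mem s 12 i = (if xs ! i \<in> blocked X S (p y) then 1 else 0)"
  shows "wp compute_wedge (500 * jh) (\<lambda>t. flags 13 t (insert (p y) (wedge X S (p y) (dir k)))) s"
  unfolding compute_wedge_def
proof (rule wp_Seq[where ?K2.0 = "10"])
  let ?W = "wedge X S (p y) (dir k)"
  let ?a = "If (ahead_exp (RGet 4 (NVar 7)) (RGet 5 (NVar 7))) (NSet 13 (NVar 7) (NGet 11 (NVar 7)))
         (NSet 13 (NVar 7) (NConst 0))"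
  let ?b = "If blocks_exp (NSet 13 (NVar 7) (NConst 0)) Skip"
  let ?c = "Seq ?a (For 8 obstacle_count ?b)"
  let ?P = "\<lambda>m t :: state. \<forall>z<m. nat_mem t 13 z = (if p z \<in> ?W then 1 else 0)"
  show "wp (For 7 point_count ?c) (450 * jh) (?P j) s"
  proof (rule wp_For_scaled[where C = 400 and M = "h + 1" and P = ?P and N = j])
    fix m t
    assume m: "m < j" "?P m t" "frame (For 7 point_count ?c) s t" "nat_mem t 7 0 = m"
    note mt = frameD[OF m(3), simplified]
    have it: "sorted_input t" using s(1) by (rule sorted_input_frame[OF _ m(3)]) auto
    let ?Q = "\<lambda>n t :: state. (\<forall>z<m. nat_mem t 13 z = (if p z \<in> ?W then 1 else 0)) \<and>
       nat_mem t 13 m = (if p m \<in> S \<and> ahead (p y) (dir k) (p m) \<and> (\<forall>i<n. \<not> blocks S y k m i) then 1 else 0)"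
    show "wp ?c (400 * (h + 1)) (?P (Suc m)) t"
    proof (rule wp_Seq[where ?K1.0 = 100 and ?K2.0 = "300 * (h + 1)"])
      have "beval (ahead_exp (RGet 4 (NVar 7)) (RGet 5 (NVar 7))) t \<longleftrightarrow> ahead (p y) (dir k) (p m)"
        using s(3-5) m(1,4) coordinates[OF it] by (subst beval_ahead_exp[OF it]) (simp_all add: mt)
      moreover have "nat_mem t 11 m = (if p m \<in> S then 1 else 0)"
        using s(2) m(1) by (simp add: flags_def mt)
      ultimately have "?Q 0 (run ?a t)" using m(2,4) by simp
      then show "wp ?a 100 (?Q 0) t" by (intro wp_run) (simp_all add: bcost_ahead_exp)
    next
      fix u assume fu: "frame ?a t u" and q: "?Q 0 u"
      note mu = frameD[OF fu, simplified]
      have iu: "sorted_input u" using it by (rule sorted_input_frame[OF _ fu]) auto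
      have "wp (For 8 obstacle_count ?b) (300 * (h + 1)) (?Q h) u"
      proof (rule wp_For[where B = 200 and P = ?Q and N = h])
        fix i w
        assume i: "i < h" "?Q i w" "frame (For 8 obstacle_count ?b) u w" "nat_mem w 8 0 = i"
        note mw = frameD[OF i(3), simplified]
        have iw: "sorted_input w" using iu by (rule sorted_input_frame[OF _ i(3)]) auto
        have 7: "nat_mem w 7 0 = m" using m(4) by (simp add: mw mu)
        have "beval blocks_exp w \<longleftrightarrow> blocks S y k m i"
          using s(3-5) b i(1,4) 7 m(1) by (intro beval_blocks_exp[OF iw]) (simp_all add: mw mu mt)
        then have "?Q (Suc i) (run ?b w)" using i(2) 7 by (auto simp: less_Suc_eq)
        then show "wp ?b 200 (?Q (Suc i)) w"
          by (intro wp_run) (simp_all add: blocks_exp_def bcost_ahead_exp)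
      qed (use sorted_input_counts[OF iu] q in \<open>simp_all\<close>)
      then show "wp (For 8 obstacle_count ?b) (300 * (h + 1)) (?P (Suc m)) u"
      proof (rule wp_mono)
        fix w assume w: "?Q h w"
        then have "nat_mem w 13 m = (if p m \<in> ?W then 1 else 0)"
          unfolding wedge_iff blocks_def by auto
        with w show "?P (Suc m) w" by (simp add: less_Suc_eq)
      qed simp
    qed simp
  qed (use sorted_input_counts[OF s(1)] in \<open>simp_all add: jh_def\<close>)
  fix u assume fu: "frame (For 7 point_count ?c) s u" and q: "?P j u"
  note mu = frameD[OF fu, simplified]
  show "wp (NSet 13 (NVar 14) (NConst 1)) 10 (\<lambda>t. flags 13 t (insert (p y) ?W)) u"
    using q s(3,4) p_inj by (intro wp_run) (auto simp: flags_def mu)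
qed (use jh_ge in simp)

definition nbr :: "point set \<Rightarrow> nat \<Rightarrow> nat \<Rightarrow> point set" where
  "nbr S y k = ext V X (insert (p y) (wedge X S (p y) (dir k)))"

definition nbr_row :: "point set \<Rightarrow> nat \<Rightarrow> point set list" where
  "nbr_row S y = map (nbr S y) [0..<h + 1]"

definition nbr_list :: "point set \<Rightarrow> point set list" where
  "nbr_list S = concat (map (nbr_row S) [0..<j])"

lemma set_nbr_list: "set (nbr_list S) = nbrs V X S"
proof -
  have V: "V = p ` {..<j}" using pt_image[of V] card_V by simp
  have "nbrs V X S = (\<lambda>(v, d). ext V X (insert v (wedge X S v d))) ` (V \<times> dir ` {..<h + 1})"
    unfolding nbrs_def dir_image ..
  also have "\<dots> = (\<Union>y\<in>{..<j}. \<Union>k\<in>{..<h + 1}. {nbr S y k})"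
    unfolding nbr_def by (subst (2) V) blast
  also have "\<dots> = set (nbr_list S)"
    by (auto simp: nbr_list_def nbr_row_def simp del: upt_Suc) blast
  finally show ?thesis ..
qed

lemma wp_process:
  assumes s: "sorted_input s" "flags 11 s S" "S \<subseteq> V" "convex hull S \<inter> X = {}" "Inv L s"
    and act: "\<And>L T t. Inv L t \<Longrightarrow> sorted_input t \<Longrightarrow> current t T \<Longrightarrow> maximal_obstacle_free V X T \<Longrightarrow>
        wp act (C * jh) (Inv (L @ [T])) t"
    and stable: "\<And>L t u. Inv L t \<Longrightarrow> (\<And>a. a \<notin> {7, 8, 9, 10, 12, 13, 14, 15} \<Longrightarrow> nat_mem u a = nat_mem t a) \<Longrightarrow>
        buffer u = buffer t \<Longrightarrow> outputs u = outputs t \<Longrightarrow> Inv L u"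
    and writes: "nat_writes act \<inter> {0, 2, 11, 12, 14, 15} = {}" "real_writes act = {}"
  shows "wp (process act) ((2 * C + 20000) * (jh * jh)) (Inv (L @ nbr_list S)) s"
proof -
  let ?in = "Seq compute_wedge (Seq (extend 13) act)"
  let ?c = "Seq mark_blocked (For 15 (NAdd obstacle_count (NConst 1)) ?in)"
  let ?P = "\<lambda>y. Inv (L @ concat (map (nbr_row S) [0..<y]))"
  have aw: "a \<notin> nat_writes act" if "a \<in> {0, 2, 11, 12, 14, 15}" for a using writes that by blast
  have "wp (process act) ((2 * C + 20000) * (jh * jh)) (?P j) s"
    unfolding process_def
  proof (rule wp_For_scaled[where C = "2 * C + 15000" and M = "(h + 1) * jh" and P = ?P and N = j])
    fix y t
    assume y: "y < j" "?P y t" "frame (For 14 point_count ?c) s t" "nat_mem t 14 0 = y"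
    have it: "sorted_input t" using s(1) writes by (intro sorted_input_frame[OF _ y(3)]) auto
    have St: "flags 11 t S" using aw by (intro flags_cong[OF s(2)] frameD(1)[OF y(3)]) auto
    show "wp ?c ((2 * C + 15000) * ((h + 1) * jh)) (?P (Suc y)) t"
    proof (rule wp_Seq[OF wp_mark_blocked[OF it St s(3,4) y(4,1)]])
      fix t1 assume f1: "frame mark_blocked t t1"
        and b1: "\<forall>i<h. nat_mem t1 12 i = (if xs ! i \<in> blocked X S (p y) then 1 else 0)"
      note m1 = frameD[OF f1, simplified]
      have i1: "sorted_input t1" using it by (rule sorted_input_frame[OF _ f1]) auto
      have S1: "flags 11 t1 S" by (intro flags_cong[OF St] frameD(1)[OF f1]) auto
      have y1: "nat_mem t1 14 0 = y" using y(4) by (simp add: m1)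
      let ?R = "\<lambda>k. Inv (L @ concat (map (nbr_row S) [0..<y]) @ map (nbr S y) [0..<k])"
      have "wp (For 15 (NAdd obstacle_count (NConst 1)) ?in) ((C + 5014) * ((h + 2) * jh)) (?R (h + 1)) t1"
      proof (rule wp_For_scaled[where C = "C + 5000" and M = jh and P = ?R and N = "h + 1"])
        fix k u
        assume k: "k < h + 1" "?R k u" "frame (For 15 (NAdd obstacle_count (NConst 1)) ?in) t1 u" "nat_mem u 15 0 = k"
        have iu: "sorted_input u" using i1 writes by (intro sorted_input_frame[OF _ k(3)]) auto
        have Su: "flags 11 u S" using aw by (intro flags_cong[OF S1] frameD(1)[OF k(3)]) auto
        have yu: "nat_mem u 14 0 = y" and bu: "nat_mem u 12 = nat_mem t1 12"
          using y1 aw frameD(1)[OF k(3), of 14] frameD(1)[OF k(3), of 12] by simp_all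
        show "wp ?in ((C + 5000) * jh) (?R (Suc k)) u"
        proof (rule wp_Seq[OF wp_compute_wedge[OF iu Su yu y(1) k(4)]])
          show "\<forall>i<h. nat_mem u 12 i = (if xs ! i \<in> blocked X S (p y) then 1 else 0)"
            using b1 by (simp add: bu)
          fix u1 assume fu1: "frame compute_wedge u u1"
            and W: "flags 13 u1 (insert (p y) (wedge X S (p y) (dir k)))"
          have iu1: "sorted_input u1" using iu by (rule sorted_input_frame[OF _ fu1]) auto
          have inv1: "?R k u1"
            using k(2) by (rule stable) (auto simp: frameD[OF fu1, simplified])
          show "wp (Seq (extend 13) act) ((C + 4500) * jh) (?R (Suc k)) u1"
          proof (rule wp_Seq[OF wp_extend[OF iu1 W]])
            fix u2 assume fu2: "frame (extend 13) u1 u2"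
              and T: "current u2 (ext V X (insert (p y) (wedge X S (p y) (dir k))))"
            have iu2: "sorted_input u2" using iu1 by (rule sorted_input_frame[OF _ fu2]) auto
            have inv2: "?R k u2"
              using inv1 by (rule stable) (auto simp: frameD[OF fu2, simplified])
            have "maximal_obstacle_free V X (nbr S y k)" unfolding nbr_def by (simp add: ext_maximal)
            from act[OF inv2 iu2 T[folded nbr_def] this]
            show "wp act (C * jh) (?R (Suc k)) u2" by simp
          qed (simp_all add: algebra_simps)
        qed (simp add: algebra_simps)
      next
        fix k u q v assume "?R k u"
        then show "?R k (tick q (nat_store 15 0 v u))" by (rule stable) auto
      next
        show "?R 0 t1" using y(2) by (intro stable[of _ t t1]) (auto simp: m1)
      qed (use sorted_input_counts[OF i1] aw jh_ge in \<open>simp_all\<close>)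
      moreover have "L @ concat (map (nbr_row S) [0..<y]) @ map (nbr S y) [0..<h + 1] =
          L @ concat (map (nbr_row S) [0..<Suc y])"
        by (simp add: nbr_row_def)
      ultimately show "wp (For 15 (NAdd obstacle_count (NConst 1)) ?in) ((C + 5014) * ((h + 2) * jh)) (?P (Suc y)) t1"
        by simp
    next
      have "(h + 2) * jh \<le> 2 * ((h + 1) * jh)" by (simp add: algebra_simps)
      then have "(C + 5014) * ((h + 2) * jh) \<le> (C + 5014) * (2 * ((h + 1) * jh))" by (rule mult_left_mono) simp
      also have "\<dots> = (2 * C + 10028) * ((h + 1) * jh)" by (simp add: algebra_simps)
      finally show "2700 * jh + (C + 5014) * ((h + 2) * jh) \<le> (2 * C + 15000) * ((h + 1) * jh)"
        by (simp add: algebra_simps)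
    qed
  next
    fix k t q v assume "?P k t"
    then show "?P k (tick q (nat_store 14 0 v t))" by (rule stable) auto
  next
    have "(j + 1) * ((h + 1) * jh) = jh * jh" by (simp only: jh_def mult.assoc)
    then show "(2 * C + 15000 + 14) * ((j + 1) * ((h + 1) * jh)) \<le> (2 * C + 20000) * (jh * jh)" by simp
  qed (use sorted_input_counts[OF s(1)] s(5) aw jh_ge in \<open>simp_all\<close>)
  then show ?thesis by (simp add: nbr_list_def)
qed

end

section \<open>Sorting, output and the queue of solutions\<close>

text \<open>Natural arrays 4--6 serve for sorting. The listing program uses 16 for the powers of 2, 17 for
  the code of the set under construction, 19 for the codes of the solutions found so far, 20 for
  the queue of these solutions in blocks of length \<open>j + 1\<close>, and 21 and 22 for its head and tail.\<close>

definition lex_exp :: bexp where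
  "lex_exp = BOr (RLess (RGet 0 (NVar 6)) (RGet 0 (NVar 5)))
     (BAnd (BNot (RLess (RGet 0 (NVar 5)) (RGet 0 (NVar 6)))) (RLess (RGet 1 (NVar 6)) (RGet 1 (NVar 5))))"

definition prepare :: com where
  "prepare = For 5 point_count (Seq (NSet 4 (NConst 0) (NConst 0))
     (Seq (For 6 point_count (If lex_exp (NSet 4 (NConst 0) (NAdd (NVar 4) (NConst 1))) Skip))
     (Seq (Seq (NSet 2 (NVar 4) (NVar 5)) (NSet 3 (NVar 5) (NVar 4)))
        (Seq (RSet 4 (NVar 4) (RGet 0 (NVar 5))) (RSet 5 (NVar 4) (RGet 1 (NVar 5)))))))"

definition emit_set :: "nat \<Rightarrow> com" where
  "emit_set a = For 23 point_count (If (NLess (NConst 0) (NGet a (NVar 23))) (Emit (NGet 2 (NVar 23))) Skip)"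

definition output_set :: "nat \<Rightarrow> com" where
  "output_set a = Seq (emit_set a) Commit"

definition powers :: com where
  "powers = Seq (NSet 18 (NConst 0) (NConst 1))
     (For 5 point_count (Seq (NSet 16 (NVar 5) (NVar 18)) (NSet 18 (NConst 0) (NAdd (NVar 18) (NVar 18)))))"

definition encode :: com where
  "encode = Seq (NSet 17 (NConst 0) (NConst 0))
     (For 23 point_count (If (NLess (NConst 0) (NGet 10 (NVar 23)))
       (NSet 17 (NConst 0) (NAdd (NVar 17) (NGet 16 (NVar 23)))) Skip))"

definition enqueue :: com where
  "enqueue = Seq (NSet 19 (NVar 17) (NConst 1))
     (Seq (For 23 point_count (NSet 20 (NAdd (NVar 22) (NVar 23)) (NGet 10 (NVar 23))))
       (NSet 22 (NConst 0) (NAdd (NVar 22) (NAdd point_count (NConst 1)))))"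

definition push :: com where
  "push = Seq encode (If (NLess (NConst 0) (NGet 19 (NVar 17))) Skip enqueue)"

definition load :: com where
  "load = For 23 point_count (NSet 11 (NVar 23) (NGet 20 (NAdd (NVar 21) (NVar 23))))"

lemma prepare_writes [simp]:
  "nat_writes prepare = {2, 3, 4, 5, 6}" "real_writes prepare = {4, 5}" "silent prepare"
  by (auto simp: prepare_def)

lemma emit_set_writes [simp]:
  "nat_writes (emit_set a) = {23}" "real_writes (emit_set a) = {}"
  by (auto simp: emit_set_def)

lemma output_set_writes [simp]:
  "nat_writes (output_set a) = {23}" "real_writes (output_set a) = {}"
  by (auto simp: output_set_def)

lemma powers_writes [simp]:
  "nat_writes powers = {5, 16, 18}" "real_writes powers = {}" "silent powers"
  by (auto simp: powers_def)

lemma encode_writes [simp]: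
  "nat_writes encode = {17, 23}" "real_writes encode = {}" "silent encode"
  by (auto simp: encode_def)

lemma push_writes [simp]:
  "nat_writes push = {17, 19, 20, 22, 23}" "real_writes push = {}" "silent push"
  by (auto simp: push_def enqueue_def)

lemma load_writes [simp]:
  "nat_writes load = {11, 23}" "real_writes load = {}" "silent load"
  by (auto simp: load_def)

context input
begin

definition raw_input :: "state \<Rightarrow> bool" where
  "raw_input s \<longleftrightarrow> nat_mem s 0 0 = j \<and> nat_mem s 0 (Suc 0) = h \<and>
     (\<forall>i<h. real_mem s 2 i = fst (xs ! i) \<and> real_mem s 3 i = snd (xs ! i)) \<and>
     (\<forall>i<j. real_mem s 0 i = fst (vs ! i) \<and> real_mem s 1 i = snd (vs ! i))"

lemma nth_inj: "i < j \<Longrightarrow> i' < j \<Longrightarrow> vs ! i = vs ! i' \<longleftrightarrow> i = i'"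
  using distinct by (simp add: nth_eq_iff_index_eq)

lemma rank_inj:
  assumes "i < j" "i' < j"
  shows "lex_rank V (vs ! i) = lex_rank V (vs ! i') \<longleftrightarrow> i = i'"
proof
  assume "lex_rank V (vs ! i) = lex_rank V (vs ! i')"
  then have "vs ! i = vs ! i'" using assms by (intro inj_onD[OF inj_rank[of V]]) simp_all
  then show "i = i'" using nth_inj[OF assms] by simp
qed simp

lemma rank_count: "card {m. m < j \<and> lex_less (vs ! m) q} = lex_rank V q"
  unfolding lex_rank_def
proof (rule bij_betw_same_card[where f = "\<lambda>m. vs ! m"])
  show "bij_betw (\<lambda>m. vs ! m) {m. m < j \<and> lex_less (vs ! m) q} {r \<in> V. lex_less r q}"
    unfolding bij_betw_def
  proof
    show "inj_on (\<lambda>m. vs ! m) {m. m < j \<and> lex_less (vs ! m) q}"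
      by (rule inj_onI) (simp add: nth_inj)
    show "(\<lambda>m. vs ! m) ` {m. m < j \<and> lex_less (vs ! m) q} = {r \<in> V. lex_less r q}"
      unfolding set_conv_nth by blast
  qed
qed

lemma wp_prepare:
  assumes s: "raw_input s"
  shows "wp prepare (1000 * (jh * jh)) (\<lambda>t. sorted_input t \<and> (\<forall>i<j. nat_mem t 3 i = lex_rank V (vs ! i))) s"
proof -
  let ?a = "NSet 4 (NConst 0) (NConst 0)"
  let ?b = "If lex_exp (NSet 4 (NConst 0) (NAdd (NVar 4) (NConst 1))) Skip"
  let ?d = "Seq (Seq (NSet 2 (NVar 4) (NVar 5)) (NSet 3 (NVar 5) (NVar 4)))
        (Seq (RSet 4 (NVar 4) (RGet 0 (NVar 5))) (RSet 5 (NVar 4) (RGet 1 (NVar 5))))"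
  let ?c = "Seq ?a (Seq (For 6 point_count ?b) ?d)"
  let ?rk = "\<lambda>i. lex_rank V (vs ! i)"
  let ?P = "\<lambda>k t :: state. \<forall>i<k. nat_mem t 3 i = ?rk i \<and> nat_mem t 2 (?rk i) = i \<and>
     real_mem t 4 (?rk i) = fst (vs ! i) \<and> real_mem t 5 (?rk i) = snd (vs ! i)"
  have "wp prepare (1000 * (jh * jh)) (?P j) s"
    unfolding prepare_def
  proof (rule wp_For_scaled[where C = 300 and M = "j + 1" and P = ?P and N = j])
    fix k t
    assume k: "k < j" "?P k t" "frame (For 5 point_count ?c) s t" "nat_mem t 5 0 = k"
    note mt = frameD[OF k(3), simplified]
    have cnt: "nat_mem t 0 0 = j" using s by (simp add: raw_input_def mt)
    have co: "real_mem t 0 i = fst (vs ! i)" "real_mem t 1 i = snd (vs ! i)" if "i < j" for i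
      using s that by (simp_all add: raw_input_def mt)
    let ?Q = "\<lambda>n t :: state. nat_mem t 4 0 = card {m. m < n \<and> lex_less (vs ! m) (vs ! k)}"
    show "wp ?c (300 * (j + 1)) (?P (Suc k)) t"
    proof (rule wp_Seq[where ?K1.0 = 10 and ?Q1.0 = "?Q 0" and ?K2.0 = "250 * (j + 1)"])
      show "wp ?a 10 (?Q 0) t" by (intro wp_run) simp_all
      fix t1 assume f1: "frame ?a t t1" and q1: "?Q 0 t1"
      note m1 = frameD[OF f1, simplified]
      show "wp (Seq (For 6 point_count ?b) ?d) (250 * (j + 1)) (?P (Suc k)) t1"
      proof (rule wp_Seq[where ?K1.0 = "100 * (j + 1)" and ?Q1.0 = "?Q j" and ?K2.0 = 100])
        show "wp (For 6 point_count ?b) (100 * (j + 1)) (?Q j) t1"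
        proof (rule wp_For[where B = 80 and P = ?Q and N = j])
          fix n u
          assume n: "n < j" "?Q n u" "frame (For 6 point_count ?b) t1 u" "nat_mem u 6 0 = n"
          note mu = frameD[OF n(3), simplified]
          have 5: "nat_mem u 5 0 = k" using k(4) by (simp add: mu m1)
          have "beval lex_exp u \<longleftrightarrow> lex_less (vs ! n) (vs ! k)"
            using co[OF n(1)] co[OF k(1)] n(4) 5 by (auto simp: lex_exp_def lex_less_def mu m1)
          moreover have "{m. m < Suc n \<and> lex_less (vs ! m) (vs ! k)} =
              (if lex_less (vs ! n) (vs ! k) then insert n {m. m < n \<and> lex_less (vs ! m) (vs ! k)}
               else {m. m < n \<and> lex_less (vs ! m) (vs ! k)})"
            by (auto simp: less_Suc_eq)
          ultimately have "?Q (Suc n) (run ?b u)" using n(2) by simp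
          then show "wp ?b 80 (?Q (Suc n)) u" by (intro wp_run) (simp_all add: lex_exp_def)
        qed (use cnt q1 in \<open>simp_all add: m1\<close>)
        fix t2 assume f2: "frame (For 6 point_count ?b) t1 t2" and q2: "?Q j t2"
        note m2 = frameD[OF f2, simplified]
        have r: "nat_mem t2 4 0 = ?rk k" using q2 by (simp add: rank_count)
        have 5: "nat_mem t2 5 0 = k" using k(4) by (simp add: m1 m2)
        have ne: "?rk i \<noteq> ?rk k" if "i < k" for i using rank_inj[of i k] that k(1) by auto
        have "?P (Suc k) (run ?d t2)"
          using k(2) r 5 ne co[OF k(1)] by (simp add: less_Suc_eq all_conj_distrib m1 m2)
        then show "wp ?d 100 (?P (Suc k)) t2" by (intro wp_run) simp_all
      qed simp
    qed simp
  next
    have "(j + 1) * (j + 1) \<le> jh * jh" using jh_ge by (intro mult_mono) auto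
    then show "(300 + 14) * ((j + 1) * (j + 1)) \<le> 1000 * (jh * jh)" by (rule mult_le_mono[rotated]) simp
  qed (use s in \<open>simp_all add: raw_input_def\<close>)
  then show ?thesis
  proof (rule wp_mono)
    fix t assume f: "frame prepare s t" and q: "?P j t"
    have "real_mem t 4 y = fst (p y) \<and> real_mem t 5 y = snd (p y) \<and> nat_mem t 2 y < j \<and> vs ! nat_mem t 2 y = p y"
      if y: "y < j" for y
    proof -
      obtain m where m: "m < j" "vs ! m = p y" using p_in[OF y] by (metis in_set_conv_nth)
      then have "?rk m = y" using rank_pt(2)[of V y] card_V y by simp
      then show ?thesis using q m by metis
    qed
    then show "sorted_input t \<and> (\<forall>i<j. nat_mem t 3 i = ?rk i)"
      using q s by (simp add: sorted_input_def raw_input_def frameD[OF f, simplified])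
  qed simp
qed

definition names :: "state \<Rightarrow> point set \<Rightarrow> nat list" where
  "names s T = map (nat_mem s 2) (filter (\<lambda>y. p y \<in> T) [0..<j])"

lemma p_image:
  assumes "T \<subseteq> V"
  shows "p ` {y. y < j \<and> p y \<in> T} = T"
proof
  show "T \<subseteq> p ` {y. y < j \<and> p y \<in> T}"
  proof
    fix q assume "q \<in> T"
    then have "q \<in> p ` {..<card V}" unfolding pt_image[OF List.finite_set] using assms by blast
    then show "q \<in> p ` {y. y < j \<and> p y \<in> T}"
      using \<open>q \<in> T\<close> by (elim imageE) (auto simp: card_V)
  qed
qed blast

lemma denotes_names:
  assumes "sorted_input s" "T \<subseteq> V"
  shows "denotes vs (names s T) T"
proof -
  have 2: "nat_mem s 2 y < j" "vs ! nat_mem s 2 y = p y" if "y < j" for y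
    using assms(1) that by (simp_all add: sorted_input_def)
  have "inj_on (nat_mem s 2) {y. y < j}"
    using 2 p_inj by (intro inj_onI) (metis mem_Collect_eq)
  then have "distinct (names s T)"
    unfolding names_def by (auto simp: distinct_map intro: inj_on_subset)
  moreover have "T = (\<lambda>i. vs ! i) ` set (names s T)"
  proof -
    have "(\<lambda>i. vs ! i) ` set (names s T) = (\<lambda>y. vs ! nat_mem s 2 y) ` {y. y < j \<and> p y \<in> T}"
      by (simp add: names_def image_image)
    also have "\<dots> = p ` {y. y < j \<and> p y \<in> T}"
      by (rule image_cong) (simp_all add: 2)
    also have "\<dots> = T" by (rule p_image[OF assms(2)])
    finally show ?thesis ..
  qed
  moreover have "set (names s T) \<subseteq> {..<j}" using 2 by (auto simp: names_def)
  ultimately show ?thesis by (simp add: denotes_def)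
qed

lemma wp_output_set:
  assumes s: "sorted_input s" "flags a s T" "a \<noteq> 23" "buffer s = []"
  shows "wp (output_set a) (50 * jh) (\<lambda>t. outputs t = outputs s @ [(clock t, names s T)] \<and> buffer t = []) s"
  unfolding output_set_def
proof (rule wp_Seq[where ?K1.0 = "40 * jh" and ?K2.0 = 1])
  let ?b = "If (NLess (NConst 0) (NGet a (NVar 23))) (Emit (NGet 2 (NVar 23))) Skip"
  let ?P = "\<lambda>k t :: state. buffer t = map (nat_mem s 2) (filter (\<lambda>y. p y \<in> T) [0..<k]) \<and> outputs t = outputs s"
  show "wp (emit_set a) (40 * jh) (?P j) s"
    unfolding emit_set_def
  proof (rule wp_For[where B = 20 and P = ?P and N = j])
    fix k t
    assume k: "k < j" "?P k t" "frame (For 23 point_count ?b) s t" "nat_mem t 23 0 = k"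
    note mt = frameD[OF k(3), simplified]
    have "nat_mem t a k = (if p k \<in> T then 1 else 0)" "nat_mem t 2 = nat_mem s 2"
      using s(2,3) k(1) by (simp_all add: flags_def mt)
    then have "?P (Suc k) (run ?b t)" using k(2,4) by simp
    then show "wp ?b 20 (?P (Suc k)) t" by (intro wp_run) simp_all
  qed (use sorted_input_counts[OF s(1)] s(3,4) jh_ge in \<open>simp_all\<close>)
  fix t assume "?P j t"
  then have "outputs (run Commit t) = outputs s @ [(clock (run Commit t), names s T)] \<and> buffer (run Commit t) = []"
    by (simp add: names_def)
  then show "wp Commit 1 (\<lambda>t. outputs t = outputs s @ [(clock t, names s T)] \<and> buffer t = []) t"
    by (intro wp_run) simp_all
qed (use jh_ge in simp)

lemma wp_powers:
  assumes s: "sorted_input s"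
  shows "wp powers (50 * jh) (\<lambda>t. \<forall>y<j. nat_mem t 16 y = 2 ^ y) s"
  unfolding powers_def
proof (rule wp_Seq[where ?K1.0 = 5 and ?Q1.0 = "\<lambda>t. nat_mem t 18 0 = 1" and ?K2.0 = "40 * jh"])
  fix s1 assume f1: "frame (NSet 18 (NConst 0) (NConst 1)) s s1" and q1: "nat_mem s1 18 0 = 1"
  let ?c = "Seq (NSet 16 (NVar 5) (NVar 18)) (NSet 18 (NConst 0) (NAdd (NVar 18) (NVar 18)))"
  let ?P = "\<lambda>k t :: state. nat_mem t 18 0 = 2 ^ k \<and> (\<forall>y<k. nat_mem t 16 y = 2 ^ y)"
  have "wp (For 5 point_count ?c) (40 * jh) (?P j) s1"
  proof (rule wp_For[where B = 20 and P = ?P and N = j])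
    fix k t assume "?P k t" "nat_mem t 5 0 = k"
    then have "?P (Suc k) (run ?c t)" by (simp add: less_Suc_eq)
    then show "wp ?c 20 (?P (Suc k)) t" by (intro wp_run) simp_all
  qed (use sorted_input_counts[OF s] q1 jh_ge in \<open>simp_all add: frameD[OF f1, simplified]\<close>)
  then show "wp (For 5 point_count ?c) (40 * jh) (\<lambda>t. \<forall>y<j. nat_mem t 16 y = 2 ^ y) s1"
    by (rule wp_mono) auto
qed (use jh_ge in \<open>simp_all add: wp_run\<close>)

definition code :: "point set \<Rightarrow> nat" where
  "code T = set_encode {y. y < j \<and> p y \<in> T}"

lemma code_inj:
  assumes "T \<subseteq> V" "T' \<subseteq> V" "code T = code T'"
  shows "T = T'"
proof -
  have "{y. y < j \<and> p y \<in> T} = {y. y < j \<and> p y \<in> T'}"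
    using assms(3) unfolding code_def by (intro inj_onD[OF inj_on_set_encode]) auto
  then show ?thesis using p_image[OF assms(1)] p_image[OF assms(2)] by metis
qed

lemma wp_encode:
  assumes s: "sorted_input s" "flags 10 s T" "\<forall>y<j. nat_mem s 16 y = 2 ^ y"
  shows "wp encode (50 * jh) (\<lambda>t. nat_mem t 17 0 = code T) s"
  unfolding encode_def
proof (rule wp_Seq[where ?K1.0 = 5 and ?Q1.0 = "\<lambda>t. nat_mem t 17 0 = 0" and ?K2.0 = "40 * jh"])
  fix s1 assume f1: "frame (NSet 17 (NConst 0) (NConst 0)) s s1" and q1: "nat_mem s1 17 0 = 0"
  note m1 = frameD[OF f1, simplified]
  let ?c = "If (NLess (NConst 0) (NGet 10 (NVar 23))) (NSet 17 (NConst 0) (NAdd (NVar 17) (NGet 16 (NVar 23)))) Skip"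
  let ?P = "\<lambda>k t :: state. nat_mem t 17 0 = set_encode {y. y < k \<and> p y \<in> T}"
  have "wp (For 23 point_count ?c) (40 * jh) (?P j) s1"
  proof (rule wp_For[where B = 20 and P = ?P and N = j])
    fix k t
    assume k: "k < j" "?P k t" "frame (For 23 point_count ?c) s1 t" "nat_mem t 23 0 = k"
    note mt = frameD[OF k(3), simplified]
    have a: "nat_mem t 10 k = (if p k \<in> T then 1 else 0)" "nat_mem t 16 k = 2 ^ k"
      using s(2,3) k(1) by (simp_all add: flags_def mt m1)
    have "{y. y < Suc k \<and> p y \<in> T} = (if p k \<in> T then insert k {y. y < k \<and> p y \<in> T} else {y. y < k \<and> p y \<in> T})"
      by (auto simp: less_Suc_eq)
    moreover have "set_encode (insert k {y. y < k \<and> p y \<in> T}) = 2 ^ k + set_encode {y. y < k \<and> p y \<in> T}"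
      by (rule set_encode_insert) auto
    ultimately have "?P (Suc k) (run ?c t)" using k(2,4) a by simp
    then show "wp ?c 20 (?P (Suc k)) t" by (intro wp_run) simp_all
  qed (use sorted_input_counts[OF s(1)] q1 jh_ge in \<open>simp_all add: m1\<close>)
  then show "wp (For 23 point_count ?c) (40 * jh) (\<lambda>t. nat_mem t 17 0 = code T) s1"
    by (simp add: code_def)
qed (use jh_ge in \<open>simp_all add: wp_run\<close>)

definition queue :: "state \<Rightarrow> point set list \<Rightarrow> bool" where
  "queue s Q \<longleftrightarrow> (\<forall>y<j. nat_mem s 16 y = 2 ^ y) \<and> nat_mem s 22 0 = (j + 1) * length Q \<and>
     (\<forall>i<length Q. \<forall>y<j. nat_mem s 20 ((j + 1) * i + y) = (if p y \<in> Q ! i then 1 else 0)) \<and>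
     (\<forall>T. T \<subseteq> V \<longrightarrow> nat_mem s 19 (code T) = (if T \<in> set Q then 1 else 0))"

lemma queue_cong:
  assumes "queue s Q" "nat_mem t 16 = nat_mem s 16" "nat_mem t 19 = nat_mem s 19"
    "nat_mem t 20 = nat_mem s 20" "nat_mem t 22 = nat_mem s 22"
  shows "queue t Q"
  using assms by (simp add: queue_def)

lemma wp_enqueue:
  assumes s: "sorted_input s" "flags 10 s T" "queue s Q" "T \<subseteq> V" "T \<notin> set Q" "nat_mem s 17 0 = code T"
  shows "wp enqueue (100 * jh) (\<lambda>t. queue t (Q @ [T])) s"
  unfolding enqueue_def
proof (rule wp_Seq[where ?K1.0 = 10 and ?K2.0 = "80 * jh"
      and ?Q1.0 = "\<lambda>t. nat_mem t 19 = (nat_mem s 19)(code T := 1)"])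
  show "wp (NSet 19 (NVar 17) (NConst 1)) 10 (\<lambda>t. nat_mem t 19 = (nat_mem s 19)(code T := 1)) s"
    using s(6) by (intro wp_run) simp_all
  fix s1 assume f1: "frame (NSet 19 (NVar 17) (NConst 1)) s s1" and q1: "nat_mem s1 19 = (nat_mem s 19)(code T := 1)"
  note m1 = frameD[OF f1, simplified]
  let ?c = "NSet 20 (NAdd (NVar 22) (NVar 23)) (NGet 10 (NVar 23))"
  let ?d = "NSet 22 (NConst 0) (NAdd (NVar 22) (NAdd point_count (NConst 1)))"
  let ?n = "(j + 1) * length Q"
  have n: "nat_mem s 22 0 = ?n" using s(3) by (simp add: queue_def)
  let ?P = "\<lambda>k t :: state. (\<forall>a<?n. nat_mem t 20 a = nat_mem s 20 a) \<and>
     (\<forall>y<k. nat_mem t 20 (?n + y) = (if p y \<in> T then 1 else 0))"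
  show "wp (Seq (For 23 point_count ?c) ?d) (80 * jh) (\<lambda>t. queue t (Q @ [T])) s1"
  proof (rule wp_Seq[where ?K1.0 = "50 * jh" and ?Q1.0 = "?P j" and ?K2.0 = 20])
    show "wp (For 23 point_count ?c) (50 * jh) (?P j) s1"
    proof (rule wp_For[where B = 20 and P = ?P and N = j])
      fix k t
      assume k: "k < j" "?P k t" "frame (For 23 point_count ?c) s1 t" "nat_mem t 23 0 = k"
      note mt = frameD[OF k(3), simplified]
      have "nat_mem t 22 0 = ?n" "nat_mem t 10 k = (if p k \<in> T then 1 else 0)"
        using n s(2) k(1) by (simp_all add: flags_def mt m1)
      then have "nat_mem (run ?c t) 20 = (nat_mem t 20)(?n + k := (if p k \<in> T then 1 else 0))"
        using k(4) by simp
      then have "?P (Suc k) (run ?c t)"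
        using k(2) by (simp add: less_Suc_eq del: run.simps)
      then show "wp ?c 20 (?P (Suc k)) t" by (intro wp_run) simp_all
    qed (use sorted_input_counts[OF s(1)] jh_ge in \<open>simp_all add: m1\<close>)
    fix s2 assume f2: "frame (For 23 point_count ?c) s1 s2" and q2: "?P j s2"
    note m2 = frameD[OF f2, simplified]
    let ?u = "run ?d s2"
    have u: "nat_mem ?u 16 = nat_mem s 16" "nat_mem ?u 19 = (nat_mem s 19)(code T := 1)"
      "nat_mem ?u 20 = nat_mem s2 20" "nat_mem ?u 22 0 = ?n + (j + 1)"
      using n q1 sorted_input_counts[OF s(1)] by (simp_all add: m1 m2)
    have "nat_mem s2 20 ((j + 1) * i + y) = (if p y \<in> (Q @ [T]) ! i then 1 else 0)"
      if "i < length (Q @ [T])" "y < j" for i y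
    proof (cases "i = length Q")
      case True
      then show ?thesis using q2 that(2) by simp
    next
      case False
      with that(1) have i: "i < length Q" by simp
      then have "(j + 1) * Suc i \<le> ?n" by (intro mult_le_mono2) simp
      then have "(j + 1) * i + y < ?n" using that(2) by simp
      then have "nat_mem s2 20 ((j + 1) * i + y) = nat_mem s 20 ((j + 1) * i + y)" using q2 by blast
      also have "\<dots> = (if p y \<in> Q ! i then 1 else 0)" using s(3) i that(2) unfolding queue_def by blast
      finally show ?thesis using i by (simp add: nth_append)
    qed
    moreover have "((nat_mem s 19)(code T := 1)) (code T') = (if T' \<in> set (Q @ [T]) then 1 else 0)"
      if "T' \<subseteq> V" for T'
      using s(3,4) code_inj[OF that s(4)] that by (auto simp: queue_def)
    ultimately have "queue ?u (Q @ [T])"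
      using s(3) unfolding queue_def u by simp
    then show "wp ?d 20 (\<lambda>t. queue t (Q @ [T])) s2" by (intro wp_run) simp_all
  qed (use jh_ge in simp)
qed (use jh_ge in simp)

definition add_new :: "point set list \<Rightarrow> point set \<Rightarrow> point set list" where
  "add_new Q T = (if T \<in> set Q then Q else Q @ [T])"

lemma wp_push:
  assumes s: "sorted_input s" "flags 10 s T" "queue s Q" "T \<subseteq> V"
  shows "wp push (200 * jh) (\<lambda>t. queue t (add_new Q T)) s"
  unfolding push_def
proof (rule wp_Seq[where ?K2.0 = "130 * jh", OF wp_encode[OF s(1,2)]])
  show "\<forall>y<j. nat_mem s 16 y = 2 ^ y" using s(3) by (simp add: queue_def)
  fix s1 assume f1: "frame encode s s1" and q1: "nat_mem s1 17 0 = code T"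
  note m1 = frameD[OF f1, simplified]
  have i1: "sorted_input s1" using s(1) by (rule sorted_input_frame[OF _ f1]) auto
  have Q1: "queue s1 Q" by (rule queue_cong[OF s(3)]) (simp_all add: m1)
  have T1: "flags 10 s1 T" by (rule flags_cong[OF s(2)]) (simp add: m1)
  let ?b = "NLess (NConst 0) (NGet 19 (NVar 17))"
  have b: "beval ?b s1 \<longleftrightarrow> T \<in> set Q" using Q1 s(4) q1 by (simp add: queue_def)
  let ?s = "tick (1 + bcost ?b) s1"
  have Qt: "queue ?s Q" using Q1 by (rule queue_cong) simp_all
  show "wp (If ?b Skip enqueue) (130 * jh) (\<lambda>t. queue t (add_new Q T)) s1"
  proof (rule wp_If[where K = "100 * jh"])
    assume "beval ?b s1"
    then have e: "add_new Q T = Q" using b by (simp add: add_new_def)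
    have "queue (run Skip ?s) Q" using Qt by (rule queue_cong) simp_all
    then show "wp Skip (100 * jh) (\<lambda>t. queue t (add_new Q T)) ?s"
      unfolding e using jh_ge by (intro wp_run) simp_all
  next
    assume "\<not> beval ?b s1"
    then have n: "T \<notin> set Q" using b by simp
    then have e: "add_new Q T = Q @ [T]" by (simp add: add_new_def)
    show "wp enqueue (100 * jh) (\<lambda>t. queue t (add_new Q T)) ?s"
      unfolding e using i1 T1 q1 by (intro wp_enqueue[OF _ _ Qt s(4) n]) (simp_all add: sorted_input_def)
  qed (use jh_ge in simp)
qed simp

lemma wp_load:
  assumes s: "sorted_input s" "queue s Q" "nat_mem s 21 0 = (j + 1) * m" "m < length Q"
  shows "wp load (50 * jh) (\<lambda>t. flags 11 t (Q ! m)) s"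
proof -
  let ?c = "NSet 11 (NVar 23) (NGet 20 (NAdd (NVar 21) (NVar 23)))"
  let ?P = "\<lambda>k t :: state. \<forall>y<k. nat_mem t 11 y = (if p y \<in> Q ! m then 1 else 0)"
  have "wp load (50 * jh) (?P j) s"
    unfolding load_def
  proof (rule wp_For[where B = 20 and P = ?P and N = j])
    fix k t
    assume k: "k < j" "?P k t" "frame (For 23 point_count ?c) s t" "nat_mem t 23 0 = k"
    note mt = frameD[OF k(3), simplified]
    have "nat_mem t 20 (nat_mem t 21 0 + k) = (if p k \<in> Q ! m then 1 else 0)"
      using s(2-4) k(1) unfolding queue_def by (simp add: mt)
    then have "?P (Suc k) (run ?c t)" using k(2,4) by (simp add: less_Suc_eq)
    then show "wp ?c 20 (?P (Suc k)) t" by (intro wp_run) simp_all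
  qed (use sorted_input_counts[OF s(1)] jh_ge in \<open>simp_all\<close>)
  then show ?thesis by (simp add: flags_def)
qed

end

section \<open>The three programs\<close>

definition find_program :: com where
  "find_program = Seq prepare (Seq (extend 13) (output_set 10))"

definition read_set :: com where
  "read_set = For 5 (NGet 1 (NConst 0)) (NSet 11 (NGet 3 (NGet 1 (NAdd (NVar 5) (NConst 1)))) (NConst 1))"

definition neighbors_program :: com where
  "neighbors_program = Seq prepare (Seq read_set (process (output_set 10)))"

definition start :: com where
  "start = Seq prepare (Seq powers (Seq (extend 13) push))"

definition visit :: com where
  "visit = Seq load (Seq (NSet 21 (NConst 0) (NAdd (NVar 21) (NAdd point_count (NConst 1))))
     (Seq (output_set 11) (process push)))"

definition search :: com where
  "search = While (NLess (NVar 21) (NVar 22)) visit"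

lemma read_set_writes [simp]:
  "nat_writes read_set = {5, 11}" "real_writes read_set = {}" "silent read_set"
  by (auto simp: read_set_def)

lemma start_writes [simp]:
  "nat_writes start = {2, 3, 4, 5, 6, 7, 8, 9, 10, 16, 17, 18, 19, 20, 22, 23}" "silent start"
  by (auto simp: start_def)

context input
begin

definition initial :: "nat list list \<Rightarrow> state" where
  "initial ns = initial_state ([j, h] # ns) [map fst vs, map snd vs, map fst xs, map snd xs]"

lemma initial_simps:
  "raw_input (initial ns)" "buffer (initial ns) = []" "outputs (initial ns) = []" "clock (initial ns) = 0"
  "length ns < a \<Longrightarrow> nat_mem (initial ns) a i = 0"
  by (simp_all add: initial_def raw_input_def initial_state_def row_mem_def)

lemma flags_empty: "(\<And>i. nat_mem s a i = 0) \<Longrightarrow> flags a s {}"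
  by (simp add: flags_def)

lemma wp_find:
  "wp find_program (6000 * (jh * jh))
    (\<lambda>t. \<exists>ids S. map snd (outputs t) = [ids] \<and> denotes vs ids S \<and> maximal_obstacle_free V X S) (initial [])"
  unfolding find_program_def
proof (rule wp_Seq[OF wp_prepare[OF initial_simps(1)]])
  let ?s = "initial []"
  fix t assume f: "frame prepare ?s t" and q: "sorted_input t \<and> (\<forall>i<j. nat_mem t 3 i = lex_rank V (vs ! i))"
  note mt = frameD[OF f, simplified]
  have i: "sorted_input t" using q by simp
  have e: "flags 13 t {}" by (rule flags_empty) (simp add: mt initial_simps)
  show "wp (Seq (extend 13) (output_set 10)) (4600 * jh)
    (\<lambda>t. \<exists>ids S. map snd (outputs t) = [ids] \<and> denotes vs ids S \<and> maximal_obstacle_free V X S) t"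
  proof (rule wp_Seq[OF wp_extend[OF i e], where ?K2.0 = "50 * jh"])
    fix u assume f': "frame (extend 13) t u" and c: "current u (ext V X {})"
    note mu = frameD[OF f', simplified]
    have iu: "sorted_input u" using i by (rule sorted_input_frame[OF _ f']) auto
    have max: "maximal_obstacle_free V X (ext V X {})" by (simp add: ext_maximal)
    then have "ext V X {} \<subseteq> V" by (simp add: maximal_obstacle_free_def obstacle_free_def)
    then have d: "denotes vs (names u (ext V X {})) (ext V X {})" by (rule denotes_names[OF iu])
    have "wp (output_set 10) (50 * jh)
      (\<lambda>t. outputs t = outputs u @ [(clock t, names u (ext V X {}))] \<and> buffer t = []) u"
      using c by (intro wp_output_set[OF iu]) (simp_all add: current_def mu mt initial_simps)
    then show "wp (output_set 10) (50 * jh)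
      (\<lambda>t. \<exists>ids S. map snd (outputs t) = [ids] \<and> denotes vs ids S \<and> maximal_obstacle_free V X S) u"
      by (rule wp_mono) (use d max in \<open>auto simp: mu mt initial_simps\<close>)
  qed simp_all
next
  have "jh \<le> jh * jh" using jh_ge by simp
  then show "1000 * (jh * jh) + 4600 * jh \<le> 6000 * (jh * jh)" by linarith
qed

lemma wp_read_set:
  assumes s: "sorted_input s" "\<forall>i<j. nat_mem s 3 i = lex_rank V (vs ! i)"
    and ids: "denotes vs ids S" "nat_mem s 1 0 = length ids" "\<And>m. m < length ids \<Longrightarrow> nat_mem s 1 (Suc m) = ids ! m"
    and zero: "\<And>i. nat_mem s 11 i = 0"
  shows "wp read_set (50 * jh) (\<lambda>t. flags 11 t S) s"
proof -
  have d: "distinct ids" "set ids \<subseteq> {..<j}" "S = (\<lambda>i. vs ! i) ` set ids" using ids(1) by (auto simp: denotes_def)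
  let ?c = "NSet 11 (NGet 3 (NGet 1 (NAdd (NVar 5) (NConst 1)))) (NConst 1)"
  let ?r = "\<lambda>m. lex_rank V (vs ! (ids ! m))"
  let ?P = "\<lambda>k t :: state. \<forall>y. nat_mem t 11 y = (if \<exists>m<k. ?r m = y then 1 else 0)"
  have len: "length ids \<le> j"
    using card_mono[OF _ d(2)] distinct_card[OF d(1)] by simp
  have "wp read_set (50 * jh) (?P (length ids)) s"
    unfolding read_set_def
  proof (rule wp_For[where B = 20 and P = ?P and N = "length ids"])
    fix k t
    assume k: "k < length ids" "?P k t" "frame (For 5 (NGet 1 (NConst 0)) ?c) s t" "nat_mem t 5 0 = k"
    note mt = frameD[OF k(3), simplified]
    have "ids ! k < j" using d(2) nth_mem[OF k(1)] by auto
    then have "nat_mem (run ?c t) 11 = (nat_mem t 11)(?r k := 1)"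
      using s(2) ids(3)[OF k(1)] k(4) by (simp add: mt)
    then have "?P (Suc k) (run ?c t)" using k(2) by (auto simp: less_Suc_eq simp del: run.simps)
    then show "wp ?c 20 (?P (Suc k)) t" by (intro wp_run) simp_all
  next
    have "length ids + 1 \<le> jh" using len jh_ge(1) by linarith
    then show "(length ids + 1) * (20 + 14) \<le> 50 * jh" by simp
  qed (use ids(2) zero in \<open>simp_all\<close>)
  then show ?thesis
  proof (rule wp_mono)
    fix t assume q: "?P (length ids) t"
    have "(\<exists>m<length ids. ?r m = y) \<longleftrightarrow> p y \<in> S" if y: "y < j" for y
    proof
      assume "\<exists>m<length ids. ?r m = y"
      then obtain m where m: "m < length ids" "?r m = y" by blast
      have "ids ! m < j" using d(2) nth_mem[OF m(1)] by auto
      then have "p y = vs ! (ids ! m)" using pt_rank[of V "vs ! (ids ! m)"] m(2) by simp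
      then show "p y \<in> S" unfolding d(3) using nth_mem[OF m(1)] by simp
    next
      assume "p y \<in> S"
      then obtain i where i: "i \<in> set ids" "p y = vs ! i" unfolding d(3) by blast
      then obtain m where "m < length ids" "ids ! m = i" by (auto simp: in_set_conv_nth)
      moreover have "lex_rank V (p y) = y" using rank_pt(2)[of V y] y card_V by simp
      ultimately show "\<exists>m<length ids. ?r m = y" using i(2) by auto
    qed
    then show "flags 11 t S" using q by (simp add: flags_def)
  qed simp
qed

lemma wp_neighbors:
  assumes S: "maximal_obstacle_free V X S" "denotes vs ids S"
  shows "wp neighbors_program (22000 * (jh * jh))
    (\<lambda>t. list_all2 (denotes vs) (map snd (outputs t)) (nbr_list S)) (initial [length ids # ids])"
  unfolding neighbors_program_def
proof (rule wp_Seq[OF wp_prepare[OF initial_simps(1)]])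
  let ?s = "initial [length ids # ids]"
  let ?Inv = "\<lambda>L t :: state. buffer t = [] \<and> list_all2 (denotes vs) (map snd (outputs t)) L"
  have SV: "S \<subseteq> V" "convex hull S \<inter> X = {}"
    using S(1) by (auto simp: maximal_obstacle_free_def obstacle_free_def)
  fix t assume f: "frame prepare ?s t" and q: "sorted_input t \<and> (\<forall>i<j. nat_mem t 3 i = lex_rank V (vs ! i))"
  note mt = frameD[OF f, simplified]
  have i: "sorted_input t" using q by simp
  have 1: "nat_mem t 1 0 = length ids" "\<And>m. m < length ids \<Longrightarrow> nat_mem t 1 (Suc m) = ids ! m" "\<And>i. nat_mem t 11 i = 0"
    by (simp_all add: mt initial_def initial_state_def row_mem_def)
  show "wp (Seq read_set (process (output_set 10))) (20200 * (jh * jh))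
    (\<lambda>t. list_all2 (denotes vs) (map snd (outputs t)) (nbr_list S)) t"
  proof (rule wp_Seq[OF wp_read_set[OF i _ S(2) 1]])
    show "\<forall>i<j. nat_mem t 3 i = lex_rank V (vs ! i)" using q by simp
    fix u assume f': "frame read_set t u" and S': "flags 11 u S"
    note mu = frameD[OF f', simplified]
    have iu: "sorted_input u" using i by (rule sorted_input_frame[OF _ f']) auto
    have "wp (process (output_set 10)) ((2 * 50 + 20000) * (jh * jh)) (?Inv ([] @ nbr_list S)) u"
    proof (rule wp_process[OF iu S' SV])
      show "?Inv [] u" by (simp add: mu mt initial_simps)
    next
      fix L T and w :: state
      assume inv: "?Inv L w" and w: "sorted_input w" "current w T" and T: "maximal_obstacle_free V X T"
      have TV: "T \<subseteq> V" using T by (simp add: maximal_obstacle_free_def obstacle_free_def)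
      have "wp (output_set 10) (50 * jh)
          (\<lambda>t. outputs t = outputs w @ [(clock t, names w T)] \<and> buffer t = []) w"
        using w(2) inv by (intro wp_output_set[OF w(1)]) (simp_all add: current_def)
      then show "wp (output_set 10) (50 * jh) (?Inv (L @ [T])) w"
        by (rule wp_mono) (use inv denotes_names[OF w(1) TV] in \<open>auto intro!: list_all2_appendI\<close>)
    qed auto
    then show "wp (process (output_set 10)) (20100 * (jh * jh))
        (\<lambda>t. list_all2 (denotes vs) (map snd (outputs t)) (nbr_list S)) u"
      by (rule wp_mono) auto
  next
    have "jh \<le> jh * jh" using jh_ge by simp
    then show "50 * jh + 20100 * (jh * jh) \<le> 20200 * (jh * jh)" by linarith
  qed
qed simp

lemma add_new_fold:
  "distinct Q \<Longrightarrow> distinct (foldl add_new Q L)" "set (foldl add_new Q L) = set Q \<union> set L"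
  "\<exists>R. foldl add_new Q L = Q @ R"
proof (induction L arbitrary: Q)
  case (Cons T L)
  { case 1 then show ?case using Cons.IH(1)[of "add_new Q T"] by (auto simp: add_new_def) }
  { case 2 then show ?case using Cons.IH(2)[of "add_new Q T"] by (auto simp: add_new_def) }
  { case 3 then show ?case using Cons.IH(3)[of "add_new Q T"] by (auto simp: add_new_def) }
qed auto

abbreviation out_times :: "state \<Rightarrow> nat list" where
  "out_times s \<equiv> 0 # map fst (outputs s)"

definition gap :: nat where "gap = 22000 * (jh * jh)"

definition stage :: "point set list \<Rightarrow> nat \<Rightarrow> state \<Rightarrow> bool" where
  "stage Q m s \<longleftrightarrow> sorted_input s \<and> queue s Q \<and> nat_mem s 21 0 = (j + 1) * m \<and> m \<le> length Q \<and>
     Q \<noteq> [] \<and> distinct Q \<and> (\<forall>T\<in>set Q. maximal_obstacle_free V X T) \<and> buffer s = [] \<and>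
     list_all2 (denotes vs) (map snd (outputs s)) (take m Q) \<and>
     (\<forall>i<m. nbrs V X (Q ! i) \<subseteq> set Q) \<and>
     successively (\<lambda>a b. b \<le> a + gap) (out_times s) \<and> clock s \<le> last (out_times s) + 21000 * (jh * jh)"

lemma wp_visit:
  assumes st: "stage Q m s" and m: "m < length Q"
  shows "wp visit (30000 * (jh * jh)) (\<lambda>t. \<exists>Q'. stage Q' (Suc m) t) (tick 6 s)"
  unfolding visit_def
proof -
  let ?s = "tick 6 s" and ?S = "Q ! m"
  have s: "sorted_input ?s" "queue ?s Q" "nat_mem ?s 21 0 = (j + 1) * m" "buffer ?s = []"
    using st by (simp_all add: stage_def sorted_input_def queue_def)
  have Q: "distinct Q" "\<forall>T\<in>set Q. maximal_obstacle_free V X T"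
    "list_all2 (denotes vs) (map snd (outputs s)) (take m Q)" "\<forall>i<m. nbrs V X (Q ! i) \<subseteq> set Q"
    "successively (\<lambda>a b. b \<le> a + gap) (out_times s)" "clock s \<le> last (out_times s) + 21000 * (jh * jh)"
    using st by (simp_all add: stage_def)
  have "maximal_obstacle_free V X ?S" using Q(2) nth_mem[OF m] by blast
  then have S: "?S \<subseteq> V" "convex hull ?S \<inter> X = {}"
    by (auto simp: maximal_obstacle_free_def obstacle_free_def)
  have jj: "jh \<le> jh * jh" "1 \<le> jh * jh" using jh_ge by simp_all
  let ?adv = "NSet 21 (NConst 0) (NAdd (NVar 21) (NAdd point_count (NConst 1)))"
  let ?goal = "\<lambda>t. \<exists>Q'. stage Q' (Suc m) t"
  show "wp (Seq load (Seq ?adv (Seq (output_set 11) (process push)))) (30000 * (jh * jh)) ?goal ?s"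
  proof (rule wp_Seq[OF wp_load[OF s(1,2,3) m]])
    fix t1 assume f1: "frame load ?s t1" and c1: "clock t1 \<le> clock ?s + 50 * jh" and q1: "flags 11 t1 ?S"
    note m1 = frameD[OF f1, simplified]
    have i1: "sorted_input t1" using s(1) by (rule sorted_input_frame[OF _ f1]) auto
    have h1: "nat_mem t1 21 0 = (j + 1) * m" using s(3) by (simp add: m1)
    show "wp (Seq ?adv (Seq (output_set 11) (process push))) (21000 * (jh * jh)) ?goal t1"
    proof (rule wp_Seq[where ?K1.0 = 10 and ?Q1.0 = "\<lambda>t. nat_mem t 21 0 = (j + 1) * Suc m"])
      show "wp ?adv 10 (\<lambda>t. nat_mem t 21 0 = (j + 1) * Suc m) t1"
        using h1 sorted_input_counts[OF i1] by (intro wp_run) simp_all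
      fix t2 assume f2: "frame ?adv t1 t2" and c2: "clock t2 \<le> clock t1 + 10" and h2: "nat_mem t2 21 0 = (j + 1) * Suc m"
      note m2 = frameD[OF f2, simplified]
      have i2: "sorted_input t2" using i1 by (rule sorted_input_frame[OF _ f2]) auto
      have S2: "flags 11 t2 ?S" by (rule flags_cong[OF q1]) (simp add: m2)
      have o2: "outputs t2 = outputs s" "buffer t2 = []" using s(4) by (simp_all add: m1 m2)
      show "wp (Seq (output_set 11) (process push)) (20900 * (jh * jh)) ?goal t2"
      proof (rule wp_Seq[OF wp_output_set[OF i2 S2 _ o2(2)]])
        fix t3 assume f3: "frame (output_set 11) t2 t3" and c3: "clock t3 \<le> clock t2 + 50 * jh"
          and q3: "outputs t3 = outputs t2 @ [(clock t3, names t2 ?S)] \<and> buffer t3 = []"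
        note m3 = frameD(1)[OF f3, simplified]
        have i3: "sorted_input t3" using i2 by (rule sorted_input_frame[OF _ f3]) auto
        have S3: "flags 11 t3 ?S" by (rule flags_cong[OF S2]) (simp add: m3)
        have Q3: "queue t3 Q" by (rule queue_cong[OF s(2)]) (simp_all add: m1 m2 m3)
        have h3: "nat_mem t3 21 0 = (j + 1) * Suc m" using h2 by (simp add: m3)
        let ?Inv = "\<lambda>L t. queue t (foldl add_new Q L) \<and> buffer t = [] \<and> outputs t = outputs t3 \<and>
            nat_mem t 21 0 = (j + 1) * Suc m"
        have "wp (process push) ((2 * 200 + 20000) * (jh * jh)) (?Inv ([] @ nbr_list ?S)) t3"
        proof (rule wp_process[OF i3 S3 S])
          show "?Inv [] t3" using Q3 q3 h3 by simp
        next
          fix L T and w :: state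
          assume inv: "?Inv L w" and w: "sorted_input w" "current w T" and T: "maximal_obstacle_free V X T"
          have TV: "T \<subseteq> V" using T by (simp add: maximal_obstacle_free_def obstacle_free_def)
          have "wp push (200 * jh) (\<lambda>t. queue t (add_new (foldl add_new Q L) T)) w"
            using w inv TV by (intro wp_push) (simp_all add: current_def)
          then show "wp push (200 * jh) (?Inv (L @ [T])) w"
          proof (rule wp_mono)
            fix u assume fu: "frame push w u" and "queue u (add_new (foldl add_new Q L) T)"
            then show "?Inv (L @ [T]) u" using inv frameD[OF fu, simplified] by simp
          qed simp
        next
          fix L and w u :: state
          assume "?Inv L w" "\<And>a. a \<notin> {7, 8, 9, 10, 12, 13, 14, 15} \<Longrightarrow> nat_mem u a = nat_mem w a"
            "buffer u = buffer w" "outputs u = outputs w"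
          then show "?Inv L u" by (auto simp: queue_def)
        qed auto
        then show "wp (process push) (20400 * (jh * jh)) ?goal t3"
        proof (rule wp_mono)
          let ?Q = "foldl add_new Q (nbr_list ?S)"
          fix t assume f4: "frame (process push) t3 t" and c4: "clock t \<le> clock t3 + (2 * 200 + 20000) * (jh * jh)"
            and "?Inv ([] @ nbr_list ?S) t"
          then have q4: "queue t ?Q" "buffer t = []" "outputs t = outputs t3" "nat_mem t 21 0 = (j + 1) * Suc m"
            by simp_all
          have i4: "sorted_input t" using i3 by (rule sorted_input_frame[OF _ f4]) auto
          obtain R where R: "?Q = Q @ R" using add_new_fold(3) by blast
          have out: "outputs t = outputs s @ [(clock t3, names t2 ?S)]" using q3 q4 o2 by simp
          have set: "set ?Q = set Q \<union> nbrs V X ?S" by (simp add: add_new_fold(2) set_nbr_list)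
          have take: "take (Suc m) ?Q = take m Q @ [?S]" unfolding R using m by (simp add: take_Suc_conv_app_nth)
          have "stage ?Q (Suc m) t"
            unfolding stage_def
          proof (intro conjI)
            show "Suc m \<le> length ?Q" unfolding R using m by simp
            show "?Q \<noteq> []" unfolding R using m by auto
            show "distinct ?Q" by (rule add_new_fold(1)[OF Q(1)])
            show "\<forall>T\<in>set ?Q. maximal_obstacle_free V X T" unfolding set using Q(2) nbrs_maximal[of V] by blast
            show "list_all2 (denotes vs) (map snd (outputs t)) (take (Suc m) ?Q)"
              unfolding take out map_append
              using Q(3) denotes_names[OF i2 S(1)] by (intro list_all2_appendI) simp_all
            show "\<forall>i<Suc m. nbrs V X (?Q ! i) \<subseteq> set ?Q"
            proof (intro allI impI)
              fix i assume "i < Suc m"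
              then consider "i < m" | "i = m" by linarith
              then show "nbrs V X (?Q ! i) \<subseteq> set ?Q"
              proof cases
                case 1
                then have "?Q ! i = Q ! i" unfolding R using m by (simp add: nth_append)
                then show ?thesis using Q(4) 1 set by auto
              next
                case 2
                then have "?Q ! i = ?S" unfolding R using m by (simp add: nth_append)
                then show ?thesis using set by auto
              qed
            qed
            have "clock t3 \<le> clock s + 6 + 50 * jh + 10 + 50 * jh" using c1 c2 c3 by simp
            also have "\<dots> \<le> clock s + 200 * (jh * jh)" using jj by linarith
            finally have "clock t3 \<le> last (out_times s) + gap" using Q(6) unfolding gap_def by linarith
            moreover have ot: "out_times t = out_times s @ [clock t3]" by (simp add: out)
            ultimately show "successively (\<lambda>a b. b \<le> a + gap) (out_times t)"
              unfolding ot successively_append_iff using Q(5) by simp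
            show "clock t \<le> last (out_times t) + 21000 * (jh * jh)"
              unfolding ot using c4 by simp
          qed (use q4 i4 in simp_all)
          then show "?goal t" by blast
        qed simp
      qed (use jj in simp_all)
    qed (use jj in simp)
  qed (use jj in simp)
qed

lemma finite_solutions: "finite {S. maximal_obstacle_free V X S}"
  by (rule finite_subset[of _ "Pow V"]) (auto simp: maximal_obstacle_free_def obstacle_free_def)

lemma stage_bound: "stage Q m s \<Longrightarrow> length Q \<le> card {S. maximal_obstacle_free V X S}"
  using card_mono[OF finite_solutions, of "set Q"] distinct_card[of Q]
  unfolding stage_def by auto

lemma exec_search:
  "stage Q m s \<Longrightarrow> \<exists>t Q'. exec search s (tick 6 t) \<and> stage Q' (length Q') t"
proof (induction "card {S. maximal_obstacle_free V X S} - m" arbitrary: Q m s rule: less_induct)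
  case less
  let ?b = "NLess (NVar 21) (NVar 22)"
  have nm: "nat_mem s 21 0 = (j + 1) * m" "nat_mem s 22 0 = (j + 1) * length Q" "m \<le> length Q"
    using less.prems by (simp_all add: stage_def queue_def)
  then have b: "beval ?b s \<longleftrightarrow> m < length Q" by (simp del: mult_Suc)
  have six: "1 + bcost ?b = 6" by simp
  show ?case
  proof (cases "m < length Q")
    case True
    obtain t Q' where t: "exec visit (tick 6 s) t" "stage Q' (Suc m) t"
      using wp_visit[OF less.prems True] unfolding wp_def by blast
    have "card {S. maximal_obstacle_free V X S} - Suc m < card {S. maximal_obstacle_free V X S} - m"
      using stage_bound[OF less.prems] True by linarith
    from less.hyps[OF this t(2)] obtain u Q'' where u: "exec search t (tick 6 u)" "stage Q'' (length Q'') u"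
      by blast
    have "exec search s (tick 6 u)"
      unfolding search_def
    proof (rule exec_WhileTrue)
      show "beval ?b s" using b True by simp
      show "exec visit (tick (1 + bcost ?b) s) t" unfolding six by (rule t(1))
      show "exec (While ?b visit) t (tick 6 u)" using u(1) by (simp only: search_def)
    qed
    then show ?thesis using u(2) by blast
  next
    case False
    then have "\<not> beval ?b s" using b by simp
    from exec_WhileFalse[OF this, of visit] have "exec search s (tick 6 s)"
      unfolding six search_def .
    moreover have "m = length Q" using False nm(3) by simp
    ultimately show ?thesis using less.prems by blast
  qed
qed

lemma wp_start: "wp start (6000 * (jh * jh)) (\<lambda>t. stage [ext V X {}] 0 t) (initial [])"
  unfolding start_def
proof -
  let ?s = "initial []" and ?T = "ext V X {}"
  let ?Q = "\<lambda>t. queue t [?T] \<and> sorted_input t"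
  have max: "maximal_obstacle_free V X ?T" by (simp add: ext_maximal)
  then have TV: "?T \<subseteq> V" by (simp add: maximal_obstacle_free_def obstacle_free_def)
  have jj: "jh \<le> jh * jh" using jh_ge by simp
  have "wp (Seq prepare (Seq powers (Seq (extend 13) push))) (6000 * (jh * jh)) ?Q ?s"
  proof (rule wp_Seq[OF wp_prepare[OF initial_simps(1)]])
    fix t1 assume f1: "frame prepare ?s t1" and q1: "sorted_input t1 \<and> (\<forall>i<j. nat_mem t1 3 i = lex_rank V (vs ! i))"
    note m1 = frameD[OF f1, simplified]
    have i1: "sorted_input t1" using q1 by simp
    show "wp (Seq powers (Seq (extend 13) push)) (5000 * jh) ?Q t1"
    proof (rule wp_Seq[OF wp_powers[OF i1]])
      fix t2 assume f2: "frame powers t1 t2" and q2: "\<forall>y<j. nat_mem t2 16 y = 2 ^ y"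
      note m2 = frameD[OF f2, simplified]
      have i2: "sorted_input t2" using i1 by (rule sorted_input_frame[OF _ f2]) auto
      have e: "flags 13 t2 {}" by (rule flags_empty) (simp add: m1 m2 initial_simps)
      have Q2: "queue t2 []" using q2 by (simp add: queue_def m1 m2 initial_simps)
      show "wp (Seq (extend 13) push) (4800 * jh) ?Q t2"
      proof (rule wp_Seq[OF wp_extend[OF i2 e]])
        fix t3 assume f3: "frame (extend 13) t2 t3" and q3: "current t3 ?T"
        have i3: "sorted_input t3" using i2 by (rule sorted_input_frame[OF _ f3]) auto
        have Q3: "queue t3 []" by (rule queue_cong[OF Q2]) (simp_all add: frameD[OF f3, simplified])
        have "wp push (200 * jh) (\<lambda>t. queue t (add_new [] ?T)) t3"
          using q3 TV by (intro wp_push[OF i3 _ Q3]) (simp_all add: current_def)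
        then show "wp push (200 * jh) ?Q t3"
        proof (rule wp_mono)
          fix t assume f: "frame push t3 t" and "queue t (add_new [] ?T)"
          moreover have "sorted_input t" using i3 by (rule sorted_input_frame[OF _ f]) auto
          ultimately show "?Q t" by (simp add: add_new_def)
        qed simp
      qed simp_all
    qed simp
  qed (use jj in linarith)
  then show "wp (Seq prepare (Seq powers (Seq (extend 13) push))) (6000 * (jh * jh)) (\<lambda>t. stage [?T] 0 t) ?s"
  proof (rule wp_mono)
    fix t assume f: "frame (Seq prepare (Seq powers (Seq (extend 13) push))) ?s t"
      and c: "clock t \<le> clock ?s + 6000 * (jh * jh)" and q: "?Q t"
    note mt = frameD[OF f, simplified]
    show "stage [?T] 0 t" using q c max by (simp add: stage_def mt initial_simps)
  qed simp
qed

lemma delay_bound: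
  assumes "successively (\<lambda>a b. b \<le> a + D) (out_times s @ [clock s])"
  shows "delay s \<le> D"
proof -
  let ?ts = "out_times s @ [clock s]"
  let ?A = "{?ts ! Suc i - ?ts ! i | i. Suc i < length ?ts}"
  have "?A = (\<lambda>i. ?ts ! Suc i - ?ts ! i) ` {i. Suc i < length ?ts}" by blast
  moreover have "finite {i. Suc i < length ?ts}" by (rule finite_subset[of _ "{..<length ?ts}"]) auto
  ultimately have fin: "finite ?A" by simp
  have "Suc 0 < length ?ts" by simp
  then have ne: "?A \<noteq> {}" by blast
  have "\<forall>i. Suc i < length ?ts \<longrightarrow> ?ts ! Suc i \<le> ?ts ! i + D"
    using assms unfolding successively_conv_nth by blast
  then have "\<forall>x\<in>?A. x \<le> D" by fastforce
  then have "Max ?A \<le> D" using fin ne by simp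
  then show ?thesis by (simp add: delay_def Let_def)
qed

lemma exec_list:
  "\<exists>s Ss. exec (Seq start search) (initial []) s \<and> list_all2 (denotes vs) (map snd (outputs s)) Ss \<and>
     distinct Ss \<and> set Ss = {S. maximal_obstacle_free V X S} \<and> delay s \<le> gap"
proof -
  obtain s where s: "exec start (initial []) s" "stage [ext V X {}] 0 s"
    using wp_start unfolding wp_def by blast
  obtain t Q where t: "exec search s (tick 6 t)" "stage Q (length Q) t"
    using exec_search[OF s(2)] by blast
  have Q: "Q \<noteq> []" "distinct Q" "\<forall>T\<in>set Q. maximal_obstacle_free V X T"
    "list_all2 (denotes vs) (map snd (outputs t)) Q" "\<forall>i<length Q. nbrs V X (Q ! i) \<subseteq> set Q"
    "successively (\<lambda>a b. b \<le> a + gap) (out_times t)" "clock t \<le> last (out_times t) + 21000 * (jh * jh)"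
    using t(2) by (simp_all add: stage_def)
  have "set Q = {S. maximal_obstacle_free V X S}"
  proof (rule nbrs_reach[of V X])
    show "nbrs V X S \<subseteq> set Q" if "S \<in> set Q" for S
      using Q(5) that by (metis in_set_conv_nth)
  qed (use Q in auto)
  moreover have "delay (tick 6 t) \<le> gap"
  proof (rule delay_bound)
    have "1 \<le> jh * jh" using jh_ge by simp
    then have "clock t + 6 \<le> last (out_times t) + gap" using Q(7) unfolding gap_def by linarith
    then show "successively (\<lambda>a b. b \<le> a + gap) (out_times (tick 6 t) @ [clock (tick 6 t)])"
      unfolding successively_append_iff using Q(6) by simp
  qed
  ultimately show ?thesis
    using exec_Seq[OF s(1) t(1)] Q(2,4) by (intro exI[of _ "tick 6 t"] exI[of _ Q]) simp
qed

lemma jh_le: "jh * jh \<le> (j + h + 1) ^ 4"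
proof -
  have "jh \<le> (j + h + 1) * (j + h + 1)" unfolding jh_def by (intro mult_le_mono) auto
  then have "jh * jh \<le> ((j + h + 1) * (j + h + 1)) * ((j + h + 1) * (j + h + 1))" by (rule mult_le_mono) fact
  also have "\<dots> = (j + h + 1) ^ 4" by (simp only: power4_eq_xxxx mult.assoc)
  finally show ?thesis .
qed

end

lemma presentation_cases:
  assumes "(V, X) \<in> instances obstacle_free_hulls" "(us, ns, rs) \<in> presentations obstacle_free_hulls (V, X)"
  obtains xs where "input us xs" "V = set us" "X = set xs" "ns = [length us, length xs]"
    "rs = [map fst us, map snd us, map fst xs, map snd xs]"
  using assms by (auto simp: obstacle_free_hulls_def input_def)

lemma finds_solution_hulls: "finds_solution obstacle_free_hulls find_program (smult 6000 ([:1, 1:] ^ 4))"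
  unfolding finds_solution_def
proof (clarify)
  fix V X us ns rs
  assume "(V, X) \<in> instances obstacle_free_hulls" "(us, ns, rs) \<in> presentations obstacle_free_hulls (V, X)"
  then obtain xs where i: "input us xs" and e: "V = set us" "X = set xs" "ns = [length us, length xs]"
    "rs = [map fst us, map snd us, map fst xs, map snd xs]" by (rule presentation_cases)
  interpret input us xs by fact
  obtain s ids S where s: "exec find_program (initial []) s" "clock s \<le> clock (initial []) + 6000 * (jh * jh)"
    "map snd (outputs s) = [ids]" "denotes us ids S" "maximal_obstacle_free (set us) (set xs) S"
    using wp_find[unfolded wp_def] by (elim exE conjE)
  have "input_size obstacle_free_hulls (V, X) = j + h"
    using distinct by (simp add: obstacle_free_hulls_def e distinct_card)
  then have "6000 * (jh * jh) \<le> poly (smult 6000 ([:1, 1:] ^ 4)) (input_size obstacle_free_hulls (V, X))"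
    using jh_le by (simp add: add.commute)
  then have "clock s \<le> poly (smult 6000 ([:1, 1:] ^ 4)) (input_size obstacle_free_hulls (V, X))"
    by (rule le_trans[rotated]) (use s(2) in \<open>simp add: initial_simps\<close>)
  moreover have "exec find_program (initial_state [ns] rs) s" using s(1) by (simp add: initial_def e)
  moreover have "S \<in> solutions obstacle_free_hulls (V, X)"
    using s(5) by (simp add: obstacle_free_hulls_def e)
  ultimately show "\<exists>s ids S. exec find_program (initial_state [ns] rs) s \<and>
      clock s \<le> poly (smult 6000 ([:1, 1:] ^ 4)) (input_size obstacle_free_hulls (V, X)) \<and>
      map snd (outputs s) = [ids] \<and> denotes us ids S \<and> S \<in> solutions obstacle_free_hulls (V, X)"
    using s(3,4) by - (rule exI[of _ s], rule exI[of _ ids], rule exI[of _ S], intro conjI)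
qed

lemma computes_neighbors_hulls:
  "computes_neighbors obstacle_free_hulls (\<lambda>(V, X). nbrs V X) neighbors_program (smult 22000 ([:1, 1:] ^ 4))"
  unfolding computes_neighbors_def
proof (clarify)
  fix V X us ns rs S ids
  assume "(V, X) \<in> instances obstacle_free_hulls" "(us, ns, rs) \<in> presentations obstacle_free_hulls (V, X)"
    and S: "S \<in> solutions obstacle_free_hulls (V, X)" and d: "denotes us ids S"
  then obtain xs where i: "input us xs" and e: "V = set us" "X = set xs" "ns = [length us, length xs]"
    "rs = [map fst us, map snd us, map fst xs, map snd xs]" by (elim presentation_cases)
  interpret input us xs by fact
  have "maximal_obstacle_free (set us) (set xs) S" using S by (simp add: obstacle_free_hulls_def e)
  from wp_neighbors[OF this d]
  obtain s where s: "exec neighbors_program (initial [length ids # ids]) s"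
    "clock s \<le> clock (initial [length ids # ids]) + 22000 * (jh * jh)"
    "list_all2 (denotes us) (map snd (outputs s)) (nbr_list S)"
    unfolding wp_def by blast
  have "input_size obstacle_free_hulls (V, X) = j + h"
    using distinct by (simp add: obstacle_free_hulls_def e distinct_card)
  then have "22000 * (jh * jh) \<le> poly (smult 22000 ([:1, 1:] ^ 4)) (input_size obstacle_free_hulls (V, X))"
    using jh_le by (simp add: add.commute)
  then have "clock s \<le> poly (smult 22000 ([:1, 1:] ^ 4)) (input_size obstacle_free_hulls (V, X))"
    by (rule le_trans[rotated]) (use s(2) in \<open>simp add: initial_simps\<close>)
  moreover have "exec neighbors_program (initial_state [ns, length ids # ids] rs) s"
    using s(1) by (simp add: initial_def e)
  moreover have "set (nbr_list S) = nbrs V X S" by (simp add: set_nbr_list e)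
  ultimately show "\<exists>s Ss. exec neighbors_program (initial_state [ns, length ids # ids] rs) s \<and>
      clock s \<le> poly (smult 22000 ([:1, 1:] ^ 4)) (input_size obstacle_free_hulls (V, X)) \<and>
      list_all2 (denotes us) (map snd (outputs s)) Ss \<and> set Ss = nbrs V X S"
    using s(3) by - (rule exI[of _ s], rule exI[of _ "nbr_list S"], intro conjI)
qed

lemma proximity_searchable_hulls: "proximity_searchable obstacle_free_hulls"
  unfolding proximity_searchable_def
proof (rule exI[of _ "\<lambda>I S T. S \<inter> T"], rule exI[of _ "\<lambda>(V, X). nbrs V X"], intro conjI ballI)
  fix I assume "I \<in> instances obstacle_free_hulls"
  then obtain V X where I: "I = (V, X)" "finite V" "finite X" by (auto simp: obstacle_free_hulls_def)
  fix S assume S: "S \<in> solutions obstacle_free_hulls I"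
  then have SV: "maximal_obstacle_free V X S" by (simp add: obstacle_free_hulls_def I)
  show "(case I of (V, X) \<Rightarrow> nbrs V X) S \<subseteq> solutions obstacle_free_hulls I"
    using nbrs_maximal[OF I(2)] by (auto simp: obstacle_free_hulls_def I)
  fix T assume "T \<in> solutions obstacle_free_hulls I"
  then have TV: "maximal_obstacle_free V X T" by (simp add: obstacle_free_hulls_def I)
  show "S \<inter> T \<subseteq> universe obstacle_free_hulls I"
    using SV by (auto simp: obstacle_free_hulls_def I maximal_obstacle_free_def obstacle_free_def)
  show "S \<noteq> T \<longrightarrow> (\<exists>S'\<in>(case I of (V, X) \<Rightarrow> nbrs V X) S.
      card (S \<inter> T) < card (S' \<inter> T))"
    using nbrs_closer[OF I(2,3) SV TV] by (simp add: I)
qed (use finds_solution_hulls computes_neighbors_hulls in blast)+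

definition delay_limit :: "point set \<times> point set \<Rightarrow> real" where
  "delay_limit = (\<lambda>(V, X). 22000 * ((real (card V) + 1) * (real (card X) + 1))\<^sup>2)"

lemma listable_hulls: "listable_with_delay obstacle_free_hulls delay_limit"
  unfolding listable_with_delay_def
proof (intro exI[of _ "Seq start search"] ballI, clarify)
  fix V X us ns rs
  assume "(V, X) \<in> instances obstacle_free_hulls" "(us, ns, rs) \<in> presentations obstacle_free_hulls (V, X)"
  then obtain xs where i: "input us xs" and e: "V = set us" "X = set xs" "ns = [length us, length xs]"
    "rs = [map fst us, map snd us, map fst xs, map snd xs]" by (rule presentation_cases)
  interpret input us xs by fact
  have "real gap = 22000 * ((real j + 1) * (real h + 1))\<^sup>2"
    by (simp add: gap_def jh_def power2_eq_square algebra_simps)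
  then have g: "real gap = delay_limit (V, X)"
    using distinct by (simp add: delay_limit_def e distinct_card)
  obtain s Ss where "exec (Seq start search) (initial []) s"
    "list_all2 (denotes us) (map snd (outputs s)) Ss" "distinct Ss"
    "set Ss = {S. maximal_obstacle_free V X S}" "delay s \<le> gap"
    using exec_list unfolding e by blast
  moreover from this(5) have "real (delay s) \<le> delay_limit (V, X)" unfolding g[symmetric] by simp
  ultimately show "\<exists>s Ss. exec (Seq start search) (initial_state [ns] rs) s \<and>
      list_all2 (denotes us) (map snd (outputs s)) Ss \<and> distinct Ss \<and>
      set Ss = solutions obstacle_free_hulls (V, X) \<and> real (delay s) \<le> delay_limit (V, X)"
    by (intro exI[of _ s] exI[of _ Ss]) (simp add: initial_def e obstacle_free_hulls_def)
qed

lemma delay_limit_obstacles: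
  assumes "1 \<le> card V" "1 \<le> card X"
  shows "delay_limit (V, X) \<le> 352000 *
    (real (card V) ^ 2 * real (card X) * (real (card X) + log 2 (real (card V))))"
proof -
  let ?j = "real (card V)" and ?h = "real (card X)"
  have jh: "?j \<ge> 1" "?h \<ge> 1" using assms by simp_all
  then have "(?j + 1) * (?h + 1) \<le> (2 * ?j) * (2 * ?h)" by (intro mult_mono) auto
  then have "((?j + 1) * (?h + 1))\<^sup>2 \<le> ((2 * ?j) * (2 * ?h))\<^sup>2" using jh by (intro power_mono) auto
  also have "\<dots> = 16 * (?j ^ 2 * ?h * ?h)" by (simp add: power2_eq_square)
  also have "?j ^ 2 * ?h * ?h \<le> ?j ^ 2 * ?h * (?h + log 2 ?j)"
    using jh by (intro mult_left_mono) auto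
  finally have "((?j + 1) * (?h + 1))\<^sup>2 \<le> 16 * (?j ^ 2 * ?h * (?h + log 2 ?j))" by simp
  moreover have "22000 * a \<le> 352000 * b" if "a \<le> 16 * b" for a b :: real using that by linarith
  ultimately show ?thesis unfolding delay_limit_def prod.case by blast
qed

lemma delay_limit_total:
  assumes "1 \<le> card V + card X"
  shows "delay_limit (V, X) \<le> 352000 * real (card V + card X) ^ 4"
proof -
  let ?j = "real (card V)" and ?h = "real (card X)" and ?n = "real (card V + card X)"
  have n: "?n \<ge> 1" using assms by linarith
  have "(?j + 1) * (?h + 1) \<le> (2 * ?n) * (2 * ?n)" using n by (intro mult_mono) auto
  then have "((?j + 1) * (?h + 1))\<^sup>2 \<le> ((2 * ?n) * (2 * ?n))\<^sup>2" by (intro power_mono) auto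
  also have "((2 * x) * (2 * x))\<^sup>2 = 16 * x ^ 4" for x :: real
    by (simp add: power2_eq_square power4_eq_xxxx)
  finally show ?thesis by (simp add: delay_limit_def)
qed

theorem theorem9p2:
  shows "proximity_searchable obstacle_free_hulls \<and>
    (\<exists>D C. listable_with_delay obstacle_free_hulls D \<and>
      (\<forall>V X. finite V \<and> finite X \<longrightarrow>
        (let j = card V; h = card X; n = j + h in
          (j \<ge> 1 \<and> h \<ge> 1 \<longrightarrow>
            D (V, X) \<le> C * (real j ^ 2 * real h * (real h + log 2 (real j)))) \<and>
          (n \<ge> 1 \<longrightarrow> D (V, X) \<le> C * real n ^ 4))))"
  unfolding Let_def
  using proximity_searchable_hulls listable_hulls delay_limit_obstacles delay_limit_total by blast

end
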